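(* Let $X$ be a complex Hilbert space, $Y$ a Hilbert space, $A_0:\mathcal{D}(A_0)\to X$ a strictly positive self-adjoint operator and $C\in\mathcal{L}(X,Y)$ such that $C^*C\in\mathcal{L}(\mathcal{D}(A_0^2))\cap\mathcal{L}(\mathcal{D}(A_0))$. Assume that the pair $(iA_0,C)$ is exactly observable in time $\tau>0$ and set $\eta:=\|\mathbb{L}_\tau\|_{\mathcal{L}(X)}<1$. Let $(X_h)_{h>0}$ be a family of finite-dimensional subspaces of $\mathcal{D}(A_0^{1/2})$ satisfying the approximation property stated in the context with exponent $\theta>0$. Let $z_0\in\mathcal{D}(A_0^2)$ be the initial value of the system $\dot z(t)=iA_0z(t)$ for $t\ge 0$, $z(0)=z_0$, with output $y(t)=Cz(t)$ for $t\in[0,\tau]$, let $y_h\in L^1([0,\tau],Y)$ be an approximation of $y$, let $N_h$ be a positive integer (truncation parameter), and let $$z_{0,h}=\sum_{n=0}^{N_h}\mathbb{L}_{h,\tau}^{n}\,z_h^-(0).$$ Then there exist $M>0$ (independent of $\tau$, of $z_0$ and of the discretization parameter $h$) and $h^*>0$ such that for all $h\in(0,h^* )$ $$\|z_0-z_{0,h}\|\le M\left[\left(\frac{\eta^{N_h+1}}{1-\eta}+h^\theta\tau N_h^2\right)\|z_0\|_2+N_h\int_0^\tau\|C^*(y(s)-y_h(s))\|\,ds\right].$$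
   Context: Notation. $\langle\cdot,\cdot\rangle$ and $\|\cdot\|$ are the inner product and norm of $X$; $\|\varphi\|_\alpha=\|A_0^\alpha\varphi\|$ is the norm of $\mathcal{D}(A_0^\alpha)$, and $\langle\varphi,\psi\rangle_{1/2}=\langle A_0^{1/2}\varphi,A_0^{1/2}\psi\rangle$. The dot denotes the time derivative. Exact observability of $(iA_0,C)$ in time $\tau$: there is $k_\tau>0$ such that $\int_0^\tau\|y(t)\|^2dt\ge k_\tau^2\|z_0\|^2$ for all $z_0\in\mathcal{D}(A_0)$, where $y(t)=Cz(t)$, $\dot z=iA_0z$, $z(0)=z_0$. Semigroups. $\mathbb{T}^+$ and $\mathbb{T}^-$ are the $C_0$-semigroups on $X$ generated by $iA_0-C^*C$ and $-iA_0-C^*C$ respectively, and $\mathbb{L}_\tau=\mathbb{T}^-_\tau\mathbb{T}^+_\tau$. Under exact observability in time $\tau$ it is known that $\|\mathbb{L}_\tau\|_{\mathcal{L}(X)}<1$. Galerkin spaces. $X_h\subset\mathcal{D}(A_0^{1/2})$ is endowed with the norm of $X$. $\pi_h$ is the orthogonal projection from $\mathcal{D}(A_0^{1/2})$ (with inner product $\langle\cdot,\cdot\rangle_{1/2}$) onto $X_h$. Approximation property: there exist $M>0$, $\theta>0$, $h^*>0$ such that $\|\pi_h\varphi-\varphi\|\le Mh^\theta\|\varphi\|_{1/2}$ for all $\varphi\in\mathcal{D}(A_0^{1/2})$ and all $h\in(0,h^* )$. Discrete semigroups. For $q_0\in\mathcal{D}(A_0^{1/2})$, $\mathbb{T}^\pm_{h,t}q_0:=q_h(t)$,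 where $q_h:[0,\tau]\to X_h$ is the unique solution of $$\langle\dot q_h(t),\varphi_h\rangle=\pm i\langle q_h(t),\varphi_h\rangle_{1/2}-\langle C^*Cq_h(t),\varphi_h\rangle\quad\forall\varphi_h\in X_h,\qquad q_h(0)=\pi_hq_0$$ (with the corresponding sign), and $\mathbb{L}_{h,\tau}=\mathbb{T}^-_{h,\tau}\mathbb{T}^+_{h,\tau}$. Discrete observers. $z_h^+,z_h^-:[0,\tau]\to X_h$ satisfy, for all $\varphi_h\in X_h$ and $t\in[0,\tau]$, $$\langle\dot z_h^+(t),\varphi_h\rangle=i\langle z_h^+(t),\varphi_h\rangle_{1/2}-\langle C^*Cz_h^+(t),\varphi_h\rangle+\langle C^*y_h(t),\varphi_h\rangle,\quad z_h^+(0)=0,$$ $$\langle\dot z_h^-(t),\varphi_h\rangle=i\langle z_h^-(t),\varphi_h\rangle_{1/2}+\langle C^*Cz_h^-(t),\varphi_h\rangle-\langle C^*y_h(t),\varphi_h\rangle,\quad z_h^-(\tau)=z_h^+(\tau).$$ *)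

theory Defs
  imports "HOL-Analysis.Analysis"
begin

section \<open>Complex Hilbert spaces\<close>

text \<open>
  The real structure (norm, topology, real inner product) is the library's one; the complex inner
  product is linear in the \<^emph>\<open>first\<close> argument, and its real part is the real inner product, so that
  \<open>cinner x x = of_real ((norm x)\<^sup>2)\<close>.
\<close>

class complex_hilbert = real_inner + banach +
  fixes scaleC :: "complex \<Rightarrow> 'a \<Rightarrow> 'a" (infixr "*\<^sub>C" 75)
    and cinner :: "'a \<Rightarrow> 'a \<Rightarrow> complex"
  assumes scaleC_add_right: "a *\<^sub>C (x + y) = a *\<^sub>C x + a *\<^sub>C y"
    and scaleC_add_left: "(a + b) *\<^sub>C x = a *\<^sub>C x + b *\<^sub>C x"
    and scaleC_scaleC: "a *\<^sub>C (b *\<^sub>C x) = (a * b) *\<^sub>C x"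
    and scaleC_of_real: "complex_of_real r *\<^sub>C x = r *\<^sub>R x"
    and cinner_add_left: "cinner (x + y) z = cinner x z + cinner y z"
    and cinner_scaleC_left: "cinner (a *\<^sub>C x) y = a * cinner x y"
    and cinner_commute: "cinner x y = cnj (cinner y x)"
    and Re_cinner: "Re (cinner x y) = inner x y"

global_interpretation complex_vector:
  vector_space "scaleC :: complex \<Rightarrow> 'a \<Rightarrow> 'a :: complex_hilbert"
proof
  fix x :: 'a
  show "1 *\<^sub>C x = x"
    using scaleC_of_real[of 1 x] by simp
qed (simp_all add: scaleC_add_right scaleC_add_left scaleC_scaleC)


section \<open>Bounded and unbounded operators\<close>

definition bounded_clinear :: "('a::complex_hilbert \<Rightarrow> 'b::complex_hilbert) \<Rightarrow> bool" where
  "bounded_clinear f \<longleftrightarrow> bounded_linear f \<and> (\<forall>a x. f (a *\<^sub>C x) = a *\<^sub>C f x)"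

definition cadjoint :: "('a::complex_hilbert \<Rightarrow> 'b::complex_hilbert) \<Rightarrow> 'b \<Rightarrow> 'a" where
  "cadjoint f = (THE g. \<forall>x y. cinner (f x) y = cinner x (g y))"

text \<open>
  An unbounded operator is given by its domain \<open>D\<close> and a function \<open>A\<close>, of which only the values on
  \<open>D\<close> are meaningful.
\<close>

definition linear_operator :: "'a::complex_hilbert set \<Rightarrow> ('a \<Rightarrow> 'a) \<Rightarrow> bool" where
  "linear_operator D A \<longleftrightarrow> complex_vector.subspace D \<and>
     (\<forall>x\<in>D. \<forall>y\<in>D. A (x + y) = A x + A y) \<and> (\<forall>a. \<forall>x\<in>D. A (a *\<^sub>C x) = a *\<^sub>C A x)"

text \<open>Densely defined, and the graph of the adjoint is the graph of \<open>A\<close> (domains included).\<close>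

definition selfadjoint_operator :: "'a::complex_hilbert set \<Rightarrow> ('a \<Rightarrow> 'a) \<Rightarrow> bool" where
  "selfadjoint_operator D A \<longleftrightarrow> linear_operator D A \<and> closure D = UNIV \<and>
     (\<forall>y w. (\<forall>x\<in>D. cinner (A x) y = cinner x w) \<longleftrightarrow> y \<in> D \<and> w = A y)"

definition positive_operator :: "'a::complex_hilbert set \<Rightarrow> ('a \<Rightarrow> 'a) \<Rightarrow> bool" where
  "positive_operator D A \<longleftrightarrow> (\<forall>x\<in>D. 0 \<le> Re (cinner (A x) x))"

definition strictly_positive_operator :: "'a::complex_hilbert set \<Rightarrow> ('a \<Rightarrow> 'a) \<Rightarrow> bool" where
  "strictly_positive_operator D A \<longleftrightarrow> (\<exists>m>0. \<forall>x\<in>D. m * (norm x)\<^sup>2 \<le> Re (cinner (A x) x))"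

definition square_dom :: "'a::complex_hilbert set \<Rightarrow> ('a \<Rightarrow> 'a) \<Rightarrow> 'a set" where
  "square_dom D A = {x \<in> D. A x \<in> D}"

text \<open>
  \<open>(Dh, Ah)\<close> is the square root of \<open>(D, A)\<close>. For a positive self-adjoint \<open>(D, A)\<close> it exists, and it
  is unique up to the irrelevant values of \<open>Ah\<close> outside \<open>Dh\<close>.
\<close>

definition sqrt_operator ::
    "'a::complex_hilbert set \<Rightarrow> ('a \<Rightarrow> 'a) \<Rightarrow> 'a set \<Rightarrow> ('a \<Rightarrow> 'a) \<Rightarrow> bool" where
  "sqrt_operator D A Dh Ah \<longleftrightarrow> selfadjoint_operator Dh Ah \<and> positive_operator Dh Ah \<and>
     D = square_dom Dh Ah \<and> (\<forall>x\<in>D. A x = Ah (Ah x))"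

text \<open>\<open>R\<close> restricts to a bounded operator on the space \<open>D\<close> normed by \<open>N\<close>.\<close>

definition bounded_on_domain ::
    "'a::complex_hilbert set \<Rightarrow> ('a \<Rightarrow> real) \<Rightarrow> ('a \<Rightarrow> 'a) \<Rightarrow> bool" where
  "bounded_on_domain D N R \<longleftrightarrow> R ` D \<subseteq> D \<and> (\<exists>K. \<forall>x\<in>D. N (R x) \<le> K * N x)"


section \<open>Semigroups, the observed system and exact observability\<close>

definition C0_semigroup :: "(real \<Rightarrow> 'a::complex_hilbert \<Rightarrow> 'a) \<Rightarrow> bool" where
  "C0_semigroup T \<longleftrightarrow> (\<forall>t\<ge>0. bounded_clinear (T t)) \<and> T 0 = id \<and>
     (\<forall>s\<ge>0. \<forall>t\<ge>0. T (s + t) = T s \<circ> T t) \<and> (\<forall>x. ((\<lambda>t. T t x) \<longlongrightarrow> x) (at_right 0))"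

definition generates ::
    "'a::complex_hilbert set \<Rightarrow> ('a \<Rightarrow> 'a) \<Rightarrow> (real \<Rightarrow> 'a \<Rightarrow> 'a) \<Rightarrow> bool" where
  "generates D G T \<longleftrightarrow> C0_semigroup T \<and>
     (\<forall>x w. ((\<lambda>t. (T t x - x) /\<^sub>R t) \<longlongrightarrow> w) (at_right 0) \<longleftrightarrow> x \<in> D \<and> w = G x)"

text \<open>Classical solutions of \<open>z' = i A z\<close> on \<open>[0, \<infinity>)\<close>.\<close>

definition system_solution ::
    "'a::complex_hilbert set \<Rightarrow> ('a \<Rightarrow> 'a) \<Rightarrow> 'a \<Rightarrow> (real \<Rightarrow> 'a) \<Rightarrow> bool" where
  "system_solution D A z0 z \<longleftrightarrow> z 0 = z0 \<and>
     (\<forall>t\<ge>0. z t \<in> D \<and> (z has_vector_derivative \<i> *\<^sub>C A (z t)) (at t within {0..}))"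

definition exactly_observable ::
    "'a::complex_hilbert set \<Rightarrow> ('a \<Rightarrow> 'a) \<Rightarrow> ('a \<Rightarrow> 'b::complex_hilbert) \<Rightarrow> real \<Rightarrow> bool" where
  "exactly_observable D A C \<tau> \<longleftrightarrow>
     (\<exists>k>0. \<forall>z0\<in>D. \<forall>z. system_solution D A z0 z \<longrightarrow>
        (LINT t:{0..\<tau>}|lebesgue. (norm (C (z t)))\<^sup>2) \<ge> k\<^sup>2 * (norm z0)\<^sup>2)"

text \<open>
  \<open>L\<^sup>1\<close> functions on \<open>S\<close> in the sense of Bochner. The library's \<open>set_integrable\<close> requires a second
  countable codomain, whereas the output space need not be separable.
\<close>

definition L1_on :: "real set \<Rightarrow> (real \<Rightarrow> 'b::complex_hilbert) \<Rightarrow> bool" where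
  "L1_on S f \<longleftrightarrow>
     (\<exists>s. (\<forall>n::nat. simple_function (lebesgue_on S) (s n)) \<and>
          (AE t in lebesgue_on S. (\<lambda>n. s n t) \<longlonglongrightarrow> f t)) \<and>
     integrable (lebesgue_on S) (\<lambda>t. norm (f t))"


section \<open>Galerkin approximation\<close>

text \<open>Below, \<open>Ah\<close> is the square root of the operator \<open>A\<close> and \<open>V\<close> a Galerkin space.\<close>

definition inner_half :: "('a::complex_hilbert \<Rightarrow> 'a) \<Rightarrow> 'a \<Rightarrow> 'a \<Rightarrow> complex" where
  "inner_half Ah x y = cinner (Ah x) (Ah y)"

definition galerkin_space :: "'a::complex_hilbert set \<Rightarrow> 'a set \<Rightarrow> bool" where
  "galerkin_space Dh V \<longleftrightarrow> V \<subseteq> Dh \<and> (\<exists>S. finite S \<and> V = complex_vector.span S)"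

definition galerkin_proj ::
    "('a::complex_hilbert \<Rightarrow> 'a) \<Rightarrow> 'a set \<Rightarrow> 'a \<Rightarrow> 'a" where
  "galerkin_proj Ah V \<phi> = (THE p. p \<in> V \<and> (\<forall>\<psi>\<in>V. inner_half Ah (\<phi> - p) \<psi> = 0))"

definition approximation_property ::
    "'a::complex_hilbert set \<Rightarrow> ('a \<Rightarrow> 'a) \<Rightarrow> (real \<Rightarrow> 'a set) \<Rightarrow> real \<Rightarrow> bool" where
  "approximation_property Dh Ah X \<theta> \<longleftrightarrow>
     (\<exists>M>0. \<exists>hs>0. \<forall>\<phi>\<in>Dh. \<forall>h\<in>{0<..<hs}.
        norm (galerkin_proj Ah (X h) \<phi> - \<phi>) \<le> M * h powr \<theta> * norm (Ah \<phi>))"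

text \<open>The sign \<open>\<sigma>\<close> is \<open>1\<close> for the forward and \<open>-1\<close> for the backward discrete semigroup.\<close>

definition discrete_solution ::
    "complex \<Rightarrow> ('a::complex_hilbert \<Rightarrow> 'a) \<Rightarrow> ('a \<Rightarrow> 'b::complex_hilbert) \<Rightarrow> 'a set \<Rightarrow> real \<Rightarrow>
     'a \<Rightarrow> (real \<Rightarrow> 'a) \<Rightarrow> bool" where
  "discrete_solution \<sigma> Ah C V \<tau> q0 q \<longleftrightarrow>
     (\<forall>t\<in>{0..\<tau>}. q t \<in> V) \<and> q 0 = galerkin_proj Ah V q0 \<and>
     (\<forall>t\<in>{0..\<tau>}. \<exists>q'. (q has_vector_derivative q') (at t within {0..\<tau>}) \<and>
        (\<forall>\<phi>\<in>V. cinner q' \<phi> =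
           \<sigma> * \<i> * inner_half Ah (q t) \<phi> - cinner (cadjoint C (C (q t))) \<phi>))"

definition discrete_semigroup ::
    "complex \<Rightarrow> ('a::complex_hilbert \<Rightarrow> 'a) \<Rightarrow> ('a \<Rightarrow> 'b::complex_hilbert) \<Rightarrow> 'a set \<Rightarrow> real \<Rightarrow>
     real \<Rightarrow> 'a \<Rightarrow> 'a" where
  "discrete_semigroup \<sigma> Ah C V \<tau> t q0 =
     (THE v. \<exists>q. discrete_solution \<sigma> Ah C V \<tau> q0 q \<and> v = q t)"

definition discrete_L ::
    "('a::complex_hilbert \<Rightarrow> 'a) \<Rightarrow> ('a \<Rightarrow> 'b::complex_hilbert) \<Rightarrow> 'a set \<Rightarrow> real \<Rightarrow> 'a \<Rightarrow> 'a" where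
  "discrete_L Ah C V \<tau> =
     discrete_semigroup (-1) Ah C V \<tau> \<tau> \<circ> discrete_semigroup 1 Ah C V \<tau> \<tau>"

text \<open>
  The data \<open>y\<^sub>h\<close> of the observers are only in \<open>L\<^sup>1\<close>, so \<open>\<langle>z' t, \<phi>\<rangle> = F t (z t) \<phi>\<close> is understood in the
  sense of Caratheodory, i.e. in time-integrated form. A solution for which the equation holds
  pointwise is a special case.
\<close>

definition caratheodory_solution ::
    "'a::complex_hilbert set \<Rightarrow> real \<Rightarrow> (real \<Rightarrow> 'a \<Rightarrow> 'a \<Rightarrow> complex) \<Rightarrow> (real \<Rightarrow> 'a) \<Rightarrow> bool" where
  "caratheodory_solution V \<tau> F z \<longleftrightarrow>
     (\<forall>t\<in>{0..\<tau>}. z t \<in> V) \<and> continuous_on {0..\<tau>} z \<and>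
     (\<forall>\<phi>\<in>V. \<forall>t\<in>{0..\<tau>}.
        cinner (z t) \<phi> - cinner (z 0) \<phi> = (LINT s:{0..t}|lebesgue. F s (z s) \<phi>))"

definition discrete_observers ::
    "('a::complex_hilbert \<Rightarrow> 'a) \<Rightarrow> ('a \<Rightarrow> 'b::complex_hilbert) \<Rightarrow> 'a set \<Rightarrow> real \<Rightarrow> (real \<Rightarrow> 'b) \<Rightarrow>
     (real \<Rightarrow> 'a) \<Rightarrow> (real \<Rightarrow> 'a) \<Rightarrow> bool" where
  "discrete_observers Ah C V \<tau> yh zp zm \<longleftrightarrow>
     caratheodory_solution V \<tau>
       (\<lambda>t v \<phi>. \<i> * inner_half Ah v \<phi> - cinner (cadjoint C (C v)) \<phi> + cinner (cadjoint C (yh t)) \<phi>) zp \<and>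
     zp 0 = 0 \<and>
     caratheodory_solution V \<tau>
       (\<lambda>t v \<phi>. \<i> * inner_half Ah v \<phi> + cinner (cadjoint C (C v)) \<phi> - cinner (cadjoint C (yh t)) \<phi>) zm \<and>
     zm \<tau> = zp \<tau>"

end

theory Submission
  imports Defs
begin

text \<open>
  Write \<open>B = C\<^sup>* C\<close>, \<open>L = T\<^sup>-\<^sub>\<tau> T\<^sup>+\<^sub>\<tau>\<close> and \<open>\<pi>\<close> for the Galerkin projection, and let \<open>L\<^sub>h\<close>
  be the discrete forward-backward operator on the Galerkin space. The error of the forward observer
  with exact data starts at \<open>-z\<^sub>0\<close> and is transported by \<open>T\<^sup>+\<close>; the error of the backward observer, read
  backwards in time, is transported by \<open>T\<^sup>-\<close>. So one forward-backward sweep maps the unknown \<open>z\<^sub>0\<close> to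
  \<open>(I - L) z\<^sub>0\<close>, and a truncated Neumann series inverts \<open>I - L\<close>. The same computation in the Galerkin
  space (\<open>observer_error\<close>) gives \<open>z\<^sub>h\<^sup>-(0) = \<pi> z\<^sub>0 - L\<^sub>h \<pi> z\<^sub>0 + r\<close>, where \<open>r\<close> collects the data error and
  the consistency error. The Neumann sum telescopes, and
  \<open>z\<^sub>0 - z\<^sub>0\<^sub>,\<^sub>h = (z\<^sub>0 - \<pi> z\<^sub>0) + L\<^sub>h\<^sup>N\<^sup>+\<^sup>1 \<pi> z\<^sub>0 - \<Sum> L\<^sub>h\<^sup>n r\<close>. As \<open>L\<^sub>h\<close> is a contraction, the last sum costs
  \<open>(N + 1) \<parallel>r\<parallel>\<close>. The middle term is compared with \<open>L\<^sup>N\<^sup>+\<^sup>1 z\<^sub>0\<close>, of norm at most \<open>\<eta>\<^sup>N\<^sup>+\<^sup>1 \<parallel>z\<^sub>0\<parallel>\<close>; the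
  comparison (\<open>L_funpow_error\<close>) adds up one consistency error per power (\<open>reconstruction_error\<close>).

  All discrete comparisons are instances of one energy estimate (\<open>energy_estimate\<close>): a solution of the
  Galerkin equation with a forcing \<open>g\<close> grows at most by the integral of \<open>\<parallel>g\<parallel>\<close>. For a projected exact
  trajectory the forcing consists of projection errors of the trajectory and of its derivative
  (\<open>forced_projected_trajectory\<close>).

  The constant does not depend on the observation time for the following reason. Initial states in the
  domain of \<open>A\<^sup>2\<close> have trajectories whose derivatives lie in the domain of \<open>A\<close>, and there duality doubles the order of
  approximation (\<open>aubin_nitsche\<close>): the consistency errors are of order \<open>h\<^sup>2\<^sup>\<theta>\<close>, with a factor that may depend
  on \<open>\<tau>\<close> in any way. Since the range of \<open>h\<close> may depend on \<open>\<tau>\<close>, a spare factor \<open>h\<^sup>\<theta>\<close> absorbs this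
  dependence. What is needed is uniformity in the power \<open>n\<close>, and this is delicate, for \<open>L\<close> need not
  be a contraction for the graph norm of \<open>A\<^sup>2\<close>. But \<open>A\<close> commutes with the semigroups up to bounded operators, and
  with \<open>\<eta> < 1\<close> this makes \<open>L\<close> a contraction for an equivalent norm (\<open>power_graph_bound\<close>).

  That \<open>\<eta> < 1\<close> follows from observability
  (\<open>observability_imp_strict_contraction\<close>) by comparing the damped with the undamped evolution. This needs
  solutions of the undamped system, that is, the group generated by \<open>\<i> A\<close>; it is the limit of the groups
  of the Yosida approximations (\<open>contraction_evolution_group\<close>). Resolvents and adjoints both come from one variational
  principle (\<open>closed_form_representation\<close>). That the semigroups \<open>T\<^sup>\<plusminus>\<close> are differentiable on the domain
  of the generator and contractive rests on the uniform boundedness principle.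
\<close>

section \<open>Complex Hilbert spaces\<close>

lemma cinner_add_right: "cinner x (y + z) = cinner x y + cinner x z"
  for x :: "'a::complex_hilbert"
  by (metis cinner_add_left cinner_commute complex_cnj_add)

lemma cinner_scaleC_right: "cinner x (a *\<^sub>C y) = cnj a * cinner x y"
  for x :: "'a::complex_hilbert"
  by (metis cinner_commute cinner_scaleC_left complex_cnj_mult)

lemma cinner_self: "cinner x x = of_real ((norm x)\<^sup>2)"
  for x :: "'a::complex_hilbert"
proof -
  have "Im (cinner x x) = 0"
    using arg_cong[OF cinner_commute[of x x], of Im] by simp
  then show ?thesis
    by (simp add: complex_eq_iff Re_cinner power2_norm_eq_inner)
qed

lemma norm_scaleC: "norm (a *\<^sub>C x) = cmod a * norm x"
  for x :: "'a::complex_hilbert"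
proof -
  have "complex_of_real ((norm (a *\<^sub>C x))\<^sup>2) = a * (cnj a * of_real ((norm x)\<^sup>2))"
    by (simp only: cinner_self[symmetric] cinner_scaleC_left cinner_scaleC_right mult.left_commute)
  also have "\<dots> = of_real ((cmod a * norm x)\<^sup>2)"
    using complex_norm_square[of a] by (simp add: power_mult_distrib)
  finally have "(norm (a *\<^sub>C x))\<^sup>2 = (cmod a * norm x)\<^sup>2"
    using of_real_eq_iff by blast
  then show ?thesis
    by (simp add: power2_eq_iff_nonneg)
qed

text \<open>The modulus is reduced to the real Cauchy--Schwarz inequality by rotating \<open>x\<close>.\<close>

lemma cmod_cinner_le: "cmod (cinner x y) \<le> norm x * norm y"
  for x :: "'a::complex_hilbert"
proof -
  define u where "u = (if cinner x y = 0 then 1 else cnj (sgn (cinner x y)))"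
  have u: "cmod u = 1" by (simp add: u_def norm_sgn)
  have "cinner (u *\<^sub>C x) y = of_real (cmod (cinner x y))"
    unfolding cinner_scaleC_left u_def
    by (simp add: sgn_eq mult.commute[of "cnj _"] complex_norm_square[symmetric] power2_eq_square)
  then have "cmod (cinner x y) = inner (u *\<^sub>C x) y"
    by (metis Re_cinner Re_complex_of_real)
  also have "\<dots> \<le> norm (u *\<^sub>C x) * norm y" by (rule norm_cauchy_schwarz)
  finally show ?thesis by (simp add: norm_scaleC u)
qed

lemma scaleR_scaleC: "r *\<^sub>R x = complex_of_real r *\<^sub>C x" for x :: "'a::complex_hilbert"
  by (simp add: scaleC_of_real)

lemma cinner_scaleR_left: "cinner (r *\<^sub>R x) y = r *\<^sub>R cinner x y"
  for x :: "'a::complex_hilbert"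
  by (simp add: scaleR_scaleC cinner_scaleC_left scaleR_conv_of_real)

lemma cinner_scaleR_right: "cinner x (r *\<^sub>R y) = r *\<^sub>R cinner x y"
  for x :: "'a::complex_hilbert"
  by (simp add: scaleR_scaleC cinner_scaleC_right scaleR_conv_of_real)

interpretation cinner: bounded_bilinear "cinner :: 'a::complex_hilbert \<Rightarrow> 'a \<Rightarrow> complex"
  by standard (auto simp: cinner_add_left cinner_add_right cinner_scaleR_left cinner_scaleR_right
      intro!: exI[of _ 1] cmod_cinner_le)

interpretation scaleC: bounded_bilinear "scaleC :: complex \<Rightarrow> 'a::complex_hilbert \<Rightarrow> 'a"
  by standard (auto simp: scaleC_add_left scaleC_add_right scaleR_scaleC scaleC_scaleC
      scaleR_conv_of_real mult.commute norm_scaleC intro: exI[of _ 1])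

lemma cinner_eq_zero_imp: "(\<And>y. cinner x y = 0) \<Longrightarrow> x = 0" for x :: "'a::complex_hilbert"
  by (metis cinner_self norm_eq_zero of_real_eq_0_iff power2_eq_iff power_zero_numeral zero_eq_power2)

lemma cinner_ext: "x = y" if "\<And>z. cinner z x = cinner z y" for x :: "'a::complex_hilbert"
proof -
  have "cinner (x - y) z = 0" for z
    by (metis cinner.diff_left cinner_commute right_minus_eq that)
  then show ?thesis using cinner_eq_zero_imp[of "x - y"] by simp
qed

lemma norm_le_of_cinner_le:
  fixes v :: "'a::complex_hilbert"
  assumes "Re (cinner v v) \<le> c * norm v" "0 \<le> c"
  shows "norm v \<le> c"
proof (cases "v = 0")
  case False
  then show ?thesis
    using assms by (simp add: cinner_self power2_eq_square)
qed (use assms in simp)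

lemma bounded_clinearD:
  assumes "bounded_clinear f"
  shows "bounded_linear f" "f (a *\<^sub>C x) = a *\<^sub>C f x"
  using assms by (auto simp: bounded_clinear_def)

lemma complex_subspace_imp_subspace:
  "complex_vector.subspace W \<Longrightarrow> subspace (W :: 'a::complex_hilbert set)"
  by (auto simp: complex_vector.subspace_def subspace_def scaleR_scaleC)


section \<open>Minimisation of quadratic functionals and the Riesz representation\<close>

text \<open>
  Both the Riesz representation theorem (\<open>W\<close> the whole space, \<open>L = 0\<close>) and the existence of the
  resolvent of a positive self-adjoint operator (\<open>L\<close> its square root) are instances of the following
  variational principle. The space \<open>W\<close> with the graph norm of the closed operator \<open>L\<close> is complete,
  so by the parallelogram law a minimising sequence of the functional
  \<open>\<parallel>x\<parallel>\<^sup>2 + \<parallel>L x\<parallel>\<^sup>2 - 2 F x\<close> converges; the first variation vanishes at the limit.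
\<close>

lemma closed_form_representation:
  fixes W :: "'a::{real_inner,banach} set" and L :: "'a \<Rightarrow> 'c::{real_inner,banach}"
    and F :: "'a \<Rightarrow> real"
  assumes W: "subspace W"
    and L_add: "\<And>x y. x \<in> W \<Longrightarrow> y \<in> W \<Longrightarrow> L (x + y) = L x + L y"
    and L_scale: "\<And>r x. x \<in> W \<Longrightarrow> L (r *\<^sub>R x) = r *\<^sub>R L x"
    and closed: "\<And>s u w. (\<And>n. s n \<in> W) \<Longrightarrow> s \<longlonglongrightarrow> u \<Longrightarrow> (\<lambda>n. L (s n)) \<longlonglongrightarrow> w \<Longrightarrow> u \<in> W \<and> L u = w"
    and F: "bounded_linear F"
  shows "\<exists>u\<in>W. \<forall>y\<in>W. inner u y + inner (L u) (L y) = F y"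
proof -
  interpret F: bounded_linear F by (rule F)
  define Q where "Q x = inner x x + inner (L x) (L x)" for x
  define \<Phi> where "\<Phi> x = Q x - 2 * F x" for x
  obtain K where K: "\<And>x. \<bar>F x\<bar> \<le> norm x * K"
    using F.bounded by auto
  have \<Phi>_lower: "- K\<^sup>2 \<le> \<Phi> x" for x
  proof -
    have "0 \<le> (norm x - K)\<^sup>2" by simp
    moreover have "F x \<le> norm x * K" using K[of x] by linarith
    moreover have "(norm x)\<^sup>2 \<le> Q x" by (simp add: Q_def power2_norm_eq_inner)
    ultimately show ?thesis by (simp add: \<Phi>_def power2_diff)
  qed
  define I where "I = Inf (\<Phi> ` W)"
  have bdd: "bdd_below (\<Phi> ` W)" using \<Phi>_lower by (meson bdd_below.I2)
  have W0: "0 \<in> W" using W by (rule subspace_0)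
  have I_le: "I \<le> \<Phi> x" if "x \<in> W" for x
    unfolding I_def using that bdd by (simp add: cInf_lower)
  have "\<exists>x\<in>W. \<Phi> x < I + 1 / real (Suc n)" for n
  proof -
    have "Inf (\<Phi> ` W) < I + 1 / real (Suc n)" by (simp add: I_def)
    then show ?thesis using cInf_lessD[of "\<Phi> ` W"] W0 by blast
  qed
  then obtain s where sW: "\<And>n. s n \<in> W" and s: "\<And>n. \<Phi> (s n) < I + 1 / real (Suc n)"
    by metis
  have L_diff: "L (x - y) = L x - L y" if "x \<in> W" "y \<in> W" for x y
  proof -
    have "(-1) *\<^sub>R y \<in> W" using that(2) W by (simp add: subspace_neg)
    then show ?thesis
      using L_add[of x "(-1) *\<^sub>R y"] L_scale[of y "-1"] that by simp
  qed
  have par: "Q (x - y) = 2 * \<Phi> x + 2 * \<Phi> y - 4 * \<Phi> ((1/2) *\<^sub>R (x + y))" if "x \<in> W" "y \<in> W" for x y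
  proof -
    have xy: "x + y \<in> W" using that W by (simp add: subspace_add)
    show ?thesis
      unfolding \<Phi>_def Q_def
      by (simp add: L_diff[OF that] L_scale[OF xy] L_add[OF that] F.add F.scale inner_diff_left
          inner_diff_right inner_add_left inner_add_right inner_commute algebra_simps
          del: scaleR_add_right)
  qed
  have Q_s: "Q (s n - s m) \<le> 2 / real (Suc n) + 2 / real (Suc m)" for n m
  proof -
    have "(1/2) *\<^sub>R (s n + s m) \<in> W" using sW W by (simp add: subspace_add subspace_scale)
    from I_le[OF this] show ?thesis
      using par[OF sW[of n] sW[of m]] s[of n] s[of m] by simp
  qed
  have small: "\<exists>N. \<forall>m\<ge>N. \<forall>n\<ge>N. Q (s m - s n) < e\<^sup>2" if "e > 0" for e
  proof -
    obtain N where N: "4 / e\<^sup>2 < real N" using reals_Archimedean2 by blast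
    have "2 / real (Suc m) < e\<^sup>2 / 2" if "m \<ge> N" for m
    proof -
      have "4 < e\<^sup>2 * real (Suc m)"
      proof -
        have "4 / e\<^sup>2 < real (Suc m)" using N that by simp
        then show ?thesis using \<open>e > 0\<close> by (simp add: field_simps)
      qed
      then show ?thesis by (simp add: field_simps)
    qed
    then have "Q (s m - s n) < e\<^sup>2" if "m \<ge> N" "n \<ge> N" for m n
      using Q_s[of m n] that by (smt (verit) field_sum_of_halves)
    then show ?thesis by blast
  qed
  have Cauchy: "Cauchy f" if f: "\<And>m n. (norm (f m - f n))\<^sup>2 \<le> Q (s m - s n)"
    for f :: "nat \<Rightarrow> 'd::real_normed_vector"
  proof (rule metric_CauchyI)
    fix e :: real assume "e > 0"
    then obtain N where N: "\<And>m n. m \<ge> N \<Longrightarrow> n \<ge> N \<Longrightarrow> Q (s m - s n) < e\<^sup>2" using small by blast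
    have "dist (f m) (f n) < e" if "m \<ge> N" "n \<ge> N" for m n
    proof -
      have "(norm (f m - f n))\<^sup>2 < e\<^sup>2" using f[of m n] N[OF that] by linarith
      then show ?thesis using \<open>e > 0\<close> by (simp add: dist_norm power2_less_imp_less)
    qed
    then show "\<exists>M. \<forall>m\<ge>M. \<forall>n\<ge>M. dist (f m) (f n) < e" by blast
  qed
  have "Cauchy s"
    by (rule Cauchy) (simp add: Q_def power2_norm_eq_inner)
  moreover have "Cauchy (\<lambda>n. L (s n))"
    by (rule Cauchy) (simp add: Q_def power2_norm_eq_inner L_diff sW)
  ultimately obtain u w where u: "s \<longlonglongrightarrow> u" and w: "(\<lambda>n. L (s n)) \<longlonglongrightarrow> w"
    by (meson Cauchy_convergent convergent_def)
  have uW: "u \<in> W" and Lu: "L u = w" using closed[OF sW u w] by auto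
  have "(\<lambda>n. \<Phi> (s n)) \<longlonglongrightarrow> \<Phi> u"
    unfolding \<Phi>_def Q_def Lu by (intro tendsto_intros u w F.tendsto)
  moreover have "(\<lambda>n. I + 1 / real (Suc n)) \<longlonglongrightarrow> I + 0"
    by (intro tendsto_intros LIMSEQ_Suc[OF lim_1_over_n])
  ultimately have \<Phi>u: "\<Phi> u \<le> I"
    using LIMSEQ_le[of "\<lambda>n. \<Phi> (s n)" _ "\<lambda>n. I + 1 / real (Suc n)"] s by (metis add_0_right less_imp_le)
  have "inner u y + inner (L u) (L y) = F y" if y: "y \<in> W" for y
  proof -
    define b where "b = inner u y + inner (L u) (L y) - F y"
    have Q0: "0 \<le> Q y" by (simp add: Q_def)
    have "0 \<le> t\<^sup>2 * Q y + 2 * t * b" for t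
    proof -
      have ty: "t *\<^sub>R y \<in> W" using y W by (simp add: subspace_scale)
      have "\<Phi> (u + t *\<^sub>R y) = \<Phi> u + t\<^sup>2 * Q y + 2 * t * b"
        unfolding \<Phi>_def Q_def b_def
        by (simp add: L_add[OF uW ty] L_scale[OF y] F.add F.scale inner_add_left inner_add_right
            inner_commute algebra_simps power2_eq_square)
      moreover have "I \<le> \<Phi> (u + t *\<^sub>R y)" using ty uW W by (intro I_le subspace_add)
      ultimately show ?thesis using \<Phi>u by linarith
    qed
    from this[of "- b / (Q y + 1)"]
    have "0 \<le> b\<^sup>2 * Q y / (Q y + 1)\<^sup>2 - 2 * b\<^sup>2 / (Q y + 1)"
      by (simp add: power2_eq_square power_divide)
    also have "\<dots> = - b\<^sup>2 * (Q y + 2) / (Q y + 1)\<^sup>2"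
      using Q0 by (simp add: divide_simps power2_eq_square) (simp add: algebra_simps)
    finally have "b\<^sup>2 * (Q y + 2) \<le> 0"
      using Q0 by (simp add: field_simps zero_le_divide_iff divide_le_0_iff)
    then have "b = 0"
      using Q0 by (metis add_nonneg_pos mult_le_0_iff not_less power2_less_eq_zero_iff zero_less_numeral)
    then show ?thesis by (simp add: b_def)
  qed
  then show ?thesis using uW by blast
qed

lemma riesz_representation:
  fixes f :: "'a::complex_hilbert \<Rightarrow> complex"
  assumes f: "bounded_linear f" and fC: "\<And>a x. f (a *\<^sub>C x) = a * f x"
  shows "\<exists>u. \<forall>x. f x = cinner x u"
proof -
  have "bounded_linear (\<lambda>x. Re (f x))"
    using bounded_linear_compose[OF bounded_linear_Re f] by simp
  then have "\<exists>u\<in>UNIV. \<forall>y\<in>UNIV. inner u y + inner (0::real) 0 = Re (f y)"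
    by (intro closed_form_representation) (auto simp: LIMSEQ_const_iff)
  then obtain u where u: "\<And>y. Re (cinner y u) = Re (f y)"
    by (auto simp: Re_cinner inner_commute)
  have "f y = cinner y u" for y
    using u[of y] u[of "\<i> *\<^sub>C y"] by (simp add: complex_eq_iff fC cinner_scaleC_left)
  then show ?thesis by blast
qed

lemma cinner_cadjoint:
  fixes f :: "'a::complex_hilbert \<Rightarrow> 'b::complex_hilbert"
  assumes f: "bounded_clinear f"
  shows "cinner (f x) y = cinner x (cadjoint f y)"
proof -
  have "\<exists>u. \<forall>x. cinner (f x) y = cinner x u" for y
    by (rule riesz_representation)
      (auto simp: bounded_clinearD[OF f] cinner_scaleC_left
        intro!: bounded_linear_compose[OF cinner.bounded_linear_left])
  then obtain g where g: "\<And>x y. cinner (f x) y = cinner x (g y)" by metis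
  have "\<forall>x y. cinner (f x) y = cinner x (cadjoint f y)"
    unfolding cadjoint_def
  proof (rule theI[where P = "\<lambda>g. \<forall>x y. cinner (f x) y = cinner x (g y)"])
    show "\<forall>x y. cinner (f x) y = cinner x (g y)" using g by blast
    fix g' assume "\<forall>x y. cinner (f x) y = cinner x (g' y)"
    then have "cinner x (g' y) = cinner x (g y)" for x y using g by metis
    then show "g' = g" by (intro ext cinner_ext)
  qed
  then show ?thesis by blast
qed

lemma bounded_clinear_cadjoint:
  fixes f :: "'a::complex_hilbert \<Rightarrow> 'b::complex_hilbert"
  assumes f: "bounded_clinear f"
  shows "bounded_clinear (cadjoint f)"
proof -
  note adj = cinner_cadjoint[OF f, symmetric]
  obtain K where K: "\<And>x. norm (f x) \<le> norm x * K"
    using bounded_linear.bounded[OF bounded_clinearD(1)[OF f]] by blast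
  have scale: "cadjoint f (a *\<^sub>C y) = a *\<^sub>C cadjoint f y" for a y
    by (rule cinner_ext) (simp add: adj cinner_scaleC_right)
  have "bounded_linear (cadjoint f)"
  proof (rule bounded_linear_intro)
    show "cadjoint f (x + y) = cadjoint f x + cadjoint f y" for x y
      by (rule cinner_ext) (simp add: adj cinner_add_right)
    show "cadjoint f (r *\<^sub>R x) = r *\<^sub>R cadjoint f x" for r x
      by (simp add: scaleR_scaleC scale)
    show "norm (cadjoint f y) \<le> norm y * \<bar>K\<bar>" for y
    proof (rule norm_le_of_cinner_le)
      have "Re (cinner (cadjoint f y) (cadjoint f y)) = Re (cinner (f (cadjoint f y)) y)"
        by (simp add: adj)
      also have "\<dots> \<le> norm (f (cadjoint f y)) * norm y"
        using cmod_cinner_le complex_Re_le_cmod order_trans by blast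
      also have "\<dots> \<le> (norm (cadjoint f y) * \<bar>K\<bar>) * norm y"
        by (intro mult_right_mono order_trans[OF K] mult_left_mono) auto
      finally show "Re (cinner (cadjoint f y) (cadjoint f y)) \<le> norm y * \<bar>K\<bar> * norm (cadjoint f y)"
        by (simp add: mult_ac)
    qed simp
  qed
  then show ?thesis by (simp add: bounded_clinear_def scale)
qed


section \<open>Growth of differentiable curves\<close>

text \<open>
  The energy method: the norm grows at most at the rate at which the derivative points outwards. The
  square root of \<open>\<parallel>f\<parallel>\<^sup>2 + \<epsilon>\<^sup>2\<close> stands in for the norm, which is not differentiable at zero.
\<close>

lemma norm_growth:
  fixes f :: "real \<Rightarrow> 'a::real_inner"
  assumes ab: "a \<le> b"
    and f: "\<And>t. t \<in> {a..b} \<Longrightarrow> (f has_vector_derivative f' t) (at t within {a..b})"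
    and growth: "\<And>t. t \<in> {a..b} \<Longrightarrow> inner (f t) (f' t) \<le> c * norm (f t)" and c: "0 \<le> c"
  shows "norm (f b) \<le> norm (f a) + c * (b - a)"
proof (rule field_le_epsilon)
  fix e :: real assume e: "e > 0"
  define g where "g t = sqrt (inner (f t) (f t) + e\<^sup>2)" for t
  have pos: "0 < inner (f t) (f t) + e\<^sup>2" for t
    using e by (simp add: add_nonneg_pos)
  have norm_g: "norm (f t) \<le> g t" for t
    unfolding g_def norm_eq_sqrt_inner by simp
  have g: "(g has_derivative (\<lambda>h. h * (inner (f t) (f' t) / g t))) (at t within {a..b})"
    if t: "t \<in> {a..b}" for t
  proof -
    have D: "((\<lambda>t. inner (f t) (f t) + e\<^sup>2) has_real_derivative (2 * inner (f t) (f' t))) (at t within {a..b})"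
      using f[OF t] unfolding has_field_derivative_def has_vector_derivative_def
      by (auto intro!: derivative_eq_intros simp: inner_commute algebra_simps)
    have "(g has_real_derivative (inverse (sqrt (inner (f t) (f t) + e\<^sup>2)) / 2 * (2 * inner (f t) (f' t))))
        (at t within {a..b})"
      unfolding g_def[abs_def] by (rule DERIV_chain2[OF DERIV_real_sqrt[OF pos[of t]] D])
    then have "(g has_real_derivative (inner (f t) (f' t) / g t)) (at t within {a..b})"
      by (rule DERIV_cong) (simp add: g_def inverse_eq_divide)
    then show ?thesis
      unfolding has_field_derivative_def by (rule has_derivative_eq_rhs) (simp add: fun_eq_iff)
  qed
  have "\<exists>x\<in>{a..b}. g b - g a = (b - a) * (inner (f x) (f' x) / g x)"
  proof (rule mvt_very_simple[OF ab])
    show "(g has_derivative (\<lambda>h. h * (inner (f x) (f' x) / g x))) (at x within {a..b})"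
      if "a \<le> x" "x \<le> b" for x
      by (rule g) (use that in auto)
  qed
  then obtain x where x: "x \<in> {a..b}" "g b - g a = (b - a) * (inner (f x) (f' x) / g x)"
    by blast
  have gx: "0 < g x" using pos[of x] by (simp add: g_def)
  have "inner (f x) (f' x) \<le> c * g x"
    using growth[OF x(1)] mult_left_mono[OF norm_g[of x] c] by linarith
  then have "inner (f x) (f' x) / g x \<le> c" using gx by (simp add: divide_le_eq)
  then have "g b - g a \<le> (b - a) * c"
    unfolding x(2) using ab by (intro mult_left_mono) auto
  moreover have "g a \<le> norm (f a) + e"
    unfolding g_def norm_eq_sqrt_inner
    using sqrt_add_le_add_sqrt[of "inner (f a) (f a)" "e\<^sup>2"] e by simp
  ultimately show "norm (f b) \<le> norm (f a) + c * (b - a) + e"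
    using norm_g[of b] by (simp add: mult.commute)
qed


section \<open>Exponentials of bounded operators\<close>

definition exp_flow :: "('a::banach \<Rightarrow> 'a) \<Rightarrow> real \<Rightarrow> 'a \<Rightarrow> 'a" where
  "exp_flow G t x = (\<Sum>n. (t ^ n / fact n) *\<^sub>R (G ^^ n) x)"

context
  fixes G :: "'a::banach \<Rightarrow> 'a"
  assumes G: "bounded_linear G"
begin

lemma bounded_linear_funpow: "bounded_linear (G ^^ n)"
  by (induction n) (auto simp: id_def intro!: bounded_linear_compose[OF G] bounded_linear_ident simp: o_def)

lemma norm_funpow_le: "norm ((G ^^ n) x) \<le> onorm G ^ n * norm x"
proof (induction n)
  case (Suc n)
  have "norm ((G ^^ Suc n) x) \<le> onorm G * norm ((G ^^ n) x)" using onorm[OF G] by simp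
  also have "\<dots> \<le> onorm G * (onorm G ^ n * norm x)"
    by (intro mult_left_mono Suc onorm_pos_le[OF G])
  finally show ?case by simp
qed simp

lemma norm_exp_flow_term_le:
  assumes "\<bar>t\<bar> \<le> r"
  shows "norm ((t ^ n / fact n) *\<^sub>R (G ^^ n) x) \<le> inverse (fact n) * (r * onorm G) ^ n * norm x"
proof -
  have "norm ((t ^ n / fact n) *\<^sub>R (G ^^ n) x) = \<bar>t\<bar> ^ n / fact n * norm ((G ^^ n) x)"
    by (simp add: power_abs)
  also have "\<dots> \<le> r ^ n / fact n * (onorm G ^ n * norm x)"
    using assms by (intro mult_mono divide_right_mono power_mono norm_funpow_le) auto
  finally show ?thesis by (simp add: power_mult_distrib field_simps)
qed

lemma uniform_limit_exp_flow:
  "uniform_limit {-r..r} (\<lambda>n t. \<Sum>i<n. (t ^ i / fact i) *\<^sub>R (G ^^ i) x) (\<lambda>t. exp_flow G t x) sequentially"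
  unfolding exp_flow_def
proof (rule Weierstrass_m_test)
  show "norm ((t ^ n / fact n) *\<^sub>R (G ^^ n) x) \<le> inverse (fact n) * (r * onorm G) ^ n * norm x"
    if "t \<in> {-r..r}" for n t
    using that by (intro norm_exp_flow_term_le) auto
  show "summable (\<lambda>n. inverse (fact n) * (r * onorm G) ^ n * norm x)"
    by (intro summable_mult2 summable_exp)
qed

lemma exp_flow_sums: "(\<lambda>n. (t ^ n / fact n) *\<^sub>R (G ^^ n) x) sums exp_flow G t x"
  using tendsto_uniform_limitI[OF uniform_limit_exp_flow[where r = "\<bar>t\<bar>" and x = x], of t]
  unfolding sums_def by (metis abs_ge_self abs_ge_minus_self atLeastAtMost_iff minus_le_iff)

lemma exp_flow_zero [simp]: "exp_flow G 0 x = x"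
proof -
  have "(\<lambda>n. (0 ^ n / fact n) *\<^sub>R (G ^^ n) x) sums x"
    using sums_If_finite_set[of "{0}" "\<lambda>n. (G ^^ n) x"]
    by (subst sums_cong[of _ "\<lambda>n. if n \<in> {0} then (G ^^ n) x else 0"]) (auto simp: power_0_left)
  with exp_flow_sums show ?thesis using sums_unique2 by blast
qed

lemma exp_flow_commute:
  assumes P: "bounded_linear P" and PG: "\<And>x. P (G x) = G (P x)"
  shows "P (exp_flow G t x) = exp_flow G t (P x)"
proof -
  have "P ((G ^^ n) x) = (G ^^ n) (P x)" for n by (induction n) (auto simp: PG)
  then have "(\<lambda>n. P ((t ^ n / fact n) *\<^sub>R (G ^^ n) x)) = (\<lambda>n. (t ^ n / fact n) *\<^sub>R (G ^^ n) (P x))"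
    by (simp add: linear_scale[OF bounded_linear.linear[OF P]])
  with bounded_linear.sums[OF P exp_flow_sums[of t x]] show ?thesis
    using exp_flow_sums sums_unique2 by metis
qed

lemma exp_flow_add: "exp_flow G t (x + y) = exp_flow G t x + exp_flow G t y"
proof -
  have "(\<lambda>n. (t ^ n / fact n) *\<^sub>R (G ^^ n) x + (t ^ n / fact n) *\<^sub>R (G ^^ n) y)
      sums (exp_flow G t x + exp_flow G t y)"
    by (intro sums_add exp_flow_sums)
  then show ?thesis
    using exp_flow_sums[of t "x + y"] sums_unique2
    by (fastforce simp: linear_add[OF bounded_linear.linear[OF bounded_linear_funpow]] scaleR_add_right)
qed

lemma exp_flow_has_vector_derivative:
  "((\<lambda>t. exp_flow G t x) has_vector_derivative G (exp_flow G t x)) (at t)"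
proof -
  define r where "r = \<bar>t\<bar> + 1"
  define f where "f n t = (t ^ n / fact n) *\<^sub>R (G ^^ n) x" for n t
  define f' where "f' n t h = (if n = 0 then 0 else (h * (t ^ (n - 1) / fact (n - 1))) *\<^sub>R (G ^^ n) x)"
    for n and t h :: real
  interpret G: bounded_linear G by (rule G)
  have step: "(\<Sum>i<Suc n. f' i t h) = h *\<^sub>R G (\<Sum>i<n. f i t)" for n t h
    unfolding sum.lessThan_Suc_shift f'_def f_def
    by (simp add: G.sum G.scale scaleR_right.sum)
  have "\<exists>g. \<forall>t\<in>{-r..r}. (\<lambda>n. f n t) sums g t \<and>
      (g has_derivative (\<lambda>h. h *\<^sub>R G (exp_flow G t x))) (at t within {-r..r})"
  proof (rule has_derivative_series[where f' = f' and x = 0 and l = "exp_flow G 0 x"])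
    show "(f n has_derivative f' n t) (at t within {-r..r})" for n t
    proof (cases n)
      case 0
      then show ?thesis by (simp add: f_def[abs_def] f'_def[abs_def])
    next
      case (Suc k)
      have "((\<lambda>t. t ^ Suc k / fact (Suc k)) has_derivative (\<lambda>h. h * (t ^ k / fact k))) (at t within {-r..r})"
      proof -
        have "((\<lambda>t. t ^ Suc k) has_real_derivative (real (Suc k) * t ^ k)) (at t within {-r..r})"
          using DERIV_pow[of "Suc k"] by simp
        from DERIV_cdivide[OF this, of "fact (Suc k)"]
        have "((\<lambda>t. t ^ Suc k / fact (Suc k)) has_real_derivative (t ^ k / fact k)) (at t within {-r..r})"
          by (simp only: fact_Suc mult_divide_mult_cancel_left_if of_nat_eq_0_iff nat.distinct if_False)
        then show ?thesis
          unfolding has_field_derivative_def by (rule has_derivative_eq_rhs) (simp add: fun_eq_iff)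
      qed
      from has_derivative_scaleR[OF this has_derivative_const[of "(G ^^ Suc k) x"]]
      show ?thesis
        by (simp add: Suc f_def[abs_def] f'_def[abs_def] del: funpow.simps fact_Suc power_Suc)
    qed
    fix e :: real assume "e > 0"
    obtain K where K: "K > 0" "\<And>x. norm (G x) \<le> norm x * K" using G.pos_bounded by blast
    have "\<forall>\<^sub>F n in sequentially. \<forall>t\<in>{-r..r}. dist (\<Sum>i<n. f i t) (exp_flow G t x) < e / K"
      using uniform_limitD[OF uniform_limit_exp_flow[where r = r and x = x], of "e / K"] \<open>e > 0\<close> K(1)
      by (simp add: f_def)
    then have "\<forall>\<^sub>F n in sequentially. \<forall>t\<in>{-r..r}. \<forall>h.
      norm ((\<Sum>i<Suc n. f' i t h) - h *\<^sub>R G (exp_flow G t x)) \<le> e * norm h"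
    proof eventually_elim
      case (elim n)
      show ?case
      proof (intro ballI allI)
        fix t h assume t: "t \<in> {-r..r}"
        have "norm ((\<Sum>i<Suc n. f' i t h) - h *\<^sub>R G (exp_flow G t x))
            = \<bar>h\<bar> * norm (G ((\<Sum>i<n. f i t) - exp_flow G t x))"
          unfolding step by (simp add: G.diff scaleR_diff_right[symmetric])
        also have "\<dots> \<le> \<bar>h\<bar> * (norm ((\<Sum>i<n. f i t) - exp_flow G t x) * K)"
          by (intro mult_left_mono K) auto
        also have "\<dots> \<le> \<bar>h\<bar> * e"
          using elim t K(1) by (intro mult_left_mono) (auto simp: dist_norm pos_less_divide_eq less_imp_le)
        finally show "norm ((\<Sum>i<Suc n. f' i t h) - h *\<^sub>R G (exp_flow G t x)) \<le> e * norm h"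
          by (simp add: mult.commute)
      qed
    qed
    then show "\<forall>\<^sub>F n in sequentially. \<forall>t\<in>{-r..r}. \<forall>h.
      norm ((\<Sum>i<n. f' i t h) - h *\<^sub>R G (exp_flow G t x)) \<le> e * norm h"
      by (rule eventually_sequentially_Suc[THEN iffD1])
  qed (auto simp: r_def f_def exp_flow_sums simp del: exp_flow_zero)
  then obtain g where g: "\<And>t. t \<in> {-r..r} \<Longrightarrow> (\<lambda>n. f n t) sums g t"
    "\<And>t. t \<in> {-r..r} \<Longrightarrow> (g has_derivative (\<lambda>h. h *\<^sub>R G (exp_flow G t x))) (at t within {-r..r})"
    by blast
  have tr: "t \<in> {-r<..<r}" by (auto simp: r_def)
  have "(g has_vector_derivative G (exp_flow G t x)) (at t within {-r..r})"
    unfolding has_vector_derivative_def using g(2)[of t] tr by simp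
  then have "(g has_vector_derivative G (exp_flow G t x)) (at t within {-r<..<r})"
    by (rule has_vector_derivative_within_subset) auto
  then have "(g has_vector_derivative G (exp_flow G t x)) (at t)"
    using tr by (metis at_within_open open_greaterThanLessThan)
  moreover have "g s = exp_flow G s x" if "s \<in> {-r<..<r}" for s
    using g(1)[of s] exp_flow_sums[of s x] that sums_unique2 by (fastforce simp: f_def)
  ultimately show ?thesis
    using tr by (metis (no_types, lifting) has_vector_derivative_transform_within_open open_greaterThanLessThan)
qed

lemma exp_flow_has_vector_derivative_within:
  "((\<lambda>t. exp_flow G t x) has_vector_derivative G (exp_flow G t x)) (at t within S)"
  by (rule has_vector_derivative_at_within[OF exp_flow_has_vector_derivative])

end

section \<open>Contraction semigroups\<close>

text \<open>Of \<open>S (x + z)\<close> and \<open>S (x - z)\<close>, one is at least as large as \<open>S z\<close>.\<close>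

lemma exists_near_large_value:
  fixes S :: "'a::real_normed_vector \<Rightarrow> 'b::real_normed_vector"
  assumes S: "bounded_linear S" and r: "0 < r" and pos: "0 < onorm S"
  shows "\<exists>y. norm (y - x) \<le> r \<and> 2/3 * onorm S * r \<le> norm (S y)"
proof -
  interpret S: bounded_linear S by (rule S)
  have "\<exists>v. 2/3 * onorm S * norm v < norm (S v)"
  proof (rule ccontr)
    assume "\<nexists>v. 2/3 * onorm S * norm v < norm (S v)"
    then have "onorm S \<le> 2/3 * onorm S" by (intro onorm_bound) (auto simp: not_less onorm_pos_le[OF S])
    with pos show False by simp
  qed
  then obtain v where v: "2/3 * onorm S * norm v < norm (S v)" by blast
  then have "v \<noteq> 0" by (auto simp: S.zero)
  define z where "z = (r / norm v) *\<^sub>R v"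
  have nz: "norm z = r" using \<open>v \<noteq> 0\<close> r by (simp add: z_def)
  have Sz: "2/3 * onorm S * r \<le> norm (S z)"
  proof -
    have "norm (S z) = (r / norm v) * norm (S v)" using r by (simp add: z_def S.scale)
    moreover have "(r / norm v) * (2/3 * onorm S * norm v) \<le> (r / norm v) * norm (S v)"
      using v r by (intro mult_left_mono) auto
    ultimately show ?thesis using \<open>v \<noteq> 0\<close> by (simp add: mult_ac)
  qed
  have "2 *\<^sub>R S z = S (x + z) - S (x - z)" by (simp add: S.add S.diff scaleR_2)
  then have "2 * norm (S z) \<le> norm (S (x + z)) + norm (S (x - z))"
    using norm_triangle_ineq4[of "S (x + z)" "S (x - z)"] by (metis abs_numeral norm_scaleR)
  then consider "norm (S z) \<le> norm (S (x + z))" | "norm (S z) \<le> norm (S (x - z))" by linarith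
  then show ?thesis
    by cases (use Sz nz in \<open>auto intro: exI[of _ "x + z"] exI[of _ "x - z"]\<close>)
qed

text \<open>
  The gliding hump argument. If the norms of the operators \<open>S k\<close> exceed \<open>4\<^sup>k\<close>, then correct a vector at
  step \<open>k\<close> by at most \<open>3\<^sup>-\<^sup>k\<close> so that \<open>S k\<close> becomes large on it. The later corrections add up to at
  most half of this, which is too little to undo the gain.
\<close>

lemma uniform_boundedness:
  fixes T :: "nat \<Rightarrow> 'a::banach \<Rightarrow> 'b::real_normed_vector"
  assumes T: "\<And>n. bounded_linear (T n)" and bdd: "\<And>x. \<exists>K. \<forall>n. norm (T n x) \<le> K"
  shows "\<exists>K. \<forall>n. onorm (T n) \<le> K"
proof (rule ccontr)
  assume "\<nexists>K. \<forall>n. onorm (T n) \<le> K"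
  then have "\<exists>n. 4 ^ k < onorm (T n)" for k :: nat by (meson not_le)
  then obtain \<nu> where \<nu>: "\<And>k. 4 ^ k < onorm (T (\<nu> k))" by metis
  define S where "S k = T (\<nu> k)" for k
  have S: "bounded_linear (S k)" and S_large: "4 ^ k < onorm (S k)" for k
    using T \<nu> by (auto simp: S_def)
  have S_pos: "0 < onorm (S k)" for k
    using S_large[of k] by (meson less_trans zero_less_numeral zero_less_power)
  have "\<exists>y. norm (y - x) \<le> (1/3) ^ k \<and> 2/3 * onorm (S k) * (1/3) ^ k \<le> norm (S k y)" for k x
    using exists_near_large_value[OF S, of "(1/3) ^ k" k x] S_pos by simp
  then have "\<exists>f. \<forall>k x. norm (f k x - x) \<le> (1/3) ^ k \<and> 2/3 * onorm (S k) * (1/3) ^ k \<le> norm (S k (f k x))"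
    by (intro choice allI)
  then obtain f where f: "\<And>k x. norm (f k x - x) \<le> (1/3) ^ k"
    "\<And>k x. 2/3 * onorm (S k) * (1/3) ^ k \<le> norm (S k (f k x))"
    by blast
  define X where "X = rec_nat 0 f"
  have X_Suc: "X (Suc k) = f k (X k)" and X_0: "X 0 = 0" for k by (simp_all add: X_def)
  define d where "d k = X (Suc k) - X k" for k
  have d: "norm (d k) \<le> (1/3) ^ k" for k using f(1) by (simp add: d_def X_Suc)
  have summ: "summable d"
    by (rule summable_comparison_test'[of "\<lambda>k. (1/3) ^ k" 0]) (use d in auto)
  have X_sum: "X n = (\<Sum>k<n. d k)" for n
    by (induction n) (simp_all add: X_0 d_def)
  define x where "x = suminf d"
  have tail: "norm (x - X (Suc k)) \<le> (1/3) ^ k / 2" for k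
  proof -
    have "x - X (Suc k) = (\<Sum>j. d (j + Suc k))"
      using suminf_split_initial_segment[OF summ, of "Suc k"] by (simp add: x_def X_sum)
    also have "norm \<dots> \<le> (\<Sum>j. (1/3) ^ (j + Suc k))"
      by (rule norm_suminf_le[OF d]) (intro summable_ignore_initial_segment summable_geometric; simp)
    also have "\<dots> = (1/3) ^ Suc k * (\<Sum>j. (1/3) ^ j)"
      unfolding power_add by (subst suminf_mult[symmetric]) (auto simp: mult.commute)
    also have "\<dots> = (1/3) ^ k / 2" by (simp add: suminf_geometric)
    finally show ?thesis .
  qed
  obtain K where K: "\<And>n. norm (T n x) \<le> K" using bdd by blast
  have "(4/3) ^ k / 6 \<le> K" for k
  proof -
    have "2/3 * onorm (S k) * (1/3) ^ k \<le> norm (S k (X (Suc k)))" using f(2) by (simp add: X_Suc)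
    also have "\<dots> \<le> norm (S k x) + norm (S k (x - X (Suc k)))"
      using norm_triangle_ineq4[of "S k x" "S k (x - X (Suc k))"]
      by (simp add: linear_diff[OF bounded_linear.linear[OF S]])
    also have "\<dots> \<le> K + onorm (S k) * ((1/3) ^ k / 2)"
    proof (rule add_mono)
      show "norm (S k x) \<le> K" using K by (simp add: S_def)
      show "norm (S k (x - X (Suc k))) \<le> onorm (S k) * ((1/3) ^ k / 2)"
        by (rule order_trans[OF onorm[OF S] mult_left_mono[OF tail onorm_pos_le[OF S]]])
    qed
    finally have "onorm (S k) * (1/3) ^ k / 6 \<le> K" by (simp add: field_simps)
    moreover have "(4::real) ^ k * (1/3) ^ k / 6 \<le> onorm (S k) * (1/3) ^ k / 6"
      using S_large[of k] by (intro divide_right_mono mult_right_mono) auto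
    ultimately show ?thesis by (simp add: power_mult_distrib[symmetric])
  qed
  moreover obtain k where "6 * K < (4/3) ^ k" using real_arch_pow[of "4/3"] by auto
  ultimately show False by (metis divide_le_eq_numeral1(1) mult.commute not_less)
qed

text \<open>
  Otherwise there are times \<open>t n\<close> tending to zero with unbounded operator norms, although
  \<open>T (t n) x\<close> converges for each \<open>x\<close>.
\<close>

lemma C0_semigroup_bounded_near_zero:
  fixes T :: "real \<Rightarrow> 'a::complex_hilbert \<Rightarrow> 'a"
  assumes T: "C0_semigroup T"
  shows "\<exists>d>0. \<exists>K. \<forall>t\<in>{0..d}. \<forall>x. norm (T t x) \<le> K * norm x"
proof (rule ccontr)
  assume contr: "\<not> ?thesis"
  have lin: "bounded_linear (T t)" if "t \<ge> 0" for t
    using T that by (auto simp: C0_semigroup_def bounded_clinear_def)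
  have "\<exists>t\<in>{0..1 / real (Suc n)}. real n < onorm (T t)" for n
  proof (rule ccontr)
    assume n: "\<not> ?thesis"
    have "norm (T t x) \<le> real n * norm x" if "t \<in> {0..1 / real (Suc n)}" for t x
    proof -
      have "onorm (T t) \<le> real n" using n that by (simp add: not_less)
      then show ?thesis
        using onorm[OF lin, of t x] that by (meson atLeastAtMost_iff mult_right_mono norm_ge_zero order_trans)
    qed
    then have "\<exists>d>0. \<exists>K. \<forall>t\<in>{0..d}. \<forall>x. norm (T t x) \<le> K * norm x"
      by (intro exI[of _ "1 / real (Suc n)"] conjI exI[of _ "real n"]) auto
    with contr show False by blast
  qed
  then obtain t where t: "\<And>n. t n \<in> {0..1 / real (Suc n)}" and large: "\<And>n. real n < onorm (T (t n))"
    by metis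
  have "\<exists>K. \<forall>n. norm (T (t n) x) \<le> K" for x
  proof -
    have "((\<lambda>t. T t x) \<longlongrightarrow> x) (at_right 0)" using T by (simp add: C0_semigroup_def)
    then have "\<forall>\<^sub>F s in at_right 0. dist (T s x) x < 1" by (rule tendstoD) simp
    then obtain d where d: "d > 0" "\<And>s. 0 < s \<Longrightarrow> s < d \<Longrightarrow> dist (T s x) x < 1"
      by (auto simp: eventually_at_right_field)
    have T0: "T 0 x = x" using T by (simp add: C0_semigroup_def)
    have near: "norm (T s x) \<le> norm x + 1" if "0 \<le> s" "s < d" for s
    proof (cases "s = 0")
      case False
      then show ?thesis
        using d(2)[of s] that norm_triangle_ineq2[of "T s x" x] by (auto simp: dist_norm)
    qed (simp add: T0)
    obtain N where N: "1 / d < real N" using reals_Archimedean2 by blast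
    have "t n < d" if "n \<ge> N" for n
    proof -
      have "1 < d * real (Suc n)"
      proof -
        have "1 / d < real (Suc n)" using N that by simp
        then show ?thesis using d(1) by (simp add: field_simps)
      qed
      then have "1 / real (Suc n) < d" by (simp add: field_simps)
      then show ?thesis using t[of n] by simp
    qed
    then have "norm (T (t n) x) \<le> max (norm x + 1) (Max ((\<lambda>n. norm (T (t n) x)) ` {..<N}))" for n
      using near[of "t n"] t[of n]
      by (cases "n \<ge> N") (auto simp: le_max_iff_disj not_le)
    then show ?thesis by blast
  qed
  then obtain K where K: "\<And>n. onorm (T (t n)) \<le> K"
    using uniform_boundedness[of "\<lambda>n. T (t n)"] lin t by auto
  obtain n where "K < real n" using reals_Archimedean2 by blast
  with K[of n] large[of n] show False by simp
qed

lemma C0_semigroup_locally_bounded: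
  fixes T :: "real \<Rightarrow> 'a::complex_hilbert \<Rightarrow> 'a"
  assumes T: "C0_semigroup T"
  shows "\<exists>K\<ge>0. \<forall>t\<in>{0..r}. \<forall>x. norm (T t x) \<le> K * norm x"
proof -
  obtain d K where d: "d > 0" and K: "\<And>t x. t \<in> {0..d} \<Longrightarrow> norm (T t x) \<le> K * norm x"
    using C0_semigroup_bounded_near_zero[OF T] by blast
  have step: "\<exists>K'\<ge>0. \<forall>t\<in>{0..real n * d}. \<forall>x. norm (T t x) \<le> K' * norm x" for n
  proof (induction n)
    case 0
    then show ?case using T by (intro exI[of _ 1]) (auto simp: C0_semigroup_def)
  next
    case (Suc n)
    then obtain K' where K': "K' \<ge> 0" "\<And>t x. t \<in> {0..real n * d} \<Longrightarrow> norm (T t x) \<le> K' * norm x"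
      by blast
    have "norm (T t x) \<le> (max 1 \<bar>K\<bar> * K') * norm x" if t: "t \<in> {0..real (Suc n) * d}" for t x
    proof (cases "t \<le> real n * d")
      case True
      have "norm (T t x) \<le> K' * norm x" using t True by (intro K') auto
      also have "\<dots> \<le> (max 1 \<bar>K\<bar> * K') * norm x"
        using K'(1) by (intro mult_right_mono) (auto simp: mult_le_cancel_right1)
      finally show ?thesis .
    next
      case False
      define s where "s = t - real n * d"
      have s: "s \<in> {0..d}" using False t by (auto simp: s_def algebra_simps)
      have nd: "0 \<le> real n * d" using d by simp
      have "T t x = T s (T (real n * d) x)"
        using T s nd unfolding C0_semigroup_def
        by (metis s_def atLeastAtMost_iff comp_apply diff_add_cancel)
      then have "norm (T t x) \<le> K * norm (T (real n * d) x)" using K[OF s] by simp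
      also have "\<dots> \<le> max 1 \<bar>K\<bar> * (K' * norm x)"
        using nd by (intro mult_mono K') auto
      finally show ?thesis by simp
    qed
    moreover have "0 \<le> max 1 \<bar>K\<bar> * K'" using K'(1) by simp
    ultimately show ?case by blast
  qed
  obtain n where "r / d < real n" using reals_Archimedean2 by blast
  then have "r \<le> real n * d" using d by (simp add: field_simps)
  moreover obtain K' where "K' \<ge> 0" "\<forall>t\<in>{0..real n * d}. \<forall>x. norm (T t x) \<le> K' * norm x"
    using step by blast
  ultimately have "\<forall>t\<in>{0..r}. \<forall>x. norm (T t x) \<le> K' * norm x" by auto
  with \<open>K' \<ge> 0\<close> show ?thesis by blast
qed

text \<open>
  The properties of a contraction semigroup on which the error analysis is based; they pass to the limit
  of the Yosida approximations.
\<close>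

definition contraction_evolution ::
    "'a::complex_hilbert set \<Rightarrow> ('a \<Rightarrow> 'a) \<Rightarrow> (real \<Rightarrow> 'a \<Rightarrow> 'a) \<Rightarrow> bool" where
  "contraction_evolution D G T \<longleftrightarrow>
     (\<forall>t\<ge>0. bounded_clinear (T t)) \<and> (\<forall>x. T 0 x = x) \<and> (\<forall>t\<ge>0. \<forall>x. norm (T t x) \<le> norm x) \<and>
     (\<forall>t\<ge>0. \<forall>x\<in>D. T t x \<in> D \<and> G (T t x) = T t (G x) \<and>
        ((\<lambda>t. T t x) has_vector_derivative G (T t x)) (at t within {0..}))"

lemma contraction_evolutionD:
  assumes "contraction_evolution D G T"
  shows "T 0 x = x"
    and "t \<ge> 0 \<Longrightarrow> bounded_clinear (T t)"
    and "t \<ge> 0 \<Longrightarrow> norm (T t x) \<le> norm x"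
    and "t \<ge> 0 \<Longrightarrow> x \<in> D \<Longrightarrow> T t x \<in> D"
    and "t \<ge> 0 \<Longrightarrow> x \<in> D \<Longrightarrow> G (T t x) = T t (G x)"
    and "t \<ge> 0 \<Longrightarrow> x \<in> D \<Longrightarrow> ((\<lambda>t. T t x) has_vector_derivative G (T t x)) (at t within {0..})"
  using assms unfolding contraction_evolution_def by blast+

lemma norm_bound_from_dense:
  fixes S :: "'a::real_normed_vector \<Rightarrow> 'b::real_normed_vector"
  assumes S: "bounded_linear S" and D: "closure D = UNIV"
    and bound: "\<And>x. x \<in> D \<Longrightarrow> norm (S x) \<le> c * norm x"
  shows "norm (S x) \<le> c * norm x"
proof -
  obtain s where s: "\<And>n. s n \<in> D" "s \<longlonglongrightarrow> x"
    using D by (metis UNIV_I closure_sequential)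
  have "(\<lambda>n. norm (S (s n))) \<longlonglongrightarrow> norm (S x)"
    by (intro tendsto_norm bounded_linear.tendsto[OF S] s)
  moreover have "(\<lambda>n. c * norm (s n)) \<longlonglongrightarrow> c * norm x"
    by (intro tendsto_intros s)
  ultimately show ?thesis using bound s(1) by (blast intro: LIMSEQ_le)
qed

text \<open>
  Two points \<open>s, t\<close> are compared by applying the operator at time \<open>min s t\<close> to a one-sided difference
  quotient at zero; the local bound makes this work from the left as well as from the right.
\<close>

lemma generates_has_vector_derivative:
  fixes T :: "real \<Rightarrow> 'a::complex_hilbert \<Rightarrow> 'a"
  assumes gen: "generates D G T" and x: "x \<in> D" and t: "0 \<le> t"
  shows "((\<lambda>t. T t x) has_vector_derivative T t (G x)) (at t within {0..})"
proof -
  have T: "C0_semigroup T" using gen by (simp add: generates_def)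
  then have lin: "bounded_linear (T s)" if "s \<ge> 0" for s
    using that by (auto simp: C0_semigroup_def bounded_clinear_def)
  obtain K where K: "K \<ge> 0" "\<And>s x. s \<in> {0..t} \<Longrightarrow> norm (T s x) \<le> K * norm x"
    using C0_semigroup_locally_bounded[OF T, of t] by blast
  have TT: "T (a + h) y = T a (T h y)" if "a \<ge> 0" "h \<ge> 0" for a h y
    using T that by (simp add: C0_semigroup_def)
  define \<rho> where "\<rho> h = K * (norm ((T h x - x) /\<^sub>R h - G x) + norm (T h (G x) - G x))" for h
  have "((\<lambda>h. (T h x - x) /\<^sub>R h) \<longlongrightarrow> G x) (at_right 0)" using gen x by (auto simp: generates_def)
  moreover have "((\<lambda>h. T h (G x)) \<longlongrightarrow> G x) (at_right 0)" using T by (simp add: C0_semigroup_def)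
  ultimately have "((\<lambda>h. \<rho> h) \<longlongrightarrow> K * (norm (G x - G x) + norm (G x - G x))) (at_right 0)"
    unfolding \<rho>_def by (intro tendsto_intros)
  then have \<rho>: "(\<rho> \<longlongrightarrow> 0) (at_right 0)" by simp
  have key: "norm (T s x - T t x - (s - t) *\<^sub>R T t (G x)) \<le> \<rho> \<bar>s - t\<bar> * \<bar>s - t\<bar>"
    if s: "s \<ge> 0" "s \<noteq> t" for s
  proof -
    define a h where "a = min s t" and "h = \<bar>s - t\<bar>"
    have a: "a \<ge> 0" "a \<in> {0..t}" and h: "h > 0" using s t by (auto simp: a_def h_def)
    define y where "y = G x"
    interpret Ta: bounded_linear "T a" by (rule lin[OF a(1)])
    have quot: "T s x - T t x = (s - t) *\<^sub>R T a ((T h x - x) /\<^sub>R h)"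
    proof (cases "s < t")
      case True
      then have "T t x = T a (T h x)" "T s x = T a x" and "s - t = - h"
        using TT[of a h x] a h by (auto simp: a_def h_def)
      then show ?thesis using h by (simp add: Ta.scale Ta.diff)
    next
      case False
      then have "T s x = T a (T h x)" "T t x = T a x" and "s - t = h"
        using TT[of a h x] a h by (auto simp: a_def h_def)
      then show ?thesis using h by (simp add: Ta.scale Ta.diff)
    qed
    have at: "norm (T a y - T t y) \<le> K * norm (T h y - y)"
    proof (cases "s < t")
      case True
      then have "T t y = T a (T h y)" using TT[of a h y] a h by (auto simp: a_def h_def)
      then have "norm (T a y - T t y) = norm (T a (T h y - y))"
        by (simp add: Ta.diff norm_minus_commute)
      then show ?thesis using K(2)[OF a(2)] by simp
    next
      case False
      then have "a = t" by (simp add: a_def)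
      then show ?thesis using K(1) by simp
    qed
    have "T s x - T t x - (s - t) *\<^sub>R T t y = (s - t) *\<^sub>R (T a ((T h x - x) /\<^sub>R h - y) + (T a y - T t y))"
      unfolding quot Ta.diff[of "(T h x - x) /\<^sub>R h" y] by (simp flip: scaleR_diff_right)
    then have "norm (T s x - T t x - (s - t) *\<^sub>R T t y)
        = h * norm (T a ((T h x - x) /\<^sub>R h - y) + (T a y - T t y))"
      by (simp add: h_def)
    also have "\<dots> \<le> h * \<rho> h"
    proof (intro mult_left_mono)
      have "norm (T a ((T h x - x) /\<^sub>R h - y) + (T a y - T t y))
          \<le> norm (T a ((T h x - x) /\<^sub>R h - y)) + norm (T a y - T t y)"
        by (rule norm_triangle_ineq)
      also have "\<dots> \<le> K * norm ((T h x - x) /\<^sub>R h - y) + K * norm (T h y - y)"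
        by (intro add_mono at K(2) a)
      finally show "norm (T a ((T h x - x) /\<^sub>R h - y) + (T a y - T t y)) \<le> \<rho> h"
        by (simp add: \<rho>_def y_def algebra_simps)
    qed (use h in auto)
    finally show ?thesis by (simp add: y_def h_def mult.commute)
  qed
  have "((\<lambda>t. T t x) has_derivative (\<lambda>h. h *\<^sub>R T t (G x))) (at t within {0..})"
    unfolding has_derivative_within_alt
  proof (intro conjI allI impI)
    show "bounded_linear (\<lambda>h. h *\<^sub>R T t (G x))" by (rule bounded_linear_scaleR_left)
    fix e :: real assume "e > 0"
    then have "\<forall>\<^sub>F h in at_right 0. \<rho> h < e" using \<rho> by (rule order_tendstoD(2)[rotated])
    then obtain d where d: "d > 0" "\<And>h. 0 < h \<Longrightarrow> h < d \<Longrightarrow> \<rho> h < e"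
      by (auto simp: eventually_at_right_field)
    have "norm (T s x - T t x - (s - t) *\<^sub>R T t (G x)) \<le> e * norm (s - t)"
      if "s \<in> {0..}" "norm (s - t) < d" for s
    proof (cases "s = t")
      case False
      have "norm (T s x - T t x - (s - t) *\<^sub>R T t (G x)) \<le> \<rho> \<bar>s - t\<bar> * \<bar>s - t\<bar>"
        using key that False by simp
      also have "\<dots> \<le> e * \<bar>s - t\<bar>"
        using d(2)[of "\<bar>s - t\<bar>"] that False by (intro mult_right_mono) auto
      finally show ?thesis by simp
    qed simp
    then show "\<exists>d>0. \<forall>y\<in>{0..}. norm (y - t) < d \<longrightarrow>
        norm (T y x - T t x - (y - t) *\<^sub>R T t (G x)) \<le> e * norm (y - t)"
      using d(1) by blast
  qed
  then show ?thesis by (simp add: has_vector_derivative_def)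
qed

text \<open>
  The semigroup leaves the domain of its generator invariant and commutes with the generator. So on the
  domain the energy method applies with growth rate zero, and density does the rest.
\<close>

lemma contraction_evolution_of_generator:
  fixes T :: "real \<Rightarrow> 'a::complex_hilbert \<Rightarrow> 'a"
  assumes gen: "generates D G T" and dense: "closure D = UNIV"
    and diss: "\<And>x. x \<in> D \<Longrightarrow> inner x (G x) \<le> 0"
  shows "contraction_evolution D G T"
proof -
  have T: "C0_semigroup T" using gen by (simp add: generates_def)
  then have clin: "bounded_clinear (T t)" if "t \<ge> 0" for t using that by (simp add: C0_semigroup_def)
  have T0: "T 0 x = x" for x using T by (simp add: C0_semigroup_def)
  have inv: "T t x \<in> D \<and> G (T t x) = T t (G x)" if x: "x \<in> D" and t: "t \<ge> 0" for x t
  proof -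
    interpret Tt: bounded_linear "T t" using clin[OF t] by (rule bounded_clinearD)
    have "((\<lambda>h. (T h x - x) /\<^sub>R h) \<longlongrightarrow> G x) (at_right 0)" using gen x by (auto simp: generates_def)
    then have lim: "((\<lambda>h. T t ((T h x - x) /\<^sub>R h)) \<longlongrightarrow> T t (G x)) (at_right 0)" by (rule Tt.tendsto)
    have "\<forall>\<^sub>F h in at_right (0::real). 0 < h" by (rule eventually_at_right_less)
    then have "\<forall>\<^sub>F h in at_right 0. T t ((T h x - x) /\<^sub>R h) = (T h (T t x) - T t x) /\<^sub>R h"
    proof eventually_elim
      case (elim h)
      have "T (t + h) = T t \<circ> T h" "T (h + t) = T h \<circ> T t"
        using T t elim by (simp_all add: C0_semigroup_def)
      then have "T t (T h x) = T h (T t x)" by (metis add.commute comp_apply)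
      then show ?case by (simp add: Tt.scale Tt.diff)
    qed
    from Lim_transform_eventually[OF lim this]
    have "((\<lambda>h. (T h (T t x) - T t x) /\<^sub>R h) \<longlongrightarrow> T t (G x)) (at_right 0)" .
    moreover have "((\<lambda>h. (T h (T t x) - T t x) /\<^sub>R h) \<longlongrightarrow> T t (G x)) (at_right 0) \<longleftrightarrow>
        T t x \<in> D \<and> T t (G x) = G (T t x)"
      using gen unfolding generates_def by blast
    ultimately show ?thesis by simp
  qed
  have deriv: "((\<lambda>t. T t x) has_vector_derivative G (T t x)) (at t within {0..})"
    if "x \<in> D" "t \<ge> 0" for x t
    using generates_has_vector_derivative[OF gen that] inv[OF that] by simp
  have "norm (T t x) \<le> 1 * norm x" if t: "t \<ge> 0" for t x
  proof (rule norm_bound_from_dense[OF bounded_clinearD(1)[OF clin[OF t]] dense])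
    fix x assume x: "x \<in> D"
    have "norm (T t x) \<le> norm (T 0 x) + 0 * (t - 0)"
    proof (rule norm_growth[OF t])
      fix s assume s: "s \<in> {0..t}"
      show "((\<lambda>t. T t x) has_vector_derivative G (T s x)) (at s within {0..t})"
        by (rule has_vector_derivative_within_subset[OF deriv[OF x]]) (use s in auto)
      show "inner (T s x) (G (T s x)) \<le> 0 * norm (T s x)"
        using diss[of "T s x"] inv[OF x, of s] s by simp
    qed simp
    then show "norm (T t x) \<le> 1 * norm x" by (simp add: T0)
  qed
  then show ?thesis
    unfolding contraction_evolution_def using clin T0 inv deriv by simp
qed

section \<open>Self-adjoint operators and the group generated by \<i>A\<close>

context
  fixes D :: "'a::complex_hilbert set" and A :: "'a \<Rightarrow> 'a"
  assumes sa: "selfadjoint_operator D A"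
begin

lemma selfadjoint_csubspace: "complex_vector.subspace D"
  using sa by (simp add: selfadjoint_operator_def linear_operator_def)

lemma selfadjoint_dense: "closure D = UNIV"
  using sa by (simp add: selfadjoint_operator_def)

lemma selfadjoint_dom:
  "0 \<in> D" "x \<in> D \<Longrightarrow> y \<in> D \<Longrightarrow> x + y \<in> D" "x \<in> D \<Longrightarrow> y \<in> D \<Longrightarrow> x - y \<in> D" "x \<in> D \<Longrightarrow> - x \<in> D"
  "x \<in> D \<Longrightarrow> a *\<^sub>C x \<in> D" "x \<in> D \<Longrightarrow> r *\<^sub>R x \<in> D"
  using selfadjoint_csubspace
  by (auto simp: complex_vector.subspace_0 complex_vector.subspace_add complex_vector.subspace_diff
      complex_vector.subspace_neg complex_vector.subspace_scale scaleR_scaleC)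

lemma selfadjoint_scaleC: "x \<in> D \<Longrightarrow> A (a *\<^sub>C x) = a *\<^sub>C A x"
  and selfadjoint_add: "x \<in> D \<Longrightarrow> y \<in> D \<Longrightarrow> A (x + y) = A x + A y"
  using sa by (auto simp: selfadjoint_operator_def linear_operator_def)

lemma selfadjoint_scaleR: "x \<in> D \<Longrightarrow> A (r *\<^sub>R x) = r *\<^sub>R A x"
  by (simp add: scaleR_scaleC selfadjoint_scaleC)

lemma selfadjoint_neg: "x \<in> D \<Longrightarrow> A (- x) = - A x"
  using selfadjoint_scaleR[of x "-1"] by simp

lemma selfadjoint_diff: "x \<in> D \<Longrightarrow> y \<in> D \<Longrightarrow> A (x - y) = A x - A y"
  using selfadjoint_add[of x "- y"] by (simp add: selfadjoint_neg selfadjoint_dom)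

lemma selfadjoint_zero: "A 0 = 0"
  using selfadjoint_scaleR[of 0 0] by (simp add: selfadjoint_dom)

lemma selfadjoint_adjoint_iff: "(\<forall>x\<in>D. cinner (A x) y = cinner x w) \<longleftrightarrow> y \<in> D \<and> w = A y"
  using sa by (simp add: selfadjoint_operator_def)

lemma selfadjoint_symmetric: "x \<in> D \<Longrightarrow> y \<in> D \<Longrightarrow> cinner (A x) y = cinner x (A y)"
  using selfadjoint_adjoint_iff[of y "A y"] by blast

lemma selfadjoint_closed:
  assumes "\<And>n. s n \<in> D" "s \<longlonglongrightarrow> u" "(\<lambda>n. A (s n)) \<longlonglongrightarrow> w"
  shows "u \<in> D \<and> A u = w"
proof -
  have "cinner (A x) u = cinner x w" if "x \<in> D" for x
  proof -
    have "(\<lambda>n. cinner (A x) (s n)) \<longlonglongrightarrow> cinner (A x) u"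
      by (intro cinner.tendsto tendsto_const assms)
    moreover have "(\<lambda>n. cinner (A x) (s n)) \<longlonglongrightarrow> cinner x w"
      using that assms(1) by (simp add: selfadjoint_symmetric) (intro cinner.tendsto tendsto_const assms)
    ultimately show ?thesis by (rule LIMSEQ_unique)
  qed
  then show ?thesis using selfadjoint_adjoint_iff[of u w] by blast
qed

lemma selfadjoint_real: "x \<in> D \<Longrightarrow> Im (cinner (A x) x) = 0"
  by (metis selfadjoint_symmetric cinner_commute Reals_cnj_iff complex_is_Real_iff)

end

lemma inner_scaleC_ii_selfadjoint:
  assumes "selfadjoint_operator D A" "x \<in> D"
  shows "inner x (\<i> *\<^sub>C A x) = 0"
proof -
  have "Im (cinner x (A x)) = 0"
    using selfadjoint_real[OF assms] selfadjoint_symmetric[OF assms(1) assms(2) assms(2)] by metis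
  then show ?thesis by (simp add: Re_cinner[symmetric] cinner_scaleC_right)
qed

locale positive_selfadjoint =
  fixes D0 :: "'a::complex_hilbert set" and A0 :: "'a \<Rightarrow> 'a" and Dh :: "'a set" and Ah :: "'a \<Rightarrow> 'a"
  assumes sa: "selfadjoint_operator D0 A0"
    and sqrt: "sqrt_operator D0 A0 Dh Ah"
begin

lemma sah: "selfadjoint_operator Dh Ah"
  using sqrt by (simp add: sqrt_operator_def)

lemma dom_iff: "x \<in> D0 \<longleftrightarrow> x \<in> Dh \<and> Ah x \<in> Dh"
  using sqrt by (auto simp: sqrt_operator_def square_dom_def)

lemma A0_eq: "x \<in> D0 \<Longrightarrow> A0 x = Ah (Ah x)"
  using sqrt by (simp add: sqrt_operator_def)

lemma cinner_A0_left: "x \<in> D0 \<Longrightarrow> y \<in> Dh \<Longrightarrow> cinner (A0 x) y = cinner (Ah x) (Ah y)"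
  by (simp add: A0_eq dom_iff selfadjoint_symmetric[OF sah])

lemma cinner_A0_right: "x \<in> Dh \<Longrightarrow> y \<in> D0 \<Longrightarrow> cinner x (A0 y) = cinner (Ah x) (Ah y)"
  by (simp add: A0_eq dom_iff selfadjoint_symmetric[OF sah])

lemma A0_nonneg: "x \<in> D0 \<Longrightarrow> 0 \<le> inner x (A0 x)"
  using cinner_A0_right[of x x] by (simp add: Re_cinner[symmetric] dom_iff cinner_self)

text \<open>
  Weakly, \<open>u + \<epsilon> A u = f\<close> says \<open>\<langle>u, y\<rangle> + \<epsilon> \<langle>u, y\<rangle>\<^sub>1\<^sub>/\<^sub>2 = \<langle>f, y\<rangle>\<close>, which is the variational problem for
  the closed form of \<open>A\<close>; self-adjointness of the square root turns a weak into a strong solution.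
\<close>

lemma resolvent_exists:
  assumes \<epsilon>: "0 < \<epsilon>"
  shows "\<exists>u\<in>D0. u + \<epsilon> *\<^sub>R A0 u = f"
proof -
  have "\<exists>u\<in>Dh. \<forall>y\<in>Dh. inner u y + inner (sqrt \<epsilon> *\<^sub>R Ah u) (sqrt \<epsilon> *\<^sub>R Ah y) = inner f y"
  proof (rule closed_form_representation)
    show "subspace Dh" by (rule complex_subspace_imp_subspace[OF selfadjoint_csubspace[OF sah]])
    show "bounded_linear (inner f)" by (rule bounded_linear_inner_right)
    fix s u w assume s: "\<And>n. s n \<in> Dh" "s \<longlonglongrightarrow> u" "(\<lambda>n. sqrt \<epsilon> *\<^sub>R Ah (s n)) \<longlonglongrightarrow> w"
    have "(\<lambda>n. (1 / sqrt \<epsilon>) *\<^sub>R (sqrt \<epsilon> *\<^sub>R Ah (s n))) \<longlonglongrightarrow> (1 / sqrt \<epsilon>) *\<^sub>R w"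
      by (intro tendsto_scaleR tendsto_const s)
    then have "(\<lambda>n. Ah (s n)) \<longlonglongrightarrow> (1 / sqrt \<epsilon>) *\<^sub>R w" using \<epsilon> by simp
    from selfadjoint_closed[OF sah s(1,2) this]
    show "u \<in> Dh \<and> sqrt \<epsilon> *\<^sub>R Ah u = w" using \<epsilon> by simp
  qed (simp_all add: selfadjoint_add[OF sah] selfadjoint_scaleR[OF sah] scaleR_add_right)
  then obtain u where u: "u \<in> Dh" and Re_eq: "\<And>y. y \<in> Dh \<Longrightarrow> inner u y + \<epsilon> * inner (Ah u) (Ah y) = inner f y"
    using \<epsilon> by (auto simp flip: mult.assoc)
  have "cinner (Ah y) (Ah u) = cinner y ((1 / \<epsilon>) *\<^sub>R (f - u))" if y: "y \<in> Dh" for y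
  proof -
    have "\<epsilon> *\<^sub>R cinner (Ah y) (Ah u) = cinner y (f - u)"
    proof (rule complex_eqI)
      show "Re (\<epsilon> *\<^sub>R cinner (Ah y) (Ah u)) = Re (cinner y (f - u))"
        using Re_eq[OF y] inner_commute[of u y] inner_commute[of "Ah u" "Ah y"] inner_commute[of f y]
        by (simp add: Re_cinner inner_diff_right)
      have "\<i> *\<^sub>C y \<in> Dh" by (rule selfadjoint_dom(5)[OF sah y])
      from Re_eq[OF this]
      have "Re (cinner (\<i> *\<^sub>C y) u) + \<epsilon> * Re (cinner (\<i> *\<^sub>C Ah y) (Ah u)) = Re (cinner (\<i> *\<^sub>C y) f)"
        by (simp add: Re_cinner inner_commute selfadjoint_scaleC[OF sah y])
      then show "Im (\<epsilon> *\<^sub>R cinner (Ah y) (Ah u)) = Im (cinner y (f - u))"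
        by (simp add: cinner_scaleC_left cinner.diff_right)
    qed
    then show ?thesis unfolding cinner_scaleR_right using \<epsilon> by (metis less_numeral_extra(3) divideR_right inverse_eq_divide)
  qed
  then have "Ah u \<in> Dh" "(1 / \<epsilon>) *\<^sub>R (f - u) = Ah (Ah u)"
    using selfadjoint_adjoint_iff[OF sah] by blast+
  then have uD: "u \<in> D0" and A0u: "A0 u = (1 / \<epsilon>) *\<^sub>R (f - u)"
    using u by (metis dom_iff, metis A0_eq dom_iff)
  show ?thesis
  proof
    show "u + \<epsilon> *\<^sub>R A0 u = f" unfolding A0u scaleR_scaleR using \<epsilon> by simp
  qed (rule uD)
qed

lemma norm_le_norm_resolvent:
  assumes "0 < \<epsilon>" "u \<in> D0"
  shows "norm u \<le> norm (u + \<epsilon> *\<^sub>R A0 u)"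
proof (rule norm_le_of_cinner_le)
  have "Re (cinner u u) \<le> inner u (u + \<epsilon> *\<^sub>R A0 u)"
    using assms A0_nonneg by (simp add: Re_cinner inner_add_right)
  also have "\<dots> \<le> norm (u + \<epsilon> *\<^sub>R A0 u) * norm u"
    using norm_cauchy_schwarz[of u "u + \<epsilon> *\<^sub>R A0 u"] by (simp add: mult.commute)
  finally show "Re (cinner u u) \<le> norm (u + \<epsilon> *\<^sub>R A0 u) * norm u" .
qed simp

definition resolvent :: "real \<Rightarrow> 'a \<Rightarrow> 'a" where
  "resolvent \<epsilon> f = (SOME u. u \<in> D0 \<and> u + \<epsilon> *\<^sub>R A0 u = f)"

context
  fixes \<epsilon> :: real
  assumes \<epsilon>: "0 < \<epsilon>"
begin

lemma resolvent: "resolvent \<epsilon> f \<in> D0" "resolvent \<epsilon> f + \<epsilon> *\<^sub>R A0 (resolvent \<epsilon> f) = f"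
proof -
  have "\<exists>u. u \<in> D0 \<and> u + \<epsilon> *\<^sub>R A0 u = f" using resolvent_exists[OF \<epsilon>] by blast
  then have "resolvent \<epsilon> f \<in> D0 \<and> resolvent \<epsilon> f + \<epsilon> *\<^sub>R A0 (resolvent \<epsilon> f) = f"
    unfolding resolvent_def by (rule someI_ex)
  then show "resolvent \<epsilon> f \<in> D0" "resolvent \<epsilon> f + \<epsilon> *\<^sub>R A0 (resolvent \<epsilon> f) = f" by auto
qed

lemma resolvent_unique:
  assumes "u \<in> D0" "u + \<epsilon> *\<^sub>R A0 u = f"
  shows "resolvent \<epsilon> f = u"
proof -
  have "resolvent \<epsilon> f - u \<in> D0" by (intro selfadjoint_dom[OF sa] resolvent assms)
  from norm_le_norm_resolvent[OF \<epsilon> this]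
  have "norm (resolvent \<epsilon> f - u) \<le> norm ((resolvent \<epsilon> f + \<epsilon> *\<^sub>R A0 (resolvent \<epsilon> f)) - (u + \<epsilon> *\<^sub>R A0 u))"
    by (simp add: selfadjoint_diff[OF sa resolvent(1) assms(1)] algebra_simps)
  then show ?thesis by (simp add: resolvent assms)
qed

lemma norm_resolvent_le: "norm (resolvent \<epsilon> f) \<le> norm f"
  using norm_le_norm_resolvent[OF \<epsilon> resolvent(1), of f] by (simp add: resolvent)

lemma resolvent_add: "resolvent \<epsilon> (f + g) = resolvent \<epsilon> f + resolvent \<epsilon> g"
proof (rule resolvent_unique)
  have "resolvent \<epsilon> f + resolvent \<epsilon> g + \<epsilon> *\<^sub>R A0 (resolvent \<epsilon> f + resolvent \<epsilon> g)
      = (resolvent \<epsilon> f + \<epsilon> *\<^sub>R A0 (resolvent \<epsilon> f)) + (resolvent \<epsilon> g + \<epsilon> *\<^sub>R A0 (resolvent \<epsilon> g))"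
    by (simp add: selfadjoint_add[OF sa resolvent(1) resolvent(1)] scaleR_add_right)
  then show "resolvent \<epsilon> f + resolvent \<epsilon> g + \<epsilon> *\<^sub>R A0 (resolvent \<epsilon> f + resolvent \<epsilon> g) = f + g"
    by (simp add: resolvent)
qed (intro selfadjoint_dom[OF sa] resolvent)

lemma resolvent_scaleC: "resolvent \<epsilon> (a *\<^sub>C f) = a *\<^sub>C resolvent \<epsilon> f"
proof (rule resolvent_unique)
  have "a *\<^sub>C resolvent \<epsilon> f + \<epsilon> *\<^sub>R A0 (a *\<^sub>C resolvent \<epsilon> f) = a *\<^sub>C (resolvent \<epsilon> f + \<epsilon> *\<^sub>R A0 (resolvent \<epsilon> f))"
    unfolding selfadjoint_scaleC[OF sa resolvent(1)] scaleC_add_right scaleR_scaleC scaleC_scaleC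
    by (simp add: mult.commute)
  then show "a *\<^sub>C resolvent \<epsilon> f + \<epsilon> *\<^sub>R A0 (a *\<^sub>C resolvent \<epsilon> f) = a *\<^sub>C f"
    by (simp add: resolvent)
qed (intro selfadjoint_dom[OF sa] resolvent)

lemma bounded_clinear_resolvent: "bounded_clinear (resolvent \<epsilon>)"
  unfolding bounded_clinear_def
  by (auto intro!: bounded_linear_intro[of _ 1] simp: resolvent_add resolvent_scaleC scaleR_scaleC norm_resolvent_le)

lemma resolvent_commute:
  assumes x: "x \<in> D0"
  shows "A0 (resolvent \<epsilon> x) = resolvent \<epsilon> (A0 x)" "A0 (resolvent \<epsilon> x) \<in> D0"
proof -
  let ?u = "resolvent \<epsilon> x"
  have Au: "A0 ?u = (1 / \<epsilon>) *\<^sub>R (x - ?u)"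
    using resolvent(2)[of x] \<epsilon> by (metis add_diff_cancel_left' divide_inverse inverse_eq_divide
        mult_1 real_vector_affinity_eq scaleR_one scaleR_scaleR vector_fraction_eq_iff order_less_irrefl)
  show in_dom: "A0 ?u \<in> D0" unfolding Au by (intro selfadjoint_dom[OF sa] x resolvent)
  have "A0 ?u + \<epsilon> *\<^sub>R A0 (A0 ?u) = A0 (?u + \<epsilon> *\<^sub>R A0 ?u)"
    by (simp add: selfadjoint_add[OF sa] selfadjoint_scaleR[OF sa] selfadjoint_dom[OF sa] in_dom resolvent(1))
  then have "resolvent \<epsilon> (A0 x) = A0 ?u" by (intro resolvent_unique in_dom) (simp add: resolvent)
  then show "A0 ?u = resolvent \<epsilon> (A0 x)" by simp
qed

definition yosida :: "'a \<Rightarrow> 'a" where "yosida f = (1 / \<epsilon>) *\<^sub>R (f - resolvent \<epsilon> f)"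

lemma yosida_eq: "yosida f = A0 (resolvent \<epsilon> f)"
proof -
  have "f - resolvent \<epsilon> f = \<epsilon> *\<^sub>R A0 (resolvent \<epsilon> f)"
    using resolvent(2)[of f] by (metis add_diff_cancel_left')
  then show ?thesis using \<epsilon> by (simp add: yosida_def)
qed

lemma bounded_clinear_yosida: "bounded_clinear yosida"
proof -
  have "bounded_linear (\<lambda>f. (1 / \<epsilon>) *\<^sub>R (f - resolvent \<epsilon> f))"
    by (intro bounded_linear_intros bounded_clinearD(1)[OF bounded_clinear_resolvent]
        bounded_linear_const_scaleR bounded_linear_sub bounded_linear_ident)
  then show ?thesis
    unfolding bounded_clinear_def yosida_def[abs_def]
    by (simp add: resolvent_scaleC scaleR_scaleC scaleC_scaleC mult.commute scaleC.diff_right)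
qed

text \<open>
  \<open>\<langle>A\<^sub>\<epsilon> x, x\<rangle>\<close> is real, because with \<open>x = u + \<epsilon> A u\<close> it equals \<open>\<langle>A u, u\<rangle> + \<epsilon> \<parallel>A u\<parallel>\<^sup>2\<close>. Hence the
  group generated by \<open>\<i> A\<^sub>\<epsilon>\<close> does not increase the norm.
\<close>

lemma inner_scaleC_ii_yosida: "inner x (\<i> *\<^sub>C yosida x) = 0"
proof -
  define u where "u = resolvent \<epsilon> x"
  have u: "u \<in> D0" and x: "x = u + \<epsilon> *\<^sub>R A0 u" using resolvent[of x] by (simp_all add: u_def)
  have "Im (cinner (A0 u) x) = 0"
    unfolding x using selfadjoint_real[OF sa u] by (simp add: cinner_add_right cinner_scaleR_right cinner_self)
  then have "Im (cinner x (A0 u)) = 0" by (subst cinner_commute) simp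
  then show ?thesis
    by (simp add: yosida_eq u_def[symmetric] Re_cinner[symmetric] cinner_scaleC_right)
qed

end

lemma resolvent_resolvent_commute:
  assumes "0 < \<epsilon>" "0 < \<delta>"
  shows "resolvent \<delta> (resolvent \<epsilon> x) = resolvent \<epsilon> (resolvent \<delta> x)"
proof (rule resolvent_unique[OF assms(2)])
  let ?v = "resolvent \<delta> x"
  show "resolvent \<epsilon> ?v \<in> D0" by (rule resolvent[OF assms(1)])
  interpret bounded_linear "resolvent \<epsilon>"
    by (rule bounded_clinearD(1)[OF bounded_clinear_resolvent[OF assms(1)]])
  have "resolvent \<epsilon> ?v + \<delta> *\<^sub>R A0 (resolvent \<epsilon> ?v) = resolvent \<epsilon> (?v + \<delta> *\<^sub>R A0 ?v)"
    by (simp add: add scale resolvent_commute[OF assms(1) resolvent(1)[OF assms(2)]])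
  then show "resolvent \<epsilon> ?v + \<delta> *\<^sub>R A0 (resolvent \<epsilon> ?v) = resolvent \<epsilon> x"
    by (simp add: resolvent[OF assms(2)])
qed

lemma yosida_commute:
  assumes "0 < \<epsilon>" "0 < \<delta>"
  shows "yosida \<delta> (yosida \<epsilon> x) = yosida \<epsilon> (yosida \<delta> x)"
proof -
  interpret e: bounded_linear "resolvent \<epsilon>"
    by (rule bounded_clinearD(1)[OF bounded_clinear_resolvent[OF assms(1)]])
  interpret d: bounded_linear "resolvent \<delta>"
    by (rule bounded_clinearD(1)[OF bounded_clinear_resolvent[OF assms(2)]])
  have "b *\<^sub>R (a *\<^sub>R (x - u) - a *\<^sub>R (v - w)) = a *\<^sub>R (b *\<^sub>R (x - v) - b *\<^sub>R (u - w))"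
    for a b and u v w :: 'a
    by (simp add: algebra_simps)
  then show ?thesis
    unfolding yosida_def[OF assms(1)] yosida_def[OF assms(2)] e.scale d.scale e.diff d.diff
      resolvent_resolvent_commute[OF assms] .
qed


text \<open>The groups generated by \<open>\<i> A\<^sub>n\<close>, with the Yosida approximations \<open>A\<^sub>n\<close> of \<open>A\<close>.\<close>

definition yosida_seq :: "nat \<Rightarrow> 'a \<Rightarrow> 'a" where
  "yosida_seq n = yosida (1 / real (Suc n))"

definition yosida_flow :: "nat \<Rightarrow> real \<Rightarrow> 'a \<Rightarrow> 'a" where
  "yosida_flow n = exp_flow (\<lambda>x. \<i> *\<^sub>C yosida_seq n x)"

lemma inverse_Suc_pos: "0 < 1 / real (Suc n)"
  by simp

lemma yosida_seq_eq: "yosida_seq n x = A0 (resolvent (1 / real (Suc n)) x)"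
  unfolding yosida_seq_def by (rule yosida_eq[OF inverse_Suc_pos])

lemma yosida_seq_commute: "yosida_seq m (yosida_seq n x) = yosida_seq n (yosida_seq m x)"
  unfolding yosida_seq_def by (rule yosida_commute[OF inverse_Suc_pos inverse_Suc_pos])

lemma inner_ii_yosida_seq: "inner x (\<i> *\<^sub>C yosida_seq n x) = 0"
  unfolding yosida_seq_def by (rule inner_scaleC_ii_yosida[OF inverse_Suc_pos])

lemmas clinear_yosida_seq = bounded_clinear_yosida[OF inverse_Suc_pos, folded yosida_seq_def]

lemma bounded_linear_ii_yosida_seq: "bounded_linear (\<lambda>x. \<i> *\<^sub>C yosida_seq n x)"
  by (rule bounded_linear_compose[OF scaleC.bounded_linear_right bounded_clinearD(1)[OF clinear_yosida_seq]])

text \<open>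
  On the domain of \<open>A\<close>, \<open>J\<^sub>\<epsilon> x - x = - \<epsilon> J\<^sub>\<epsilon> A x\<close>; elsewhere, approximate and use that \<open>J\<^sub>\<epsilon>\<close> is a
  contraction.
\<close>

lemma resolvent_tendsto: "(\<lambda>n. resolvent (1 / real (Suc n)) x) \<longlonglongrightarrow> x"
proof (rule metric_LIMSEQ_I)
  fix e :: real assume e: "e > 0"
  obtain x' where x': "x' \<in> D0" "dist x' x < e / 3"
    using selfadjoint_dense[OF sa] closure_approachable[of x D0] e by (metis UNIV_I divide_pos_pos zero_less_numeral)
  obtain N where N: "3 * norm (A0 x') / e < real N" using reals_Archimedean2 by blast
  have "dist (resolvent (1 / real (Suc n)) x) x < e" if n: "n \<ge> N" for n
  proof -
    let ?J = "resolvent (1 / real (Suc n))"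
    interpret J: bounded_linear ?J by (rule bounded_clinearD(1)[OF bounded_clinear_resolvent[OF inverse_Suc_pos]])
    have "?J x' - x' = - ((1 / real (Suc n)) *\<^sub>R ?J (A0 x'))"
      using resolvent(2)[OF inverse_Suc_pos, of n x'] resolvent_commute(1)[OF inverse_Suc_pos x'(1), of n]
      by (metis add_diff_cancel_left' minus_diff_eq)
    then have "norm (?J x' - x') = norm (?J (A0 x')) / real (Suc n)"
      by (simp add: divide_inverse mult.commute)
    also have "\<dots> \<le> norm (A0 x') / real (Suc n)"
      by (intro divide_right_mono norm_resolvent_le) auto
    also have "\<dots> < e / 3"
    proof -
      have "3 * norm (A0 x') / e < real (Suc n)" using N n by simp
      then show ?thesis using e by (simp add: field_simps)
    qed
    finally have 1: "norm (?J x' - x') < e / 3" .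
    have 2: "norm (?J (x - x')) < e / 3"
      using norm_resolvent_le[OF inverse_Suc_pos, of n "x - x'"] x'(2) by (simp add: dist_norm norm_minus_commute)
    have "?J x - x = ?J (x - x') + (?J x' - x') + (x' - x)"
      unfolding J.diff by simp
    then have "norm (?J x - x) \<le> norm (?J (x - x')) + norm (?J x' - x') + norm (x' - x)"
      by (metis norm_triangle_mono[OF norm_triangle_ineq order_refl])
    then show ?thesis using 1 2 x'(2) by (simp add: dist_norm)
  qed
  then show "\<exists>N. \<forall>n\<ge>N. dist (resolvent (1 / real (Suc n)) x) x < e" by blast
qed

lemma yosida_seq_tendsto:
  assumes "x \<in> D0"
  shows "(\<lambda>n. yosida_seq n x) \<longlonglongrightarrow> A0 x"
proof -
  have "yosida_seq n x = resolvent (1 / real (Suc n)) (A0 x)" for n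
    unfolding yosida_seq_eq by (rule resolvent_commute[OF inverse_Suc_pos assms])
  then show ?thesis using resolvent_tendsto[of "A0 x"] by simp
qed

lemma yosida_flow_deriv:
  "((\<lambda>t. yosida_flow n t x) has_vector_derivative \<i> *\<^sub>C yosida_seq n (yosida_flow n t x)) (at t within S)"
  unfolding yosida_flow_def by (rule exp_flow_has_vector_derivative_within[OF bounded_linear_ii_yosida_seq])

lemma yosida_flow_zero: "yosida_flow n 0 x = x"
  unfolding yosida_flow_def by (rule exp_flow_zero[OF bounded_linear_ii_yosida_seq])

lemma yosida_flow_add: "yosida_flow n t (x + y) = yosida_flow n t x + yosida_flow n t y"
  unfolding yosida_flow_def by (rule exp_flow_add[OF bounded_linear_ii_yosida_seq])

lemma yosida_flow_scaleC: "yosida_flow n t (a *\<^sub>C x) = a *\<^sub>C yosida_flow n t x"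
  unfolding yosida_flow_def
  by (rule exp_flow_commute[OF bounded_linear_ii_yosida_seq, symmetric])
    (auto intro: scaleC.bounded_linear_right simp: bounded_clinearD(2)[OF clinear_yosida_seq] scaleC_scaleC mult.commute)

lemma yosida_flow_diff: "yosida_flow n t (x - y) = yosida_flow n t x - yosida_flow n t y"
  using yosida_flow_add[of n t "x - y" y] by simp

lemma yosida_seq_flow: "yosida_seq m (yosida_flow n t x) = yosida_flow n t (yosida_seq m x)"
  unfolding yosida_flow_def
proof (rule exp_flow_commute[OF bounded_linear_ii_yosida_seq])
  show "bounded_linear (yosida_seq m)" by (rule bounded_clinearD(1)[OF clinear_yosida_seq])
  show "yosida_seq m (\<i> *\<^sub>C yosida_seq n x) = \<i> *\<^sub>C yosida_seq n (yosida_seq m x)" for x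
    unfolding bounded_clinearD(2)[OF clinear_yosida_seq]
    by (simp add: yosida_seq_commute)
qed

lemma norm_yosida_flow_le:
  assumes "0 \<le> t"
  shows "norm (yosida_flow n t x) \<le> norm x"
proof -
  have "norm (yosida_flow n t x) \<le> norm (yosida_flow n 0 x) + 0 * (t - 0)"
    by (rule norm_growth[OF assms yosida_flow_deriv])
      (simp_all add: inner_ii_yosida_seq)
  then show ?thesis by (simp add: yosida_flow_zero)
qed

text \<open>
  The difference \<open>w\<close> of two flows solves \<open>w' = \<i> A\<^sub>n w + \<i> (A\<^sub>n - A\<^sub>m) u\<^sub>m\<close>. All operators commute, so the
  source is the flow of \<open>(A\<^sub>n - A\<^sub>m) x\<close> and its norm does not grow.
\<close>

lemma yosida_flow_cauchy:
  assumes t: "0 \<le> t"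
  shows "norm (yosida_flow n t x - yosida_flow m t x) \<le> t * norm (yosida_seq n x - yosida_seq m x)"
proof -
  define w where "w t = yosida_flow n t x - yosida_flow m t x" for t
  define w' where "w' t = \<i> *\<^sub>C yosida_seq n (yosida_flow n t x) - \<i> *\<^sub>C yosida_seq m (yosida_flow m t x)" for t
  have "norm (w t) \<le> norm (w 0) + norm (yosida_seq n x - yosida_seq m x) * (t - 0)"
  proof (rule norm_growth[OF t])
    fix s assume s: "s \<in> {0..t}"
    show "(w has_vector_derivative w' s) (at s within {0..t})"
      unfolding w_def[abs_def] w'_def by (intro has_vector_derivative_diff yosida_flow_deriv)
    let ?r = "yosida_seq n (yosida_flow m s x) - yosida_seq m (yosida_flow m s x)"
    have "w' s = \<i> *\<^sub>C yosida_seq n (w s) + \<i> *\<^sub>C ?r"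
      by (simp add: w_def w'_def linear_diff[OF bounded_linear.linear[OF bounded_clinearD(1)[OF clinear_yosida_seq]]]
          scaleC.diff_right)
    then have "inner (w s) (w' s) = inner (w s) (\<i> *\<^sub>C ?r)"
      by (simp add: inner_add_right inner_ii_yosida_seq)
    also have "\<dots> \<le> norm (w s) * norm (\<i> *\<^sub>C ?r)" by (rule norm_cauchy_schwarz)
    also have "norm (\<i> *\<^sub>C ?r) = norm ?r" by (simp add: norm_scaleC)
    also have "?r = yosida_flow m s (yosida_seq n x - yosida_seq m x)"
      by (simp add: yosida_seq_flow yosida_flow_diff)
    also have "norm (w s) * norm (yosida_flow m s (yosida_seq n x - yosida_seq m x))
        \<le> norm (w s) * norm (yosida_seq n x - yosida_seq m x)"
      using s by (intro mult_left_mono norm_yosida_flow_le) auto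
    finally show "inner (w s) (w' s) \<le> norm (yosida_seq n x - yosida_seq m x) * norm (w s)"
      by (simp add: mult.commute)
  qed simp
  then show ?thesis by (simp add: w_def yosida_flow_zero mult.commute)
qed

definition group :: "real \<Rightarrow> 'a \<Rightarrow> 'a" where
  "group t x = lim (\<lambda>n. yosida_flow n t x)"

lemma group_uniform_limit:
  "uniform_limit {0..R} (\<lambda>n t. yosida_flow n t x) (\<lambda>t. group t x) sequentially"
proof -
  have "uniformly_Cauchy_on {0..R} (\<lambda>n t. yosida_flow n t x)"
  proof (rule uniformly_Cauchy_onI)
    fix e :: real assume e: "e > 0"
    obtain x' where x': "x' \<in> D0" "dist x' x < e / 4"
      using selfadjoint_dense[OF sa] closure_approachable[of x D0] e by (metis UNIV_I divide_pos_pos zero_less_numeral)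
    have "Cauchy (\<lambda>n. yosida_seq n x')" by (rule LIMSEQ_imp_Cauchy[OF yosida_seq_tendsto[OF x'(1)]])
    moreover have "0 < e / (4 * (\<bar>R\<bar> + 1))" using e by simp
    ultimately obtain M where M: "\<And>m n. m \<ge> M \<Longrightarrow> n \<ge> M \<Longrightarrow>
        dist (yosida_seq m x') (yosida_seq n x') < e / (4 * (\<bar>R\<bar> + 1))"
      unfolding Cauchy_def by blast
    have "dist (yosida_flow m t x) (yosida_flow n t x) < e" if t: "t \<in> {0..R}" and mn: "m \<ge> M" "n \<ge> M" for t m n
    proof -
      have "norm (yosida_flow m t x' - yosida_flow n t x') \<le> t * norm (yosida_seq m x' - yosida_seq n x')"
        using t by (intro yosida_flow_cauchy) auto
      also have "\<dots> \<le> (\<bar>R\<bar> + 1) * (e / (4 * (\<bar>R\<bar> + 1)))"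
        using t M[OF mn] by (intro mult_mono) (auto simp: dist_norm)
      also have "\<dots> = e / 4"
        using nonzero_mult_divide_mult_cancel_left[of "\<bar>R\<bar> + 1" e 4] by (simp add: mult.commute)
      finally have 1: "norm (yosida_flow m t x' - yosida_flow n t x') \<le> e / 4" .
      have 2: "norm (yosida_flow k t (x - x')) \<le> e / 4" for k
        using norm_yosida_flow_le[of t k "x - x'"] t x'(2) by (simp add: dist_norm norm_minus_commute)
      have "yosida_flow m t x - yosida_flow n t x = (yosida_flow m t (x - x') - yosida_flow n t (x - x'))
          + (yosida_flow m t x' - yosida_flow n t x')"
        by (simp add: yosida_flow_diff)
      then have "norm (yosida_flow m t x - yosida_flow n t x)
          \<le> norm (yosida_flow m t (x - x')) + norm (yosida_flow n t (x - x'))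
            + norm (yosida_flow m t x' - yosida_flow n t x')"
        by (metis norm_triangle_mono[OF norm_triangle_ineq4 order_refl])
      with 1 2[of m] 2[of n] e show ?thesis by (simp add: dist_norm)
    qed
    then show "\<exists>M. \<forall>t\<in>{0..R}. \<forall>m\<ge>M. \<forall>n\<ge>M. dist (yosida_flow m t x) (yosida_flow n t x) < e" by blast
  qed
  then show ?thesis
    unfolding group_def by (simp add: Cauchy_uniformly_convergent uniformly_convergent_uniform_limit_iff[symmetric])
qed

lemma group_tendsto: "0 \<le> t \<Longrightarrow> (\<lambda>n. yosida_flow n t x) \<longlonglongrightarrow> group t x"
  using tendsto_uniform_limitI[OF group_uniform_limit[where R = t and x = x], of t] by simp

lemma norm_group_le: "0 \<le> t \<Longrightarrow> norm (group t x) \<le> norm x"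
  by (rule LIMSEQ_le_const2[OF tendsto_norm[OF group_tendsto]]) (auto intro: norm_yosida_flow_le)

lemma bounded_clinear_group:
  assumes t: "0 \<le> t"
  shows "bounded_clinear (group t)"
proof -
  have add: "group t (x + y) = group t x + group t y" for x y
    using group_tendsto[OF t, of "x + y"] tendsto_add[OF group_tendsto[OF t, of x] group_tendsto[OF t, of y]]
    by (simp add: yosida_flow_add LIMSEQ_unique)
  have scale: "group t (a *\<^sub>C x) = a *\<^sub>C group t x" for a x
    using group_tendsto[OF t, of "a *\<^sub>C x"] scaleC.tendsto[OF tendsto_const group_tendsto[OF t, of x], of a]
    by (simp add: yosida_flow_scaleC LIMSEQ_unique)
  show ?thesis
    unfolding bounded_clinear_def
    by (auto intro!: bounded_linear_intro[of _ 1] simp: add scale scaleR_scaleC norm_group_le t)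
qed

text \<open>A moving argument is harmless because all the operators are contractions.\<close>

lemma yosida_flow_tendsto_group:
  assumes t: "0 \<le> t" and y: "y \<longlonglongrightarrow> y0"
  shows "(\<lambda>n. yosida_flow n t (y n)) \<longlonglongrightarrow> group t y0"
proof -
  have "(\<lambda>n. norm (y n - y0)) \<longlonglongrightarrow> 0" using y by (simp add: LIM_zero_iff tendsto_norm_zero_iff)
  then have "(\<lambda>n. yosida_flow n t (y n - y0)) \<longlonglongrightarrow> 0"
    by (rule Lim_null_comparison[rotated]) (simp add: norm_yosida_flow_le[OF t])
  from tendsto_add[OF this group_tendsto[OF t, of y0]] show ?thesis by (simp add: yosida_flow_diff)
qed

text \<open>
  The elements \<open>J\<^sub>n u\<^sub>n\<close> of the domain have the same limit as the approximations \<open>u\<^sub>n\<close>, and \<open>A J\<^sub>n u\<^sub>n = A\<^sub>n u\<^sub>n\<close>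
  is the approximate flow of \<open>A\<^sub>n x\<close>, which converges. As \<open>A\<close> is closed, it can be taken to the limit.
\<close>

lemma group_dom:
  assumes t: "0 \<le> t" and x: "x \<in> D0"
  shows "group t x \<in> D0 \<and> A0 (group t x) = group t (A0 x)"
proof (rule selfadjoint_closed[OF sa])
  let ?J = "\<lambda>n. resolvent (1 / real (Suc n))"
  let ?s = "\<lambda>n. ?J n (yosida_flow n t x)"
  show "?s n \<in> D0" for n by (rule resolvent[OF inverse_Suc_pos])
  have "A0 (?s n) = yosida_flow n t (yosida_seq n x)" for n
    unfolding yosida_seq_flow[symmetric] by (rule yosida_seq_eq[symmetric])
  then show "(\<lambda>n. A0 (?s n)) \<longlonglongrightarrow> group t (A0 x)"
    using yosida_flow_tendsto_group[OF t yosida_seq_tendsto[OF x]] by simp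
  have J_diff: "?J n (a - b) = ?J n a - ?J n b" for n a b
    by (rule linear_diff[OF bounded_linear.linear[OF bounded_clinearD(1)[OF bounded_clinear_resolvent[OF inverse_Suc_pos]]]])
  have "(\<lambda>n. norm (yosida_flow n t x - group t x)) \<longlonglongrightarrow> 0"
    using group_tendsto[OF t, of x] by (simp add: LIM_zero_iff tendsto_norm_zero_iff)
  then have "(\<lambda>n. ?J n (yosida_flow n t x - group t x)) \<longlonglongrightarrow> 0"
    by (rule Lim_null_comparison[rotated]) (simp add: norm_resolvent_le)
  from tendsto_add[OF this resolvent_tendsto[of "group t x"]]
  show "?s \<longlonglongrightarrow> group t x" unfolding J_diff by simp
qed

text \<open>The derivatives \<open>u\<^sub>n' = u\<^sub>n(t; \<i> A\<^sub>n x)\<close> converge locally uniformly.\<close>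

lemma group_deriv:
  assumes t: "0 \<le> t" and x: "x \<in> D0"
  shows "((\<lambda>t. group t x) has_vector_derivative group t (\<i> *\<^sub>C A0 x)) (at t within {0..})"
proof -
  define S where "S = {0..t + 1}"
  have "\<exists>g. \<forall>s\<in>S. (\<lambda>n. yosida_flow n s x) \<longlonglongrightarrow> g s \<and>
      (g has_derivative (\<lambda>h. h *\<^sub>R group s (\<i> *\<^sub>C A0 x))) (at s within S)"
  proof (rule has_derivative_sequence)
    show "convex S" by (simp add: S_def)
    show "((\<lambda>s. yosida_flow n s x) has_derivative (\<lambda>h. h *\<^sub>R yosida_flow n s (\<i> *\<^sub>C yosida_seq n x))) (at s within S)"
      for n s
      using yosida_flow_deriv[of n x s S] by (simp add: has_vector_derivative_def yosida_seq_flow yosida_flow_scaleC)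
    show "0 \<in> S" using t by (simp add: S_def)
    show "(\<lambda>n. yosida_flow n 0 x) \<longlonglongrightarrow> x" by (simp add: yosida_flow_zero)
    fix e :: real assume e: "e > 0"
    have "(\<lambda>n. \<i> *\<^sub>C yosida_seq n x) \<longlonglongrightarrow> \<i> *\<^sub>C A0 x"
      by (intro scaleC.tendsto tendsto_const yosida_seq_tendsto x)
    then have "\<forall>\<^sub>F n in sequentially. dist (\<i> *\<^sub>C yosida_seq n x) (\<i> *\<^sub>C A0 x) < e / 2"
      by (rule tendstoD) (use e in simp)
    moreover have "\<forall>\<^sub>F n in sequentially. \<forall>s\<in>S. dist (yosida_flow n s (\<i> *\<^sub>C A0 x)) (group s (\<i> *\<^sub>C A0 x)) < e / 2"
      using uniform_limitD[OF group_uniform_limit, of "e / 2"] e by (simp add: S_def)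
    ultimately show "\<forall>\<^sub>F n in sequentially. \<forall>s\<in>S. \<forall>h.
        norm (h *\<^sub>R yosida_flow n s (\<i> *\<^sub>C yosida_seq n x) - h *\<^sub>R group s (\<i> *\<^sub>C A0 x)) \<le> e * norm h"
    proof eventually_elim
      case (elim n)
      show ?case
      proof (intro ballI allI)
        fix s h assume s: "s \<in> S"
        let ?u = "yosida_flow n s (\<i> *\<^sub>C yosida_seq n x)" and ?v = "group s (\<i> *\<^sub>C A0 x)"
        have "norm (?u - yosida_flow n s (\<i> *\<^sub>C A0 x)) \<le> norm (\<i> *\<^sub>C yosida_seq n x - \<i> *\<^sub>C A0 x)"
          unfolding yosida_flow_diff[symmetric] by (rule norm_yosida_flow_le) (use s in \<open>simp add: S_def\<close>)
        moreover have "norm (yosida_flow n s (\<i> *\<^sub>C A0 x) - ?v) < e / 2"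
          using elim(2) s by (simp add: dist_norm)
        moreover have "norm (\<i> *\<^sub>C yosida_seq n x - \<i> *\<^sub>C A0 x) < e / 2"
          using elim(1) by (simp only: dist_norm)
        ultimately have "norm (?u - ?v) \<le> e"
          using norm_diff_triangle_ineq[of ?u "yosida_flow n s (\<i> *\<^sub>C A0 x)" "yosida_flow n s (\<i> *\<^sub>C A0 x)" ?v]
            norm_triangle_ineq[of "?u - yosida_flow n s (\<i> *\<^sub>C A0 x)" "yosida_flow n s (\<i> *\<^sub>C A0 x) - ?v"]
          by (simp only: diff_add_cancel add_diff_eq)
        then show "norm (h *\<^sub>R ?u - h *\<^sub>R ?v) \<le> e * norm h"
          using mult_left_mono[of "norm (?u - ?v)" e "\<bar>h\<bar>"]
          by (simp add: scaleR_diff_right[symmetric] mult.commute del: scaleR_diff_right)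
      qed
    qed
  qed
  then obtain g where g: "\<And>s. s \<in> S \<Longrightarrow> (\<lambda>n. yosida_flow n s x) \<longlonglongrightarrow> g s"
    "\<And>s. s \<in> S \<Longrightarrow> (g has_derivative (\<lambda>h. h *\<^sub>R group s (\<i> *\<^sub>C A0 x))) (at s within S)"
    by blast
  have gU: "g s = group s x" if "s \<in> S" for s
    using g(1)[OF that] group_tendsto[of s x] that by (intro LIMSEQ_unique[OF g(1)[OF that]]) (simp add: S_def)
  have tS: "t \<in> S" using t by (simp add: S_def)
  have "(g has_vector_derivative group t (\<i> *\<^sub>C A0 x)) (at t within S)"
    unfolding has_vector_derivative_def by (rule g(2)[OF tS])
  then have "((\<lambda>t. group t x) has_vector_derivative group t (\<i> *\<^sub>C A0 x)) (at t within S)"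
    by (rule has_vector_derivative_transform[rotated 2, OF _ tS]) (simp add: gU)
  moreover have "at t within S = at t within {0..}"
    by (rule at_within_nhd[of t "{..<t + 1}"]) (use t in \<open>auto simp: S_def\<close>)
  ultimately show ?thesis by simp
qed

lemma contraction_evolution_group: "contraction_evolution D0 (\<lambda>x. \<i> *\<^sub>C A0 x) group"
proof -
  have "group 0 x = x" for x
    using group_tendsto[of 0 x] by (simp add: yosida_flow_zero LIMSEQ_const_iff)
  moreover have "\<i> *\<^sub>C A0 (group t x) = group t (\<i> *\<^sub>C A0 x)" if "0 \<le> t" "x \<in> D0" for t x
    using group_dom[OF that] by (simp add: bounded_clinearD(2)[OF bounded_clinear_group[OF that(1)]])
  ultimately show ?thesis
    unfolding contraction_evolution_def
    using bounded_clinear_group norm_group_le group_dom group_deriv by simp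
qed

end

section \<open>The observed system and its observers\<close>

lemma has_real_derivative_norm_squared:
  fixes f :: "real \<Rightarrow> 'a::real_inner"
  assumes "(f has_vector_derivative f') (at t within S)"
  shows "((\<lambda>t. (norm (f t))\<^sup>2) has_real_derivative (2 * inner (f t) f')) (at t within S)"
  using assms unfolding has_field_derivative_def has_vector_derivative_def power2_norm_eq_inner
  by (auto intro!: derivative_eq_intros simp: inner_commute algebra_simps)

locale observed_system = positive_selfadjoint D0 A0 Dh Ah
  for D0 :: "'a::complex_hilbert set" and A0 :: "'a \<Rightarrow> 'a" and Dh :: "'a set" and Ah :: "'a \<Rightarrow> 'a" +
  fixes C :: "'a \<Rightarrow> 'b::complex_hilbert"
  assumes strict: "strictly_positive_operator D0 A0"
    and C: "bounded_clinear C"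
    and B_dom: "bounded_on_domain D0 (\<lambda>x. norm (A0 x)) (cadjoint C \<circ> C)"
begin

abbreviation B :: "'a \<Rightarrow> 'a" where "B x \<equiv> cadjoint C (C x)"

lemma cinner_B: "cinner (B x) y = cinner (C x) (C y)" "cinner x (B y) = cinner (C x) (C y)"
proof -
  show "cinner x (B y) = cinner (C x) (C y)" for x y
    by (simp add: cinner_cadjoint[OF C])
  then have "cnj (cinner y (B x)) = cnj (cinner (C y) (C x))" by simp
  then show "cinner (B x) y = cinner (C x) (C y)" by (simp only: cinner_commute[symmetric])
qed

lemma inner_B: "inner x (B x) = (norm (C x))\<^sup>2"
  by (simp add: Re_cinner[symmetric] cinner_B cinner_self)

lemma bounded_linear_C: "bounded_linear C"
  and bounded_linear_adjC: "bounded_linear (cadjoint C)"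
  and bounded_linear_B: "bounded_linear (\<lambda>x. B x)"
  using bounded_clinearD(1)[OF C] bounded_clinearD(1)[OF bounded_clinear_cadjoint[OF C]]
  by (auto intro: bounded_linear_compose)

lemma B_diff: "B (x - y) = B x - B y"
  using linear_diff[OF bounded_linear.linear[OF bounded_linear_B]] .

definition \<beta> :: real where "\<beta> = onorm (\<lambda>x. B x)"

lemma \<beta>_nonneg: "0 \<le> \<beta>" unfolding \<beta>_def by (rule onorm_pos_le[OF bounded_linear_B])

lemma norm_B_le: "norm (B x) \<le> \<beta> * norm x" unfolding \<beta>_def by (rule onorm[OF bounded_linear_B])

lemma B_in_dom: "x \<in> D0 \<Longrightarrow> B x \<in> D0"
  using B_dom by (auto simp: bounded_on_domain_def)

lemma coercive: "\<exists>m>0. \<forall>x\<in>D0. m * norm x \<le> norm (A0 x)"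
proof -
  obtain m where m: "m > 0" "\<And>x. x \<in> D0 \<Longrightarrow> m * (norm x)\<^sup>2 \<le> Re (cinner (A0 x) x)"
    using strict by (auto simp: strictly_positive_operator_def)
  have "m * norm x \<le> norm (A0 x)" if x: "x \<in> D0" for x
  proof (cases "x = 0")
    case False
    have "m * (norm x)\<^sup>2 \<le> norm (A0 x) * norm x"
      using m(2)[OF x] cmod_cinner_le[of "A0 x" x] complex_Re_le_cmod[of "cinner (A0 x) x"] by linarith
    then show ?thesis using False by (simp add: power2_eq_square)
  qed simp
  with m(1) show ?thesis by blast
qed

text \<open>
  The constants \<open>m0\<close>, \<open>KB\<close>, \<open>\<beta>\<close> and \<open>K1\<close> to \<open>K4\<close> depend on \<open>A\<close> and \<open>C\<close> only. The constant of the error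
  estimate is made from \<open>m0\<close> alone, so it can be chosen before the observation time.
\<close>

definition m0 :: real where "m0 = (SOME m. m > 0 \<and> (\<forall>x\<in>D0. m * norm x \<le> norm (A0 x)))"

lemma m0: "m0 > 0" "x \<in> D0 \<Longrightarrow> m0 * norm x \<le> norm (A0 x)"
proof -
  have "m0 > 0 \<and> (\<forall>x\<in>D0. m0 * norm x \<le> norm (A0 x))"
    unfolding m0_def by (rule someI_ex) (use coercive in blast)
  then show "m0 > 0" "x \<in> D0 \<Longrightarrow> m0 * norm x \<le> norm (A0 x)" by auto
qed

lemma norm_le_norm_A0: "x \<in> D0 \<Longrightarrow> norm x \<le> norm (A0 x) / m0"
  using m0 by (simp add: pos_le_divide_eq mult.commute)

definition KB :: real where "KB = (SOME K. 0 \<le> K \<and> (\<forall>x\<in>D0. norm (A0 (B x)) \<le> K * norm (A0 x)))"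

lemma KB: "0 \<le> KB" "x \<in> D0 \<Longrightarrow> norm (A0 (B x)) \<le> KB * norm (A0 x)"
proof -
  obtain K where K: "\<And>x. x \<in> D0 \<Longrightarrow> norm (A0 (B x)) \<le> K * norm (A0 x)"
    using B_dom by (auto simp: bounded_on_domain_def)
  have "norm (A0 (B x)) \<le> \<bar>K\<bar> * norm (A0 x)" if "x \<in> D0" for x
    by (rule order_trans[OF K[OF that]]) (intro mult_right_mono; simp)
  then have "\<exists>K. 0 \<le> K \<and> (\<forall>x\<in>D0. norm (A0 (B x)) \<le> K * norm (A0 x))" by (intro exI[of _ "\<bar>K\<bar>"]) simp
  then have "0 \<le> KB \<and> (\<forall>x\<in>D0. norm (A0 (B x)) \<le> KB * norm (A0 x))" unfolding KB_def by (rule someI_ex)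
  then show "0 \<le> KB" "x \<in> D0 \<Longrightarrow> norm (A0 (B x)) \<le> KB * norm (A0 x)" by auto
qed

text \<open>
  The generators of the forward observer (\<open>\<sigma> = 1, c = 1\<close>), of the backward observer
  (\<open>\<sigma> = -1, c = 1\<close>) and of the undamped group (\<open>\<sigma> = 1, c = 0\<close>) are treated together.
\<close>

definition generator :: "real \<Rightarrow> real \<Rightarrow> 'a \<Rightarrow> 'a" where
  "generator \<sigma> c x = \<sigma> *\<^sub>R (\<i> *\<^sub>C A0 x) - c *\<^sub>R B x"

lemma inner_generator: "x \<in> D0 \<Longrightarrow> inner x (generator \<sigma> c x) = - c * (norm (C x))\<^sup>2"
  by (simp add: generator_def inner_diff_right inner_scaleC_ii_selfadjoint[OF sa] inner_B)

lemma generator_diff: "x \<in> D0 \<Longrightarrow> y \<in> D0 \<Longrightarrow> generator \<sigma> c (x - y) = generator \<sigma> c x - generator \<sigma> c y"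
  by (simp add: generator_def selfadjoint_diff[OF sa] B_diff scaleC.diff_right algebra_simps)

lemma A0_eq_generator:
  assumes "\<sigma> * \<sigma> = 1"
  shows "A0 x = (- \<i> * of_real \<sigma>) *\<^sub>C (generator \<sigma> c x + c *\<^sub>R B x)"
proof -
  have "of_real \<sigma> * of_real \<sigma> = (1::complex)" using assms by (metis of_real_1 of_real_mult)
  then show ?thesis
    by (simp add: generator_def scaleR_scaleC scaleC_scaleC algebra_simps)
qed

lemma generator_in_dom: "x \<in> square_dom D0 A0 \<Longrightarrow> generator \<sigma> c x \<in> D0"
  by (auto simp: generator_def square_dom_def intro!: selfadjoint_dom[OF sa] B_in_dom)

text \<open>
  \<open>K1\<close> bounds the semigroups in the graph norm of \<open>A\<close>. \<open>K2\<close> bounds a trajectory and its derivative in this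
  norm by \<open>\<parallel>A\<^sup>2 q\<parallel>\<close>, \<open>K3\<close> bounds the semigroups in the graph norm of \<open>A\<^sup>2\<close>, and \<open>K4\<close> is the constant of the
  consistency error of one forward-backward sweep.
\<close>

definition K1 :: real where "K1 = 1 + 2 * \<beta> / m0"

lemma K1: "1 \<le> K1" using \<beta>_nonneg m0(1) by (simp add: K1_def)

definition K2 :: real where "K2 = K1 * (1 + KB / m0) + K1 / m0"

lemma K2_nonneg: "0 \<le> K2"
  using K1 KB(1) m0(1) by (simp add: K2_def)

definition K3 :: real where "K3 = (1 + KB) * K2"

definition K4 :: real where "K4 = (1 + \<beta>) * (K2 + K2 * K3)"

lemma K4_nonneg: "0 \<le> K4"
  using \<beta>_nonneg K2_nonneg KB(1) by (simp add: K4_def K3_def)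

context
  fixes \<sigma> c :: real and T :: "real \<Rightarrow> 'a \<Rightarrow> 'a"
  assumes \<sigma>: "\<sigma> * \<sigma> = 1" and c: "0 \<le> c" "c \<le> 1"
    and T: "contraction_evolution D0 (generator \<sigma> c) T"
begin

lemmas TD = contraction_evolutionD[OF T]

lemma T_lin:
  assumes "0 \<le> t"
  shows "T t (x + y) = T t x + T t y" "T t (x - y) = T t x - T t y" "T t (r *\<^sub>R x) = r *\<^sub>R T t x"
    "T t (a *\<^sub>C x) = a *\<^sub>C T t x"
  using bounded_linear.linear[OF bounded_clinearD(1)[OF TD(2)[OF assms]]] bounded_clinearD(2)[OF TD(2)[OF assms]]
  by (auto simp: linear_add linear_diff linear_scale)

text \<open>
  The commutator of \<open>A\<close> with the semigroup is bounded, since \<open>A\<close> differs from a multiple of the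
  generator, which commutes with the semigroup, by a multiple of \<open>B\<close>.
\<close>

lemma A0_T:
  assumes t: "0 \<le> t" and x: "x \<in> D0"
  shows "A0 (T t x) = T t (A0 x) - (\<i> * of_real (\<sigma> * c)) *\<^sub>C (B (T t x) - T t (B x))"
proof -
  have "A0 (T t x) = (- \<i> * of_real \<sigma>) *\<^sub>C (T t (generator \<sigma> c x) + c *\<^sub>R B (T t x))"
    using A0_eq_generator[OF \<sigma>, of "T t x" c] TD(5)[OF t x] by simp
  also have "T t (generator \<sigma> c x) = T t ((generator \<sigma> c x + c *\<^sub>R B x) - c *\<^sub>R B x)" by simp
  also have "\<dots> = T t (generator \<sigma> c x + c *\<^sub>R B x) - c *\<^sub>R T t (B x)"
    by (simp only: T_lin[OF t])
  also have "(- \<i> * of_real \<sigma>) *\<^sub>C (T t (generator \<sigma> c x + c *\<^sub>R B x) - c *\<^sub>R T t (B x) + c *\<^sub>R B (T t x))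
    = (- \<i> * of_real \<sigma>) *\<^sub>C T t (generator \<sigma> c x + c *\<^sub>R B x) + (- \<i> * of_real \<sigma>) *\<^sub>C (c *\<^sub>R (B (T t x) - T t (B x)))"
    unfolding scaleC_add_right[symmetric] by (simp add: scaleR_diff_right)
  also have "(- \<i> * of_real \<sigma>) *\<^sub>C T t (generator \<sigma> c x + c *\<^sub>R B x) = T t (A0 x)"
    unfolding A0_eq_generator[OF \<sigma>, of x c] by (simp only: T_lin(4)[OF t])
  finally show ?thesis
    by (simp add: scaleR_scaleC scaleC_scaleC mult.assoc)
qed

lemma norm_commutator_le:
  assumes t: "0 \<le> t"
  shows "norm ((\<i> * of_real (\<sigma> * c)) *\<^sub>C (B (T t x) - T t (B x))) \<le> 2 * \<beta> * norm x"
proof -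
  have "\<bar>\<sigma>\<bar> = 1" using \<sigma> unfolding square_eq_1_iff by auto
  then have "norm ((\<i> * of_real (\<sigma> * c)) *\<^sub>C (B (T t x) - T t (B x))) = c * norm (B (T t x) - T t (B x))"
    using c by (simp add: norm_scaleC norm_mult abs_mult)
  also have "\<dots> \<le> 1 * norm (B (T t x) - T t (B x))" using c by (intro mult_right_mono) auto
  also have "\<dots> \<le> norm (B (T t x)) + norm (T t (B x))" by (simp add: norm_triangle_ineq4)
  also have "\<dots> \<le> \<beta> * norm x + \<beta> * norm x"
    by (intro add_mono order_trans[OF norm_B_le] order_trans[OF TD(3)[OF t]] mult_left_mono \<beta>_nonneg
        TD(3) t norm_B_le)
  also have "\<dots> = 2 * \<beta> * norm x" by simp
  finally show ?thesis .
qed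

lemma norm_A0_T_le:
  assumes t: "0 \<le> t" and x: "x \<in> D0"
  shows "norm (A0 (T t x)) \<le> K1 * norm (A0 x)"
proof -
  have "norm (A0 (T t x)) \<le> norm (T t (A0 x)) + norm ((\<i> * of_real (\<sigma> * c)) *\<^sub>C (B (T t x) - T t (B x)))"
    unfolding A0_T[OF t x] by (rule norm_triangle_ineq4)
  also have "\<dots> \<le> norm (A0 x) + 2 * \<beta> * norm x"
    by (intro add_mono TD(3) t norm_commutator_le)
  also have "\<dots> \<le> norm (A0 x) + 2 * \<beta> * (norm (A0 x) / m0)"
    using \<beta>_nonneg by (intro add_left_mono mult_left_mono norm_le_norm_A0 x) auto
  finally show ?thesis by (simp add: K1_def algebra_simps)
qed

lemma commutator_in_dom:
  assumes t: "0 \<le> t" and x: "x \<in> D0"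
  shows "(\<i> * of_real (\<sigma> * c)) *\<^sub>C (B (T t x) - T t (B x)) \<in> D0" (is "?R \<in> D0")
    and "norm (A0 ((\<i> * of_real (\<sigma> * c)) *\<^sub>C (B (T t x) - T t (B x)))) \<le> 2 * (K1 * KB) * norm (A0 x)"
proof -
  have dom: "B (T t x) \<in> D0" "T t (B x) \<in> D0" using t x by (auto intro: B_in_dom TD(4))
  then show "?R \<in> D0" by (intro selfadjoint_dom[OF sa])
  have "\<bar>\<sigma>\<bar> = 1" using \<sigma> unfolding square_eq_1_iff by auto
  then have "norm (A0 ?R) = c * norm (A0 (B (T t x)) - A0 (T t (B x)))"
    unfolding selfadjoint_scaleC[OF sa selfadjoint_dom(3)[OF sa dom]] selfadjoint_diff[OF sa dom]
    using c by (simp add: norm_scaleC norm_mult abs_mult)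
  also have "\<dots> \<le> 1 * (norm (A0 (B (T t x))) + norm (A0 (T t (B x))))"
    using c by (intro mult_mono norm_triangle_ineq4) auto
  also have "\<dots> \<le> 1 * (KB * (K1 * norm (A0 x)) + K1 * (KB * norm (A0 x)))"
    using t x K1 KB(1)
    by (intro mult_left_mono add_mono order_trans[OF KB(2)] order_trans[OF norm_A0_T_le] norm_A0_T_le KB(2) B_in_dom TD(4)) auto
  finally show "norm (A0 ?R) \<le> 2 * (K1 * KB) * norm (A0 x)" by (simp add: algebra_simps)
qed

lemma T_square_dom:
  assumes t: "0 \<le> t" and x: "x \<in> square_dom D0 A0"
  shows "T t x \<in> square_dom D0 A0"
proof -
  have "x \<in> D0" "A0 x \<in> D0" using x by (auto simp: square_dom_def)
  then show ?thesis
    unfolding square_dom_def using t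
    by (auto simp: A0_T intro!: selfadjoint_dom[OF sa] B_in_dom TD(4))
qed

end

text \<open>
  A trajectory smooth enough for the Galerkin error estimates, with a bound \<open>R\<close> on the graph norms that
  occur there.
\<close>

definition smooth_trajectory ::
    "real \<Rightarrow> real \<Rightarrow> real \<Rightarrow> (real \<Rightarrow> 'a) \<Rightarrow> (real \<Rightarrow> 'a) \<Rightarrow> real \<Rightarrow> bool" where
  "smooth_trajectory \<sigma> c \<tau> x x' R \<longleftrightarrow> (\<forall>t\<in>{0..\<tau>}. x t \<in> D0 \<and> x' t \<in> D0 \<and> x' t = generator \<sigma> c (x t) \<and>
     (x has_vector_derivative x' t) (at t within {0..\<tau>}) \<and>
     ((\<lambda>t. A0 (x t)) has_vector_derivative A0 (x' t)) (at t within {0..\<tau>}) \<and>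
     norm (A0 (x t)) \<le> R \<and> norm (A0 (x' t)) \<le> R)"

lemma smooth_trajectoryD:
  assumes "smooth_trajectory \<sigma> c \<tau> x x' R" "t \<in> {0..\<tau>}"
  shows "x t \<in> D0" "x' t \<in> D0" "x' t = generator \<sigma> c (x t)"
    "(x has_vector_derivative x' t) (at t within {0..\<tau>})"
    "((\<lambda>t. A0 (x t)) has_vector_derivative A0 (x' t)) (at t within {0..\<tau>})"
    "norm (A0 (x t)) \<le> R" "norm (A0 (x' t)) \<le> R"
  using assms unfolding smooth_trajectory_def by blast+

text \<open>
  Along an orbit, \<open>A\<close> of the state is a combination of the velocity and of \<open>B\<close> of the state. For an initial
  state in the domain of \<open>A\<^sup>2\<close> the velocity is itself an orbit starting in the domain of \<open>A\<close>, so \<open>A\<close> of the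
  state is differentiable.
\<close>

lemma smooth_trajectory_evolution:
  assumes \<sigma>: "\<sigma> * \<sigma> = 1" and c: "0 \<le> c" "c \<le> 1"
    and T: "contraction_evolution D0 (generator \<sigma> c) T"
    and q: "q \<in> square_dom D0 A0"
  shows "smooth_trajectory \<sigma> c \<tau> (\<lambda>t. T t q) (\<lambda>t. T t (generator \<sigma> c q)) (K2 * norm (A0 (A0 q)))"
  unfolding smooth_trajectory_def
proof (intro ballI conjI)
  fix t assume t: "t \<in> {0..\<tau>}"
  then have t0: "0 \<le> t" by simp
  note TD = contraction_evolutionD[OF T]
  have qD: "q \<in> D0" and AqD: "A0 q \<in> D0" using q by (auto simp: square_dom_def)
  have GqD: "generator \<sigma> c q \<in> D0" by (rule generator_in_dom[OF q])
  show "T t q \<in> D0" "T t (generator \<sigma> c q) \<in> D0" by (intro TD(4) t0 qD GqD)+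
  show G: "T t (generator \<sigma> c q) = generator \<sigma> c (T t q)" by (simp add: TD(5)[OF t0 qD])
  have deriv: "((\<lambda>t. T t x) has_vector_derivative T t (generator \<sigma> c x)) (at t within {0..\<tau>})" if "x \<in> D0" for x
    using has_vector_derivative_within_subset[OF TD(6)[OF t0 that], of "{0..\<tau>}"] TD(5)[OF t0 that] by auto
  show "((\<lambda>t. T t q) has_vector_derivative T t (generator \<sigma> c q)) (at t within {0..\<tau>})"
    by (rule deriv[OF qD])
  have "((\<lambda>t. (- \<i> * of_real \<sigma>) *\<^sub>C (T t (generator \<sigma> c q) + c *\<^sub>R B (T t q))) has_vector_derivative
      (- \<i> * of_real \<sigma>) *\<^sub>C (T t (generator \<sigma> c (generator \<sigma> c q)) + c *\<^sub>R B (T t (generator \<sigma> c q)))) (at t within {0..\<tau>})"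
    by (intro bounded_linear.has_vector_derivative[OF scaleC.bounded_linear_right] has_vector_derivative_add
        bounded_linear.has_vector_derivative[OF bounded_linear_scaleR_right]
        bounded_linear.has_vector_derivative[OF bounded_linear_B] deriv GqD qD)
  also have "T t (generator \<sigma> c (generator \<sigma> c q)) = generator \<sigma> c (T t (generator \<sigma> c q))"
    by (simp add: TD(5)[OF t0 GqD])
  also have "(- \<i> * of_real \<sigma>) *\<^sub>C (generator \<sigma> c (T t (generator \<sigma> c q)) + c *\<^sub>R B (T t (generator \<sigma> c q)))
      = A0 (T t (generator \<sigma> c q))"
    by (rule A0_eq_generator[OF \<sigma>, symmetric])
  finally show "((\<lambda>t. A0 (T t q)) has_vector_derivative A0 (T t (generator \<sigma> c q))) (at t within {0..\<tau>})"
  proof (rule has_vector_derivative_transform[rotated 2, OF _ t])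
    show "A0 (T s q) = (- \<i> * of_real \<sigma>) *\<^sub>C (T s (generator \<sigma> c q) + c *\<^sub>R B (T s q))"
      if "s \<in> {0..\<tau>}" for s
      using A0_eq_generator[OF \<sigma>, of "T s q" c] TD(5)[OF _ qD, of s] that by simp
  qed
  have Aq: "norm (A0 q) \<le> norm (A0 (A0 q)) / m0" by (rule norm_le_norm_A0[OF AqD])
  have "norm (A0 (T t q)) \<le> K1 * (norm (A0 (A0 q)) / m0)"
    using K1 by (intro order_trans[OF norm_A0_T_le[OF \<sigma> c T t0 qD]] mult_left_mono Aq) auto
  also have "\<dots> = K1 / m0 * norm (A0 (A0 q))" by simp
  also have "\<dots> \<le> K2 * norm (A0 (A0 q))"
    using K1 KB(1) m0(1) by (intro mult_right_mono) (auto simp: K2_def)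
  finally show "norm (A0 (T t q)) \<le> K2 * norm (A0 (A0 q))" .
  have "A0 (generator \<sigma> c q) = \<sigma> *\<^sub>R (\<i> *\<^sub>C A0 (A0 q)) - c *\<^sub>R A0 (B q)"
    by (simp add: generator_def selfadjoint_diff[OF sa] selfadjoint_scaleR[OF sa] selfadjoint_scaleC[OF sa]
        selfadjoint_dom[OF sa] AqD B_in_dom[OF qD])
  then have "norm (A0 (generator \<sigma> c q)) \<le> \<bar>\<sigma>\<bar> * norm (A0 (A0 q)) + \<bar>c\<bar> * norm (A0 (B q))"
    using norm_triangle_ineq4[of "\<sigma> *\<^sub>R (\<i> *\<^sub>C A0 (A0 q))" "c *\<^sub>R A0 (B q)"] by (simp add: norm_scaleC)
  also have "\<bar>\<sigma>\<bar> = 1" using \<sigma> unfolding square_eq_1_iff by auto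
  also have "1 * norm (A0 (A0 q)) + \<bar>c\<bar> * norm (A0 (B q)) \<le> 1 * norm (A0 (A0 q)) + 1 * (KB * (norm (A0 (A0 q)) / m0))"
    using c KB(1) by (intro add_left_mono mult_mono order_trans[OF KB(2)[OF qD]] mult_left_mono Aq) auto
  finally have AGq: "norm (A0 (generator \<sigma> c q)) \<le> (1 + KB / m0) * norm (A0 (A0 q))"
    by (simp add: algebra_simps)
  have "norm (A0 (T t (generator \<sigma> c q))) \<le> K1 * ((1 + KB / m0) * norm (A0 (A0 q)))"
    using K1 by (intro order_trans[OF norm_A0_T_le[OF \<sigma> c T t0 GqD]] mult_left_mono AGq) auto
  also have "\<dots> \<le> K2 * norm (A0 (A0 q))"
    unfolding mult.assoc[symmetric] using K1 m0(1) by (intro mult_right_mono) (auto simp: K2_def)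
  finally show "norm (A0 (T t (generator \<sigma> c q))) \<le> K2 * norm (A0 (A0 q))" .
qed

lemma smooth_trajectory_reverse:
  assumes "smooth_trajectory 1 0 \<tau> x x' R"
  shows "smooth_trajectory (-1) 0 \<tau> (\<lambda>t. x (\<tau> - t)) (\<lambda>t. - x' (\<tau> - t)) R"
  unfolding smooth_trajectory_def
proof (intro ballI)
  fix t assume t: "t \<in> {0..\<tau>}"
  then have s: "\<tau> - t \<in> {0..\<tau>}" by auto
  note x = assms[unfolded smooth_trajectory_def, rule_format, OF s]
  have refl: "((\<lambda>t. f (\<tau> - t)) has_vector_derivative - f') (at t within {0..\<tau>})"
    if "(f has_vector_derivative f') (at (\<tau> - t) within {0..\<tau>})" for f :: "real \<Rightarrow> 'a" and f'
  proof -
    have img: "(\<lambda>t. \<tau> - t) ` {0..\<tau>} \<subseteq> {0..\<tau>}" by auto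
    have "((\<lambda>t. \<tau> - t) has_vector_derivative -1) (at t within {0..\<tau>})"
      by (auto intro!: derivative_eq_intros)
    from vector_diff_chain_within[OF this has_vector_derivative_within_subset[OF that img]]
    show ?thesis by (simp add: o_def)
  qed
  have x'D: "x' (\<tau> - t) \<in> D0" and x'_eq: "x' (\<tau> - t) = generator 1 0 (x (\<tau> - t))" using x by blast+
  have neg: "A0 (- x' (\<tau> - t)) = - A0 (x' (\<tau> - t))" by (rule selfadjoint_neg[OF sa x'D])
  have gen: "- x' (\<tau> - t) = generator (-1) 0 (x (\<tau> - t))" 
    unfolding x'_eq by (simp add: generator_def)
  have d1: "((\<lambda>t. x (\<tau> - t)) has_vector_derivative - x' (\<tau> - t)) (at t within {0..\<tau>})"
    by (rule refl) (use x in blast)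
  have d2: "((\<lambda>t. A0 (x (\<tau> - t))) has_vector_derivative - A0 (x' (\<tau> - t))) (at t within {0..\<tau>})"
    using refl[of "\<lambda>t. A0 (x t)"] x by blast
  have "- x' (\<tau> - t) \<in> D0" by (rule selfadjoint_dom(4)[OF sa x'D])
  then show "x (\<tau> - t) \<in> D0 \<and> - x' (\<tau> - t) \<in> D0 \<and> - x' (\<tau> - t) = generator (- 1) 0 (x (\<tau> - t)) \<and>
      ((\<lambda>t. x (\<tau> - t)) has_vector_derivative - x' (\<tau> - t)) (at t within {0..\<tau>}) \<and>
      ((\<lambda>t. A0 (x (\<tau> - t))) has_vector_derivative A0 (- x' (\<tau> - t))) (at t within {0..\<tau>}) \<and>
      norm (A0 (x (\<tau> - t))) \<le> R \<and> norm (A0 (- x' (\<tau> - t))) \<le> R"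
    unfolding neg norm_minus_cancel using x gen d1 d2 by blast
qed

lemma group_evolution: "contraction_evolution D0 (generator 1 0) group"
proof -
  have "generator 1 0 = (\<lambda>x. \<i> *\<^sub>C A0 x)" by (simp add: generator_def fun_eq_iff)
  then show ?thesis using contraction_evolution_group by simp
qed

lemma system_solution_group:
  assumes "z0 \<in> D0"
  shows "system_solution D0 A0 z0 (\<lambda>t. group t z0)"
  using contraction_evolutionD[OF contraction_evolution_group] assms by (simp add: system_solution_def)

text \<open>The norm of the difference of two solutions is conserved.\<close>

lemma system_solution_unique:
  assumes z: "system_solution D0 A0 z0 z" and t: "0 \<le> t"
  shows "z t = group t z0"
proof -
  have z0: "z0 \<in> D0" using z unfolding system_solution_def by force
  note g = system_solution_group[OF z0]
  define w where "w t = z t - group t z0" for t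
  have "norm (w t) \<le> norm (w 0) + 0 * (t - 0)"
  proof (rule norm_growth[OF t])
    fix s assume s: "s \<in> {0..t}"
    have dom: "z s \<in> D0" "group s z0 \<in> D0" using z g s by (auto simp: system_solution_def)
    have "(w has_vector_derivative (\<i> *\<^sub>C A0 (z s) - \<i> *\<^sub>C A0 (group s z0))) (at s within {0..})"
      unfolding w_def[abs_def]
      by (rule has_vector_derivative_diff) (use z g s in \<open>auto simp: system_solution_def\<close>)
    then have "(w has_vector_derivative \<i> *\<^sub>C A0 (w s)) (at s within {0..})"
      by (simp add: w_def selfadjoint_diff[OF sa dom] scaleC.diff_right)
    then show "(w has_vector_derivative \<i> *\<^sub>C A0 (w s)) (at s within {0..t})"
      by (rule has_vector_derivative_within_subset) auto
    have "w s \<in> D0" unfolding w_def by (rule selfadjoint_dom(3)[OF sa dom])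
    then show "inner (w s) (\<i> *\<^sub>C A0 (w s)) \<le> 0 * norm (w s)"
      by (simp add: inner_scaleC_ii_selfadjoint[OF sa])
  qed simp
  then show ?thesis using z g by (simp add: w_def system_solution_def)
qed

end

context observed_system
begin

text \<open>
  Observability of the undamped system passes to the damped one. With \<open>q\<close> damped and \<open>z\<close> undamped from
  the same initial state and \<open>w = q - z\<close>, the function \<open>e\<^sup>-\<^sup>c\<^sup>t \<parallel>w\<parallel>\<^sup>2 + \<parallel>q\<parallel>\<^sup>2 / 2\<close> decreases for
  \<open>c \<ge> \<parallel>C\<parallel>\<^sup>2\<close>. Hence \<open>w\<close>, and with it the output of \<open>z\<close>, is controlled by the energy that \<open>q\<close>
  dissipates.
\<close>

lemma observability_imp_strict_contraction:
  assumes T: "contraction_evolution D0 (generator 1 1) T"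
    and obs: "exactly_observable D0 A0 C \<tau>" and \<tau>: "0 < \<tau>"
  shows "\<exists>\<rho>\<ge>0. \<rho> < 1 \<and> (\<forall>x. norm (T \<tau> x) \<le> \<rho> * norm x)"
proof -
  note TD = contraction_evolutionD[OF T]
  obtain k where k: "k > 0" and k_obs: "\<And>x z. x \<in> D0 \<Longrightarrow> system_solution D0 A0 x z \<Longrightarrow>
      k\<^sup>2 * (norm x)\<^sup>2 \<le> (LINT t:{0..\<tau>}|lebesgue. (norm (C (z t)))\<^sup>2)"
    using obs by (auto simp: exactly_observable_def)
  define c where "c = (onorm C)\<^sup>2"
  have c0: "0 \<le> c" by (simp add: c_def)
  have C_le: "(norm (C v))\<^sup>2 \<le> c * (norm v)\<^sup>2" for v
    unfolding c_def power_mult_distrib[symmetric] by (intro power_mono onorm[OF bounded_linear_C]) auto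
  \<comment> \<open>\<open>K\<close> comes from integrating \<open>\<parallel>C z\<parallel>\<^sup>2 \<le> 2 \<parallel>C q\<parallel>\<^sup>2 + 2 c \<parallel>w\<parallel>\<^sup>2\<close>.\<close>
  define K where "K = 2 + 2 * c * exp (c * \<tau>) * \<tau>"
  have K: "K > 0" using c0 \<tau> by (simp add: K_def add_pos_nonneg)
  have main: "k\<^sup>2 * (norm x)\<^sup>2 \<le> K * (((norm x)\<^sup>2 - (norm (T \<tau> x))\<^sup>2) / 2)" if x: "x \<in> D0" for x
  proof -
    define q where "q t = T t x" for t
    define z where "z t = group t x" for t
    define w where "w t = q t - z t" for t
    define J where "J = ((norm x)\<^sup>2 - (norm (q \<tau>))\<^sup>2) / 2"
    note g = contraction_evolutionD[OF group_evolution]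
    have q_dom: "q t \<in> D0" and z_dom: "z t \<in> D0" if "0 \<le> t" for t
      using TD(4)[OF that x] g(4)[OF that x] by (simp_all add: q_def z_def)
    have q_deriv: "(q has_vector_derivative generator 1 1 (q t)) (at t within {a..b})"
      and z_deriv: "(z has_vector_derivative generator 1 0 (z t)) (at t within {a..b})"
      if "0 \<le> t" "0 \<le> a" for t a b
      unfolding q_def[abs_def] z_def[abs_def] using that
      by (auto intro!: has_vector_derivative_within_subset[OF TD(6)[OF _ x]]
          has_vector_derivative_within_subset[OF g(6)[OF _ x]])
    have w_deriv: "(w has_vector_derivative generator 1 0 (w t) - B (q t)) (at t within {a..b})"
      if "0 \<le> t" "0 \<le> a" for t a b
    proof -
      have "generator 1 1 (q t) - generator 1 0 (z t) = generator 1 0 (w t) - B (q t)"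
        using generator_diff[OF q_dom z_dom, OF that(1) that(1), of 1 0] by (simp add: w_def generator_def)
      then show ?thesis
        unfolding w_def[abs_def] using has_vector_derivative_diff[OF q_deriv[OF that] z_deriv[OF that]] by simp
    qed
    have q_sq: "((\<lambda>t. (norm (q t))\<^sup>2) has_real_derivative (- 2 * (norm (C (q t)))\<^sup>2)) (at t within {0..b})"
      if "0 \<le> t" for t b
      using has_real_derivative_norm_squared[OF q_deriv[OF that order_refl]]
      by (simp add: inner_generator[OF q_dom[OF that]])
    have q_mono: "norm (q \<tau>) \<le> norm (q t)" if "t \<in> {0..\<tau>}" for t
    proof -
      have "norm (q \<tau>) \<le> norm (q t) + 0 * (\<tau> - t)"
      proof (rule norm_growth)
        show "inner (q s) (generator 1 1 (q s)) \<le> 0 * norm (q s)" if "s \<in> {t..\<tau>}" for s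
          using that \<open>t \<in> {0..\<tau>}\<close> by (simp add: inner_generator q_dom)
      qed (use that in \<open>auto intro: q_deriv\<close>)
      then show ?thesis by simp
    qed
    have w_le: "(norm (w t))\<^sup>2 \<le> exp (c * \<tau>) * J" if t: "t \<in> {0..\<tau>}" for t
    proof -
      define \<psi> where "\<psi> s = exp (- c * s) * (norm (w s))\<^sup>2 + (norm (q s))\<^sup>2 / 2" for s
      define d where "d s = exp (- c * s) * (2 * inner (w s) (generator 1 0 (w s) - B (q s)) - c * (norm (w s))\<^sup>2)
          - (norm (C (q s)))\<^sup>2" for s
      have \<psi>_deriv: "(\<psi> has_derivative (\<lambda>h. h * d s)) (at s within {0..t})" if s: "0 \<le> s" for s
      proof -
        have "((\<lambda>s. exp (- c * s)) has_real_derivative (- c * exp (- c * s))) (at s within {0..t})"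
          by (auto intro!: derivative_eq_intros)
        from DERIV_add[OF DERIV_mult[OF this has_real_derivative_norm_squared[OF w_deriv[OF s order_refl]]]
            DERIV_cdivide[OF q_sq[OF s], of 2]]
        have "(\<psi> has_real_derivative d s) (at s within {0..t})"
          unfolding \<psi>_def[abs_def] by (rule DERIV_cong) (simp add: d_def algebra_simps)
        then show ?thesis
          unfolding has_field_derivative_def by (rule has_derivative_eq_rhs) (simp add: fun_eq_iff)
      qed
      have "\<exists>s\<in>{0..t}. \<psi> t - \<psi> 0 = (t - 0) * d s"
        by (rule mvt_very_simple) (use t \<psi>_deriv in auto)
      then obtain s where s: "s \<in> {0..t}" "\<psi> t - \<psi> 0 = (t - 0) * d s" by blast
      have "d s \<le> 0"
      proof -
        have wD: "w s \<in> D0" unfolding w_def using s by (intro selfadjoint_dom(3)[OF sa] q_dom z_dom) auto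
        have "inner (w s) (B (q s)) = inner (C (w s)) (C (q s))"
          by (simp add: Re_cinner[symmetric] cinner_B)
        then have "2 * inner (w s) (generator 1 0 (w s) - B (q s)) = - (2 * inner (C (w s)) (C (q s)))"
          by (simp add: inner_diff_right inner_generator[OF wD])
        also have "\<dots> \<le> (norm (C (w s)))\<^sup>2 + (norm (C (q s)))\<^sup>2"
          using inner_ge_zero[of "C (w s) + C (q s)"]
          by (simp add: inner_add_left inner_add_right power2_norm_eq_inner inner_commute)
        also have "\<dots> \<le> c * (norm (w s))\<^sup>2 + (norm (C (q s)))\<^sup>2" using C_le by simp
        finally have "exp (- c * s) * (2 * inner (w s) (generator 1 0 (w s) - B (q s)) - c * (norm (w s))\<^sup>2)
            \<le> exp (- c * s) * (norm (C (q s)))\<^sup>2"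
          by (intro mult_left_mono) auto
        also have "\<dots> \<le> 1 * (norm (C (q s)))\<^sup>2"
          using s c0 by (intro mult_right_mono) auto
        finally show ?thesis by (simp add: d_def)
      qed
      then have "\<psi> t \<le> \<psi> 0" using s(2) t mult_nonneg_nonpos[of t "d s"] by simp
      then have "exp (- c * t) * (norm (w t))\<^sup>2 \<le> ((norm x)\<^sup>2 - (norm (q t))\<^sup>2) / 2"
        by (simp add: \<psi>_def w_def q_def z_def TD(1) g(1) field_simps)
      also have "\<dots> \<le> J"
        unfolding J_def using power_mono[OF q_mono[OF t], of 2] by simp
      finally have "exp (c * t) * (exp (- c * t) * (norm (w t))\<^sup>2) \<le> exp (c * t) * J"
        by (intro mult_left_mono) auto
      then have "(norm (w t))\<^sup>2 \<le> exp (c * t) * J" by (simp add: mult.assoc[symmetric] exp_add[symmetric])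
      also have "\<dots> \<le> exp (c * \<tau>) * J"
      proof (rule mult_right_mono)
        show "exp (c * t) \<le> exp (c * \<tau>)" using t c0 by (simp add: mult_left_mono)
        show "0 \<le> J" unfolding J_def q_def using power_mono[OF TD(3)[of \<tau> x], of 2] \<tau> by simp
      qed
      finally show ?thesis .
    qed
    have z_cont: "continuous_on {0..\<tau>} z"
      by (rule continuous_on_vector_derivative) (use z_deriv in auto)
    then have "continuous_on {0..\<tau>} (\<lambda>t. (norm (C (z t)))\<^sup>2)"
      by (intro continuous_intros bounded_linear.continuous_on[OF bounded_linear_C])
    then have abs_int: "(\<lambda>t. (norm (C (z t)))\<^sup>2) absolutely_integrable_on {0..\<tau>}"
      by (rule absolutely_integrable_continuous_real)
    have int_q: "((\<lambda>t. 2 * (norm (C (q t)))\<^sup>2) has_integral (- (norm (q \<tau>))\<^sup>2 - - (norm (q 0))\<^sup>2)) {0..\<tau>}"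
    proof (rule fundamental_theorem_of_calculus)
      fix t assume "t \<in> {0..\<tau>}"
      then show "((\<lambda>t. - (norm (q t))\<^sup>2) has_vector_derivative 2 * (norm (C (q t)))\<^sup>2) (at t within {0..\<tau>})"
        using DERIV_minus[OF q_sq[of t \<tau>]] by (simp add: has_real_derivative_iff_has_vector_derivative)
    qed (use \<tau> in simp)
    have q0: "q 0 = x" by (simp add: q_def TD(1))
    have int_rhs: "((\<lambda>t. 2 * (norm (C (q t)))\<^sup>2 + 2 * c * (exp (c * \<tau>) * J)) has_integral
        (2 * J + \<tau> * (2 * c * (exp (c * \<tau>) * J)))) {0..\<tau>}"
    proof (rule has_integral_add)
      show "((\<lambda>t. 2 * (norm (C (q t)))\<^sup>2) has_integral 2 * J) {0..\<tau>}"
      proof -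
        have "2 * J = (norm x)\<^sup>2 - (norm (q \<tau>))\<^sup>2" by (simp add: J_def)
        then show ?thesis using int_q by (simp add: q0)
      qed
      show "((\<lambda>t. 2 * c * (exp (c * \<tau>) * J)) has_integral \<tau> * (2 * c * (exp (c * \<tau>) * J))) {0..\<tau>}"
        using has_integral_const_real[of "2 * c * (exp (c * \<tau>) * J)" 0 \<tau>] \<tau> by simp
    qed
    have "(LINT t:{0..\<tau>}|lebesgue. (norm (C (z t)))\<^sup>2) = integral {0..\<tau>} (\<lambda>t. (norm (C (z t)))\<^sup>2)"
      by (rule set_lebesgue_integral_eq_integral(2)[OF abs_int])
    also have "\<dots> \<le> 2 * J + \<tau> * (2 * c * (exp (c * \<tau>) * J))"
    proof (rule has_integral_le[OF integrable_integral int_rhs])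
      show "(\<lambda>t. (norm (C (z t)))\<^sup>2) integrable_on {0..\<tau>}"
        by (rule set_lebesgue_integral_eq_integral(1)[OF abs_int])
      fix t assume t: "t \<in> {0..\<tau>}"
      have "C (z t) = C (q t) - C (w t)"
        by (simp add: w_def linear_diff[OF bounded_linear.linear[OF bounded_linear_C]])
      then have "(norm (C (z t)))\<^sup>2 \<le> 2 * (norm (C (q t)))\<^sup>2 + 2 * (norm (C (w t)))\<^sup>2"
        using inner_ge_zero[of "C (q t) + C (w t)"]
        by (simp add: inner_add_left inner_add_right inner_diff_left inner_diff_right power2_norm_eq_inner inner_commute)
      also have "2 * (norm (C (w t)))\<^sup>2 \<le> 2 * (c * (exp (c * \<tau>) * J))"
        using C_le[of "w t"] mult_left_mono[OF w_le[OF t] c0] by linarith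
      finally show "(norm (C (z t)))\<^sup>2 \<le> 2 * (norm (C (q t)))\<^sup>2 + 2 * c * (exp (c * \<tau>) * J)" by simp
    qed
    also have "\<dots> = K * J" by (simp add: K_def algebra_simps)
    finally show ?thesis
      using k_obs[OF x system_solution_group[OF x]] by (simp add: z_def J_def q_def)
  qed
  define \<rho> where "\<rho> = sqrt (max 0 (1 - 2 * k\<^sup>2 / K))"
  have "2 * k\<^sup>2 / K > 0" using k K by simp
  then have \<rho>: "0 \<le> \<rho>" "\<rho> < 1" by (auto simp: \<rho>_def max_def)
  have "norm (T \<tau> x) \<le> \<rho> * norm x" for x
  proof (rule norm_bound_from_dense[OF bounded_clinearD(1)[OF TD(2)] selfadjoint_dense[OF sa]])
    fix x assume x: "x \<in> D0"
    have "(norm (T \<tau> x))\<^sup>2 \<le> (1 - 2 * k\<^sup>2 / K) * (norm x)\<^sup>2"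
      using main[OF x] K by (simp add: field_simps)
    also have "\<dots> \<le> \<rho>\<^sup>2 * (norm x)\<^sup>2" by (intro mult_right_mono) (auto simp: \<rho>_def)
    finally have "(norm (T \<tau> x))\<^sup>2 \<le> (\<rho> * norm x)\<^sup>2" unfolding power_mult_distrib .
    then show "norm (T \<tau> x) \<le> \<rho> * norm x" by (rule power2_le_imp_le) (simp add: \<rho>(1))
  qed (use \<tau> in simp)
  with \<rho> show ?thesis by blast
qed

text \<open>
  A direct estimate of \<open>L\<close> in the graph norm of \<open>A\<^sup>2\<close> would cost a factor larger than one in each
  application. But the commutators of \<open>A\<close> with \<open>L\<close> are of lower order and \<open>L\<close> is a strict contraction, so
  that the equivalent norm \<open>\<parallel>A\<^sup>2 q\<parallel> + c\<^sub>1 \<parallel>A q\<parallel> + c\<^sub>2 \<parallel>q\<parallel>\<close> does not increase if the weights are suitable.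
\<close>

lemma power_graph_bound:
  assumes Tp: "contraction_evolution D0 (generator 1 1) Tp"
    and Tm: "contraction_evolution D0 (generator (-1) 1) Tm" and \<tau>: "0 \<le> \<tau>"
    and \<eta>: "0 \<le> \<eta>" "\<eta> < 1" "\<And>x. norm (Tm \<tau> (Tp \<tau> x)) \<le> \<eta> * norm x"
  shows "\<exists>K\<ge>0. \<forall>q\<in>square_dom D0 A0. \<forall>n. ((Tm \<tau> \<circ> Tp \<tau>) ^^ n) q \<in> square_dom D0 A0 \<and>
    norm (A0 (A0 (((Tm \<tau> \<circ> Tp \<tau>) ^^ n) q))) \<le> K * norm (A0 (A0 q))"
proof -
  let ?P = "Tp \<tau>" and ?M = "Tm \<tau>"
  let ?L = "\<lambda>q. ?M (?P q)"
  have s: "(1::real) * 1 = 1" "(-1::real) * -1 = 1" "(0::real) \<le> 1" "(1::real) \<le> 1" by auto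
  note linM = T_lin[OF s(2,3,4) Tm \<tau>]
  note A0P = A0_T[OF s(1,3,4) Tp \<tau>] and A0M = A0_T[OF s(2,3,4) Tm \<tau>]
  note nP = norm_A0_T_le[OF s(1,3,4) Tp \<tau>] and nM = norm_A0_T_le[OF s(2,3,4) Tm \<tau>]
  note cP = contraction_evolutionD(3)[OF Tp \<tau>] and cM = contraction_evolutionD(3)[OF Tm \<tau>]
  note dP = contraction_evolutionD(4)[OF Tp \<tau>] and dM = contraction_evolutionD(4)[OF Tm \<tau>]
  define Rp where "Rp q = (\<i> * of_real (1 * 1)) *\<^sub>C (B (?P q) - ?P (B q))" for q
  define Rm where "Rm q = (\<i> * of_real (- 1 * 1)) *\<^sub>C (B (?M q) - ?M (B q))" for q
  have Rp: "norm (Rp q) \<le> 2 * \<beta> * norm q" for q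
    unfolding Rp_def by (rule norm_commutator_le[OF s(1,3,4) Tp \<tau>])
  have Rm: "norm (Rm q) \<le> 2 * \<beta> * norm q" for q
    unfolding Rm_def by (rule norm_commutator_le[OF s(2,3,4) Tm \<tau>])
  have AL: "A0 (?L q) = ?L (A0 q) - (?M (Rp q) + Rm (?P q))" if q: "q \<in> D0" for q
    using A0M[OF dP[OF q]] A0P[OF q] by (simp add: linM Rp_def Rm_def)
  have R: "norm (?M (Rp q) + Rm (?P q)) \<le> 4 * \<beta> * norm q" for q
  proof -
    have "norm (?M (Rp q)) \<le> 2 * \<beta> * norm q" by (rule order_trans[OF cM Rp])
    moreover have "norm (Rm (?P q)) \<le> 2 * \<beta> * norm q"
      using \<beta>_nonneg by (intro order_trans[OF Rm] mult_left_mono cP) auto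
    ultimately show ?thesis using norm_triangle_ineq[of "?M (Rp q)" "Rm (?P q)"] by linarith
  qed
  have K10: "0 \<le> K1" using K1 by simp
  have RpD: "Rp q \<in> D0" "norm (A0 (Rp q)) \<le> 2 * (K1 * KB) * norm (A0 q)" if "q \<in> D0" for q
    unfolding Rp_def by (rule commutator_in_dom[OF s(1,3,4) Tp \<tau> that])+
  have RmD: "Rm q \<in> D0" "norm (A0 (Rm q)) \<le> 2 * (K1 * KB) * norm (A0 q)" if "q \<in> D0" for q
    unfolding Rm_def by (rule commutator_in_dom[OF s(2,3,4) Tm \<tau> that])+
  define \<kappa> where "\<kappa> = 4 * \<beta> + 4 * K1\<^sup>2 * KB"
  have \<kappa>: "0 \<le> \<kappa>" using \<beta>_nonneg KB(1) by (simp add: \<kappa>_def)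
  have LD: "?L q \<in> square_dom D0 A0" if "q \<in> square_dom D0 A0" for q
    by (rule T_square_dom[OF s(2,3,4) Tm \<tau> T_square_dom[OF s(1,3,4) Tp \<tau> that]])
  have A1: "norm (A0 (?L q)) \<le> \<eta> * norm (A0 q) + 4 * \<beta> * norm q" if q: "q \<in> D0" for q
    unfolding AL[OF q] using norm_triangle_ineq4[of "?L (A0 q)" "?M (Rp q) + Rm (?P q)"] \<eta>(3)[of "A0 q"] R[of q]
    by linarith
  have A2: "norm (A0 (A0 (?L q))) \<le> \<eta> * norm (A0 (A0 q)) + \<kappa> * norm (A0 q)" if q: "q \<in> square_dom D0 A0" for q
  proof -
    have qD: "q \<in> D0" and AqD: "A0 q \<in> D0" using q by (auto simp: square_dom_def)
    have dom: "?L (A0 q) \<in> D0" "?M (Rp q) \<in> D0" "Rm (?P q) \<in> D0"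
      using qD AqD by (auto intro: dP dM RpD RmD)
    have "norm (A0 (?M (Rp q))) \<le> K1 * (2 * (K1 * KB) * norm (A0 q))"
      using K10 by (intro order_trans[OF nM] mult_left_mono RpD qD) auto
    moreover have "norm (A0 (Rm (?P q))) \<le> 2 * (K1 * KB) * (K1 * norm (A0 q))"
      using K10 KB(1) by (intro order_trans[OF RmD(2)] mult_left_mono nP dP qD) auto
    moreover have "norm (A0 (?L (A0 q))) \<le> \<eta> * norm (A0 (A0 q)) + 4 * \<beta> * norm (A0 q)" by (rule A1[OF AqD])
    moreover have "norm (A0 (A0 (?L q)))
        \<le> norm (A0 (?L (A0 q))) + (norm (A0 (?M (Rp q))) + norm (A0 (Rm (?P q))))"
    proof -
      have "A0 (A0 (?L q)) = A0 (?L (A0 q)) - (A0 (?M (Rp q)) + A0 (Rm (?P q)))"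
        unfolding AL[OF qD]
        by (simp only: selfadjoint_diff[OF sa dom(1) selfadjoint_dom(2)[OF sa dom(2,3)]] selfadjoint_add[OF sa dom(2,3)])
      then show ?thesis
        using order_trans[OF norm_triangle_ineq4 add_left_mono[OF norm_triangle_ineq]] by metis
    qed
    ultimately show ?thesis by (simp add: \<kappa>_def algebra_simps power2_eq_square)
  qed
  \<comment> \<open>In each weighted term the deficit \<open>1 - \<eta>\<close> pays for the commutator of the term before it.\<close>
  define c1 where "c1 = \<kappa> / (1 - \<eta>)"
  define c2 where "c2 = 4 * \<beta> * c1 / (1 - \<eta>)"
  have c12: "0 \<le> c1" "0 \<le> c2" using \<kappa> \<eta> \<beta>_nonneg by (auto simp: c1_def c2_def)
  have c1_eq: "\<kappa> + c1 * \<eta> = c1" and c2_eq: "4 * \<beta> * c1 + c2 * \<eta> = c2"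
  proof -
    have "1 - \<eta> \<noteq> 0" using \<eta> by simp
    then have "c1 * (1 - \<eta>) = \<kappa>" "c2 * (1 - \<eta>) = 4 * \<beta> * c1" by (simp_all add: c1_def c2_def)
    then show "\<kappa> + c1 * \<eta> = c1" "4 * \<beta> * c1 + c2 * \<eta> = c2" by (simp_all add: algebra_simps)
  qed
  define N where "N q = norm (A0 (A0 q)) + c1 * norm (A0 q) + c2 * norm q" for q
  have N_L: "N (?L q) \<le> N q" if q: "q \<in> square_dom D0 A0" for q
  proof -
    have qD: "q \<in> D0" using q by (auto simp: square_dom_def)
    have "N (?L q) \<le> (\<eta> * norm (A0 (A0 q)) + \<kappa> * norm (A0 q)) + c1 * (\<eta> * norm (A0 q) + 4 * \<beta> * norm q) + c2 * (\<eta> * norm q)"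
      unfolding N_def by (intro add_mono mult_left_mono c12 A2[OF q] A1[OF qD] \<eta>(3))
    also have "\<dots> = \<eta> * norm (A0 (A0 q)) + (\<kappa> + c1 * \<eta>) * norm (A0 q) + (4 * \<beta> * c1 + c2 * \<eta>) * norm q"
      by (simp add: algebra_simps)
    also have "\<dots> \<le> N q"
      unfolding c1_eq c2_eq N_def using \<eta> mult_right_mono[of \<eta> 1 "norm (A0 (A0 q))"] by simp
    finally show ?thesis .
  qed
  have pow: "(?L ^^ n) q \<in> square_dom D0 A0 \<and> N ((?L ^^ n) q) \<le> N q" if q: "q \<in> square_dom D0 A0" for q n
  proof (induction n)
    case (Suc n)
    then show ?case using LD N_L[of "(?L ^^ n) q"] by auto
  qed (use q in auto)
  have "norm (A0 (A0 ((?L ^^ n) q))) \<le> (1 + c1 / m0 + c2 / m0\<^sup>2) * norm (A0 (A0 q))"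
    if q: "q \<in> square_dom D0 A0" for q n
  proof -
    have qD: "q \<in> D0" and AqD: "A0 q \<in> D0" using q by (auto simp: square_dom_def)
    have 1: "norm (A0 q) \<le> norm (A0 (A0 q)) / m0" by (rule norm_le_norm_A0[OF AqD])
    have 2: "norm q \<le> norm (A0 (A0 q)) / m0 / m0"
      using m0(1) by (intro order_trans[OF norm_le_norm_A0[OF qD]] divide_right_mono 1) auto
    have "norm (A0 (A0 ((?L ^^ n) q))) \<le> N ((?L ^^ n) q)" using c12 by (simp add: N_def)
    also have "\<dots> \<le> N q" using pow[OF q] by simp
    also have "\<dots> \<le> norm (A0 (A0 q)) + c1 * (norm (A0 (A0 q)) / m0) + c2 * (norm (A0 (A0 q)) / m0 / m0)"
      unfolding N_def by (intro add_mono mult_left_mono 1 2 c12) auto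
    finally show ?thesis by (simp add: algebra_simps power2_eq_square)
  qed
  moreover have "?M \<circ> ?P = ?L" by (simp add: o_def)
  ultimately show ?thesis
    using pow c12 m0(1) by (intro exI[of _ "1 + c1 / m0 + c2 / m0\<^sup>2"]) (simp add: add_nonneg_nonneg)
qed

end


section \<open>Finite-dimensional subspaces\<close>

lemma span_insert_decompose:
  fixes P :: "'a::complex_hilbert \<Rightarrow> 'a"
  assumes P: "\<And>x. P x \<in> complex_vector.span S" and v: "v \<in> complex_vector.span (insert a S)"
  shows "\<exists>k s. s \<in> complex_vector.span S \<and> v = s + k *\<^sub>C (a - P a)"
proof -
  obtain k where k: "v - k *\<^sub>C a \<in> complex_vector.span S"
    using v complex_vector.span_breakdown_eq by blast
  have "(v - k *\<^sub>C a) + k *\<^sub>C P a \<in> complex_vector.span S"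
    by (intro complex_vector.span_add complex_vector.span_scale k P)
  moreover have "v = ((v - k *\<^sub>C a) + k *\<^sub>C P a) + k *\<^sub>C (a - P a)" by (simp add: scaleC.diff_right)
  ultimately show ?thesis by blast
qed

text \<open>
  One Gram--Schmidt step per spanning vector: \<open>b\<close> is the part of the new vector orthogonal to the old span.
\<close>

lemma orthogonal_projection_exists:
  fixes S :: "'a::complex_hilbert set"
  assumes "finite S"
  shows "\<exists>P. bounded_clinear P \<and> (\<forall>x. P x \<in> complex_vector.span S) \<and>
    (\<forall>x. \<forall>v\<in>complex_vector.span S. cinner (x - P x) v = 0)"
  using assms
proof (induction S)
  case empty
  then show ?case by (intro exI[of _ "\<lambda>_. 0"]) (auto simp: bounded_clinear_def cinner.zero_right)
next
  case (insert a S)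
  then obtain P where P: "bounded_clinear P" and PS: "\<And>x. P x \<in> complex_vector.span S"
    and orth: "\<And>x v. v \<in> complex_vector.span S \<Longrightarrow> cinner (x - P x) v = 0"
    by blast
  define b where "b = a - P a"
  show ?case
  proof (cases "b = 0")
    case True
    then have "a \<in> complex_vector.span S" using PS[of a] by (simp add: b_def)
    then have "complex_vector.span (insert a S) = complex_vector.span S" by (rule complex_vector.span_redundant)
    then show ?thesis using P PS orth by auto
  next
    case False
    define c where "c x = cinner x b / of_real ((norm b)\<^sup>2)" for x
    define P' where "P' x = P x + c x *\<^sub>C b" for x
    have mono: "complex_vector.span S \<subseteq> complex_vector.span (insert a S)"
      by (rule complex_vector.span_mono) auto
    have bS: "b \<in> complex_vector.span (insert a S)"
      unfolding b_def by (intro complex_vector.span_diff complex_vector.span_base subsetD[OF mono PS]) simp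
    have b_orth: "cinner b v = 0" "cinner v b = 0" if "v \<in> complex_vector.span S" for v
    proof -
      show 1: "cinner b v = 0" unfolding b_def by (rule orth[OF that])
      show "cinner v b = 0" by (subst cinner_commute) (simp add: 1)
    qed
    have bb: "c x * cinner b b = cinner x b" for x
      using False by (simp add: c_def cinner_self)
    have c_lin: "bounded_linear c"
      unfolding c_def[abs_def] divide_inverse
      by (intro bounded_linear_compose[OF bounded_linear_mult_left cinner.bounded_linear_left])
    have c_scale: "c (k *\<^sub>C x) = k * c x" for k x by (simp add: c_def cinner_scaleC_left)
    have "bounded_clinear P'"
      unfolding bounded_clinear_def P'_def[abs_def]
      using bounded_clinearD[OF P]
      by (auto intro!: bounded_linear_add bounded_linear_compose[OF scaleC.bounded_linear_left c_lin]
          simp: c_scale scaleC_add_right scaleC_scaleC)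
    moreover have "P' x \<in> complex_vector.span (insert a S)" for x
      unfolding P'_def by (intro complex_vector.span_add complex_vector.span_scale bS subsetD[OF mono PS])
    moreover have "cinner (x - P' x) v = 0" if v: "v \<in> complex_vector.span (insert a S)" for x v
    proof -
      obtain k s where s: "s \<in> complex_vector.span S" and v_eq: "v = s + k *\<^sub>C b"
        using span_insert_decompose[of P S v a, OF PS v] unfolding b_def by blast
      have 1: "cinner (x - P' x) s = 0"
        using orth[OF s, of x] by (simp add: P'_def cinner.diff_left cinner.add_left cinner_scaleC_left b_orth[OF s])
      have "cinner (x - P' x) b = 0"
        by (simp add: P'_def cinner.diff_left cinner.add_left cinner_scaleC_left b_orth[OF PS] bb)
      with 1 show ?thesis by (simp add: v_eq cinner_add_right cinner_scaleC_right)
    qed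
    ultimately show ?thesis by blast
  qed
qed

text \<open>
  In the orthogonal decomposition \<open>v = s + k b\<close> both components are at most as long as \<open>v\<close>.
\<close>

lemma linear_on_finite_span_bounded:
  fixes f :: "'a::complex_hilbert \<Rightarrow> 'b::complex_hilbert"
  assumes "finite S"
    and "\<And>x y. x \<in> complex_vector.span S \<Longrightarrow> y \<in> complex_vector.span S \<Longrightarrow> f (x + y) = f x + f y"
    and "\<And>a x. x \<in> complex_vector.span S \<Longrightarrow> f (a *\<^sub>C x) = a *\<^sub>C f x"
  shows "\<exists>K\<ge>0. \<forall>v\<in>complex_vector.span S. norm (f v) \<le> K * norm v"
  using assms
proof (induction S)
  case empty
  have "f 0 = 0" using empty.prems(1)[of 0 0] by simp
  then show ?case by (intro exI[of _ 0]) simp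
next
  case (insert a S)
  have mono: "complex_vector.span S \<subseteq> complex_vector.span (insert a S)"
    by (rule complex_vector.span_mono) auto
  have "\<exists>K\<ge>0. \<forall>v\<in>complex_vector.span S. norm (f v) \<le> K * norm v"
    by (rule insert.IH) (use insert.prems mono in blast)+
  then obtain K where K: "K \<ge> 0" "\<And>v. v \<in> complex_vector.span S \<Longrightarrow> norm (f v) \<le> K * norm v" by blast
  obtain P where PS: "\<And>x. P x \<in> complex_vector.span S"
    and orth: "\<And>x v. v \<in> complex_vector.span S \<Longrightarrow> cinner (x - P x) v = 0"
    using orthogonal_projection_exists[OF insert.hyps(1)] by blast
  define b where "b = a - P a"
  have bS: "b \<in> complex_vector.span (insert a S)"
    unfolding b_def by (intro complex_vector.span_diff complex_vector.span_base subsetD[OF mono PS]) simp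
  show ?case
  proof (cases "b = 0")
    case True
    then have "a \<in> complex_vector.span S" using PS[of a] by (simp add: b_def)
    then have "complex_vector.span (insert a S) = complex_vector.span S" by (rule complex_vector.span_redundant)
    then show ?thesis using K by auto
  next
    case False
    have "norm (f v) \<le> (K + norm (f b) / norm b) * norm v" if v: "v \<in> complex_vector.span (insert a S)" for v
    proof -
      obtain k s where s: "s \<in> complex_vector.span S" and v_eq: "v = s + k *\<^sub>C b"
        using span_insert_decompose[of P S v a, OF PS v] unfolding b_def by blast
      have bs: "cinner b s = 0" unfolding b_def by (rule orth[OF s])
      then have sb: "cinner s b = 0" by (subst cinner_commute) simp
      have "cinner v s = cinner s s" by (simp add: v_eq cinner_add_left cinner_scaleC_left bs)
      then have "Re (cinner s s) \<le> norm v * norm s"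
        using cmod_cinner_le[of v s] complex_Re_le_cmod[of "cinner v s"] by simp
      then have s_le: "norm s \<le> norm v" by (rule norm_le_of_cinner_le) simp
      have "cinner v b = k * cinner b b" by (simp add: v_eq cinner_add_left cinner_scaleC_left sb)
      then have "cmod k * (norm b)\<^sup>2 \<le> norm v * norm b"
        using cmod_cinner_le[of v b] by (simp add: cinner_self norm_mult norm_power)
      then have k_le: "cmod k \<le> norm v / norm b"
        using False by (simp add: power2_eq_square field_simps)
      have "f v = f s + k *\<^sub>C f b"
        unfolding v_eq using insert.prems(1)[of s "k *\<^sub>C b"] insert.prems(2)[OF bS, of k] s mono bS
        by (auto simp: complex_vector.span_scale)
      then have "norm (f v) \<le> norm (f s) + cmod k * norm (f b)" by (metis norm_triangle_ineq norm_scaleC)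
      also have "\<dots> \<le> K * norm v + norm v / norm b * norm (f b)"
        by (intro add_mono order_trans[OF K(2)[OF s]] mult_left_mono mult_right_mono s_le k_le K(1)) auto
      finally show ?thesis by (simp add: algebra_simps)
    qed
    moreover have "0 \<le> K + norm (f b) / norm b" using K(1) by simp
    ultimately show ?thesis by blast
  qed
qed

section \<open>Galerkin projection\<close>

locale galerkin = observed_system D0 A0 Dh Ah C
  for D0 :: "'a::complex_hilbert set" and A0 :: "'a \<Rightarrow> 'a" and Dh :: "'a set" and Ah :: "'a \<Rightarrow> 'a"
    and C :: "'a \<Rightarrow> 'b::complex_hilbert" +
  fixes V :: "'a set"
  assumes V: "galerkin_space Dh V"
begin

lemma V_Dh: "v \<in> V \<Longrightarrow> v \<in> Dh"
  using V by (auto simp: galerkin_space_def)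

lemma V_csubspace: "complex_vector.subspace V"
  using V by (auto simp: galerkin_space_def complex_vector.subspace_span)

lemma V_closed_ops:
  "0 \<in> V" "u \<in> V \<Longrightarrow> v \<in> V \<Longrightarrow> u + v \<in> V" "u \<in> V \<Longrightarrow> v \<in> V \<Longrightarrow> u - v \<in> V" "u \<in> V \<Longrightarrow> a *\<^sub>C u \<in> V"
  "u \<in> V \<Longrightarrow> - u \<in> V" "u \<in> V \<Longrightarrow> r *\<^sub>R u \<in> V"
  using V_csubspace
  by (auto simp: complex_vector.subspace_0 complex_vector.subspace_add complex_vector.subspace_diff
      complex_vector.subspace_neg complex_vector.subspace_scale scaleR_scaleC)

lemma eq_of_cinner_V: "u \<in> V \<Longrightarrow> v \<in> V \<Longrightarrow> (\<And>w. w \<in> V \<Longrightarrow> cinner (u - v) w = 0) \<Longrightarrow> u = v"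
  using V_closed_ops(3)[of u v] by (metis cinner_self norm_eq_zero of_real_eq_0_iff right_minus_eq zero_eq_power2)

definition proj :: "'a \<Rightarrow> 'a" where
  "proj = (SOME P. bounded_clinear P \<and> (\<forall>x. P x \<in> V) \<and> (\<forall>x. \<forall>v\<in>V. cinner (x - P x) v = 0))"

lemma proj: "bounded_clinear proj" "proj x \<in> V" "v \<in> V \<Longrightarrow> cinner (x - proj x) v = 0"
proof -
  obtain S where "finite S" "V = complex_vector.span S" using V by (auto simp: galerkin_space_def)
  then have "\<exists>P. bounded_clinear P \<and> (\<forall>x. P x \<in> V) \<and> (\<forall>x. \<forall>v\<in>V. cinner (x - P x) v = 0)"
    using orthogonal_projection_exists by blast
  then have "bounded_clinear proj \<and> (\<forall>x. proj x \<in> V) \<and> (\<forall>x. \<forall>v\<in>V. cinner (x - proj x) v = 0)"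
    unfolding proj_def by (rule someI_ex)
  then show "bounded_clinear proj" "proj x \<in> V" "v \<in> V \<Longrightarrow> cinner (x - proj x) v = 0" by blast+
qed

lemma proj_id: "v \<in> V \<Longrightarrow> proj v = v"
  by (rule sym, rule eq_of_cinner_V) (auto intro: proj)

lemma cinner_proj_left: "v \<in> V \<Longrightarrow> cinner (proj x) v = cinner x v"
  using proj(3)[of v x] by (simp add: cinner.diff_left)

text \<open>The square root of \<open>A\<close> restricted to the Galerkin space, extended to a bounded operator.\<close>

definition AhV :: "'a \<Rightarrow> 'a" where "AhV x = Ah (proj x)"

lemma AhV_V: "v \<in> V \<Longrightarrow> AhV v = Ah v"
  by (simp add: AhV_def proj_id)

lemma AhV_clinear: "AhV (x + y) = AhV x + AhV y" "AhV (a *\<^sub>C x) = a *\<^sub>C AhV x"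
proof -
  show "AhV (x + y) = AhV x + AhV y"
    unfolding AhV_def linear_add[OF bounded_linear.linear[OF bounded_clinearD(1)[OF proj(1)]]]
    by (rule selfadjoint_add[OF sah]) (auto intro: V_Dh proj)
  show "AhV (a *\<^sub>C x) = a *\<^sub>C AhV x"
    unfolding AhV_def bounded_clinearD(2)[OF proj(1)]
    by (rule selfadjoint_scaleC[OF sah]) (auto intro: V_Dh proj)
qed

lemma bounded_clinear_AhV: "bounded_clinear AhV"
proof -
  obtain S where S: "finite S" "V = complex_vector.span S" using V by (auto simp: galerkin_space_def)
  have "\<exists>K\<ge>0. \<forall>v\<in>complex_vector.span S. norm (Ah v) \<le> K * norm v"
    by (rule linear_on_finite_span_bounded[OF S(1)])
      (auto simp: S(2)[symmetric] selfadjoint_add[OF sah] selfadjoint_scaleC[OF sah] V_Dh)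
  then obtain K where K: "K \<ge> 0" "\<And>v. v \<in> V \<Longrightarrow> norm (Ah v) \<le> K * norm v" using S(2) by blast
  have "norm (AhV x) \<le> norm x * (K * onorm proj)" for x
  proof -
    have "norm (AhV x) \<le> K * norm (proj x)" unfolding AhV_def by (rule K(2)[OF proj(2)])
    also have "\<dots> \<le> K * (onorm proj * norm x)"
      by (intro mult_left_mono onorm[OF bounded_clinearD(1)[OF proj(1)]] K(1))
    finally show ?thesis by (simp add: mult_ac)
  qed
  then show ?thesis
    unfolding bounded_clinear_def
    by (auto intro!: bounded_linear_intro simp: AhV_clinear scaleR_scaleC)
qed

lemma Ah_injective:
  assumes "x \<in> Dh" "Ah x = 0"
  shows "x = 0"
proof -
  have "x \<in> D0" using assms by (simp add: dom_iff selfadjoint_dom[OF sah])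
  moreover from this have "A0 x = 0" using assms by (simp add: A0_eq selfadjoint_zero[OF sah])
  ultimately have "norm x \<le> 0" using norm_le_norm_A0[of x] by simp
  then show ?thesis by simp
qed

lemma AhV_injective: "u \<in> V \<Longrightarrow> v \<in> V \<Longrightarrow> AhV u = AhV v \<Longrightarrow> u = v"
  using Ah_injective[of "u - v"] V_Dh[OF V_closed_ops(3), of u v]
  by (simp add: AhV_V selfadjoint_diff[OF sah] V_Dh)

text \<open>
  The square root of \<open>A\<close> is injective, hence a bijection from the Galerkin space onto its image, and its
  inverse is bounded for reasons of dimension. Compose this inverse with the orthogonal projection onto
  the image.
\<close>

lemma lift_exists:
  "\<exists>G. bounded_clinear G \<and> (\<forall>y. G y \<in> V) \<and> (\<forall>y. \<forall>v\<in>V. cinner (y - AhV (G y)) (AhV v) = 0)"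
proof -
  obtain S where S: "finite S" "V = complex_vector.span S" using V by (auto simp: galerkin_space_def)
  interpret AhV: module_hom "scaleC :: complex \<Rightarrow> 'a \<Rightarrow> 'a" "scaleC :: complex \<Rightarrow> 'a \<Rightarrow> 'a" AhV
    by unfold_locales (auto simp: AhV_clinear)
  have W: "AhV ` V = complex_vector.span (AhV ` S)" by (rule AhV.span_image[of S, folded S(2), symmetric])
  obtain Q where Q: "bounded_clinear Q" and QW: "\<And>y. Q y \<in> AhV ` V"
    and Q_orth: "\<And>y w. w \<in> AhV ` V \<Longrightarrow> cinner (y - Q y) w = 0"
    using orthogonal_projection_exists[of "AhV ` S"] S(1) unfolding W by blast
  define \<Psi> where "\<Psi> = inv_into V AhV"
  have \<Psi>: "\<Psi> w \<in> V" "AhV (\<Psi> w) = w" if "w \<in> AhV ` V" for w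
    using that by (auto simp: \<Psi>_def inv_into_into f_inv_into_f)
  have \<Psi>_eqI: "\<Psi> w = v" if "v \<in> V" "AhV v = w" for v w
    using that AhV_injective \<Psi>[of w] by (metis imageI)
  have \<Psi>_add: "\<Psi> (w + w') = \<Psi> w + \<Psi> w'" if "w \<in> AhV ` V" "w' \<in> AhV ` V" for w w'
    using \<Psi>[OF that(1)] \<Psi>[OF that(2)] by (intro \<Psi>_eqI) (auto simp: AhV_clinear V_closed_ops)
  have \<Psi>_scale: "\<Psi> (a *\<^sub>C w) = a *\<^sub>C \<Psi> w" if "w \<in> AhV ` V" for a w
    using \<Psi>[OF that] by (intro \<Psi>_eqI) (auto simp: AhV_clinear V_closed_ops)
  have "\<exists>K\<ge>0. \<forall>w\<in>complex_vector.span (AhV ` S). norm (\<Psi> w) \<le> K * norm w"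
    by (rule linear_on_finite_span_bounded) (use S(1) in \<open>auto simp: W[symmetric] \<Psi>_add \<Psi>_scale\<close>)
  then obtain K where K: "K \<ge> 0" "\<And>w. w \<in> AhV ` V \<Longrightarrow> norm (\<Psi> w) \<le> K * norm w" using W by blast
  define G where "G y = \<Psi> (Q y)" for y
  have G_add: "G (x + y) = G x + G y" for x y
    unfolding G_def linear_add[OF bounded_linear.linear[OF bounded_clinearD(1)[OF Q]]] by (intro \<Psi>_add QW)
  have G_scale: "G (a *\<^sub>C x) = a *\<^sub>C G x" for a x
    unfolding G_def bounded_clinearD(2)[OF Q] by (intro \<Psi>_scale QW)
  have "norm (G y) \<le> norm y * (K * onorm Q)" for y
  proof -
    have "norm (G y) \<le> K * norm (Q y)" unfolding G_def by (rule K(2)[OF QW])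
    also have "\<dots> \<le> K * (onorm Q * norm y)"
      by (intro mult_left_mono onorm[OF bounded_clinearD(1)[OF Q]] K(1))
    finally show ?thesis by (simp add: mult_ac)
  qed
  then have "bounded_clinear G"
    unfolding bounded_clinear_def by (auto intro!: bounded_linear_intro simp: G_add G_scale scaleR_scaleC)
  moreover have "G y \<in> V" for y unfolding G_def by (rule \<Psi>(1)[OF QW])
  moreover have "cinner (y - AhV (G y)) (AhV v) = 0" if "v \<in> V" for y v
    unfolding G_def \<Psi>(2)[OF QW] by (rule Q_orth) (use that in blast)
  ultimately show ?thesis by blast
qed

text \<open>
  \<open>lift y\<close> is the element of the Galerkin space whose image under the square root of \<open>A\<close> is nearest to
  \<open>y\<close>; on images \<open>y = A\<^sup>1\<^sup>/\<^sup>2 \<phi>\<close> it yields the Galerkin projection of \<open>\<phi>\<close>.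
\<close>

definition lift :: "'a \<Rightarrow> 'a" where
  "lift = (SOME G. bounded_clinear G \<and> (\<forall>y. G y \<in> V) \<and> (\<forall>y. \<forall>v\<in>V. cinner (y - AhV (G y)) (AhV v) = 0))"

lemma lift: "bounded_clinear lift" "lift y \<in> V" "v \<in> V \<Longrightarrow> cinner (y - AhV (lift y)) (AhV v) = 0"
proof -
  have "bounded_clinear lift \<and> (\<forall>y. lift y \<in> V) \<and> (\<forall>y. \<forall>v\<in>V. cinner (y - AhV (lift y)) (AhV v) = 0)"
    unfolding lift_def by (rule someI_ex[OF lift_exists])
  then show "bounded_clinear lift" "lift y \<in> V" "v \<in> V \<Longrightarrow> cinner (y - AhV (lift y)) (AhV v) = 0" by blast+
qed

abbreviation gproj :: "'a \<Rightarrow> 'a" where "gproj \<equiv> galerkin_proj Ah V"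

lemma galerkin_proj_unique:
  assumes \<phi>: "\<phi> \<in> Dh" and p: "p \<in> V" "\<And>\<psi>. \<psi> \<in> V \<Longrightarrow> inner_half Ah (\<phi> - p) \<psi> = 0"
  shows "gproj \<phi> = p"
  unfolding galerkin_proj_def
proof (rule the_equality)
  show "p \<in> V \<and> (\<forall>\<psi>\<in>V. inner_half Ah (\<phi> - p) \<psi> = 0)" using p by blast
  fix p' assume p': "p' \<in> V \<and> (\<forall>\<psi>\<in>V. inner_half Ah (\<phi> - p') \<psi> = 0)"
  let ?d = "p' - p"
  have d: "?d \<in> V" using p p' by (simp add: V_closed_ops)
  have "Ah (\<phi> - p) - Ah (\<phi> - p') = Ah ?d"
    using p p' \<phi> by (simp add: selfadjoint_diff[OF sah] V_Dh)
  then have "cinner (Ah ?d) (Ah ?d) = inner_half Ah (\<phi> - p) ?d - inner_half Ah (\<phi> - p') ?d"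
    by (simp add: inner_half_def cinner.diff_left[symmetric])
  then have "Ah ?d = 0" using p(2)[OF d] p' d by (simp add: cinner_self)
  then show "p' = p" using Ah_injective[OF V_Dh[OF d]] by simp
qed

lemma galerkin_proj_eq_lift:
  assumes "\<phi> \<in> Dh"
  shows "gproj \<phi> = lift (Ah \<phi>)"
proof (rule galerkin_proj_unique[OF assms lift(2)])
  fix \<psi> assume \<psi>: "\<psi> \<in> V"
  have "Ah (\<phi> - lift (Ah \<phi>)) = Ah \<phi> - AhV (lift (Ah \<phi>))"
    by (simp add: selfadjoint_diff[OF sah] assms V_Dh lift AhV_V)
  then show "inner_half Ah (\<phi> - lift (Ah \<phi>)) \<psi> = 0"
    using lift(3)[OF \<psi>, of "Ah \<phi>"] by (simp add: inner_half_def AhV_V[OF \<psi>])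
qed

lemma gproj_in_V: "\<phi> \<in> Dh \<Longrightarrow> gproj \<phi> \<in> V"
  by (simp add: galerkin_proj_eq_lift lift)

lemma inner_half_gproj: "\<phi> \<in> Dh \<Longrightarrow> \<psi> \<in> V \<Longrightarrow> inner_half Ah (gproj \<phi>) \<psi> = inner_half Ah \<phi> \<psi>"
  using lift(3)[of \<psi> "Ah \<phi>"]
  by (simp add: galerkin_proj_eq_lift inner_half_def AhV_V lift cinner.diff_left)

lemma gproj_id: "v \<in> V \<Longrightarrow> gproj v = v"
  by (rule galerkin_proj_unique)
    (auto simp: V_Dh inner_half_def selfadjoint_zero[OF sah] cinner.zero_left)

text \<open>
  Because \<open>\<langle>\<phi>, \<psi>\<rangle>\<^sub>1\<^sub>/\<^sub>2 = \<langle>A \<phi>, \<psi>\<rangle>\<close> for \<open>\<phi>\<close> in the domain of \<open>A\<close>, the Galerkin projection of \<open>\<phi>\<close> depends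
  boundedly on \<open>A \<phi>\<close>, by way of the inverse \<open>dinv\<close> of the discretised \<open>A\<close>. This is how projected
  trajectories inherit differentiability.
\<close>

definition dinv :: "'a \<Rightarrow> 'a" where "dinv y = lift (cadjoint lift y)"

lemma bounded_linear_dinv: "bounded_linear dinv"
  unfolding dinv_def[abs_def]
  by (rule bounded_linear_compose[OF bounded_clinearD(1)[OF lift(1)] bounded_clinearD(1)[OF bounded_clinear_cadjoint[OF lift(1)]]])

lemma lift_AhV: "v \<in> V \<Longrightarrow> lift (AhV v) = v"
  using galerkin_proj_eq_lift[OF V_Dh] gproj_id AhV_V by metis

lemma gproj_eq_dinv:
  assumes x: "x \<in> D0"
  shows "gproj x = dinv (A0 x)"
proof (rule galerkin_proj_unique)
  have xh: "x \<in> Dh" using x by (simp add: dom_iff)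
  then show "x \<in> Dh" .
  show dV: "dinv (A0 x) \<in> V" by (simp add: dinv_def lift)
  fix \<psi> assume \<psi>: "\<psi> \<in> V"
  have "cinner (AhV (dinv (A0 x))) (AhV \<psi>) = cinner (cadjoint lift (A0 x)) (AhV \<psi>)"
    using lift(3)[OF \<psi>, of "cadjoint lift (A0 x)"] by (simp add: dinv_def cinner.diff_left)
  also have "\<dots> = cnj (cinner (lift (AhV \<psi>)) (A0 x))"
    by (subst cinner_commute) (simp add: cinner_cadjoint[OF lift(1)])
  also have "\<dots> = cinner (A0 x) \<psi>"
    unfolding lift_AhV[OF \<psi>] by (rule cinner_commute[symmetric])
  also have "\<dots> = cinner (Ah x) (Ah \<psi>)" by (rule cinner_A0_left[OF x V_Dh[OF \<psi>]])
  finally show "inner_half Ah (x - dinv (A0 x)) \<psi> = 0"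
    by (simp add: inner_half_def selfadjoint_diff[OF sah xh V_Dh[OF dV]] AhV_V[OF \<psi>] AhV_V[OF dV] cinner.diff_left)
qed

text \<open>
  The Aubin--Nitsche duality trick: the error of the projection is its own projection error, and its
  energy norm is controlled by testing with \<open>A \<phi>\<close>. On the domain of \<open>A\<close> the order of approximation
  doubles.
\<close>

lemma aubin_nitsche:
  assumes approx: "\<And>\<phi>. \<phi> \<in> Dh \<Longrightarrow> norm (gproj \<phi> - \<phi>) \<le> \<epsilon> * norm (Ah \<phi>)" and \<epsilon>: "0 \<le> \<epsilon>" and \<phi>: "\<phi> \<in> D0"
  shows "norm (gproj \<phi> - \<phi>) \<le> \<epsilon>\<^sup>2 * norm (A0 \<phi>)"
proof -
  have \<phi>h: "\<phi> \<in> Dh" using \<phi> by (simp add: dom_iff)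
  define e where "e = \<phi> - gproj \<phi>"
  have eh: "e \<in> Dh" unfolding e_def by (intro selfadjoint_dom(3)[OF sah] \<phi>h V_Dh gproj_in_V)
  have orth: "inner_half Ah e \<psi> = 0" if "\<psi> \<in> V" for \<psi>
    unfolding e_def using inner_half_gproj[OF \<phi>h that]
    by (simp add: inner_half_def selfadjoint_diff[OF sah \<phi>h V_Dh[OF gproj_in_V[OF \<phi>h]]] cinner.diff_left)
  have "gproj e = 0"
    by (rule galerkin_proj_unique[OF eh V_closed_ops(1)]) (simp add: orth)
  then have e_le: "norm e \<le> \<epsilon> * norm (Ah e)" using approx[OF eh] by simp
  have "cinner (Ah e) (Ah e) = cinner (Ah e) (Ah \<phi>) - cinner (Ah e) (Ah (gproj \<phi>))"
    by (simp add: e_def selfadjoint_diff[OF sah \<phi>h V_Dh[OF gproj_in_V[OF \<phi>h]]] cinner.diff_right)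
  also have "\<dots> = cinner e (A0 \<phi>)"
    using orth[OF gproj_in_V[OF \<phi>h]] by (simp add: inner_half_def cinner_A0_right[OF eh \<phi>])
  finally have "(norm (Ah e))\<^sup>2 = cmod (cinner e (A0 \<phi>))"
    by (metis cinner_self norm_of_real abs_of_nonneg zero_le_power2)
  then have Ae: "(norm (Ah e))\<^sup>2 \<le> norm e * norm (A0 \<phi>)" using cmod_cinner_le by metis
  have "norm e \<le> \<epsilon>\<^sup>2 * norm (A0 \<phi>)"
  proof (rule norm_le_of_cinner_le)
    have "Re (cinner e e) = (norm e)\<^sup>2" by (simp add: cinner_self)
    also have "\<dots> \<le> (\<epsilon> * norm (Ah e))\<^sup>2" by (intro power_mono e_le) auto
    also have "\<dots> \<le> \<epsilon>\<^sup>2 * (norm e * norm (A0 \<phi>))"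
      unfolding power_mult_distrib by (intro mult_left_mono Ae) auto
    finally show "Re (cinner e e) \<le> \<epsilon>\<^sup>2 * norm (A0 \<phi>) * norm e" by (simp add: mult_ac)
  qed simp
  then show ?thesis by (simp add: e_def norm_minus_commute)
qed


section \<open>Forced Galerkin equations\<close>

definition form :: "real \<Rightarrow> 'a \<Rightarrow> 'a \<Rightarrow> complex" where
  "form \<sigma> v \<phi> = of_real \<sigma> * \<i> * inner_half Ah v \<phi> - cinner (B v) \<phi>"

text \<open>
  The forcing \<open>g\<close> is merely integrable in the observers, so the equation
  \<open>\<langle>\<delta>', \<phi>\<rangle> = form \<sigma> \<delta> \<phi> + \<langle>g, \<phi>\<rangle>\<close> is stated in integrated form. The gauge
  integral makes the integrability of the right-hand side a part of the equation.
\<close>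

definition forced :: "real \<Rightarrow> real \<Rightarrow> (real \<Rightarrow> 'a) \<Rightarrow> (real \<Rightarrow> 'a) \<Rightarrow> bool" where
  "forced \<sigma> \<tau> g \<delta> \<longleftrightarrow> (\<forall>t\<in>{0..\<tau>}. \<delta> t \<in> V) \<and> continuous_on {0..\<tau>} \<delta> \<and>
     (\<forall>\<phi>\<in>V. \<forall>t\<in>{0..\<tau>}. ((\<lambda>s. form \<sigma> (\<delta> s) \<phi> + cinner (g s) \<phi>) has_integral
        (cinner (\<delta> t) \<phi> - cinner (\<delta> 0) \<phi>)) {0..t})"

lemma form_diff: "u \<in> V \<Longrightarrow> v \<in> V \<Longrightarrow> form \<sigma> (u - v) \<phi> = form \<sigma> u \<phi> - form \<sigma> v \<phi>"
  by (simp add: form_def inner_half_def selfadjoint_diff[OF sah] V_Dh cinner.diff_left B_diff algebra_simps)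

lemma forced_diff:
  assumes "forced \<sigma> \<tau> g \<delta>" "forced \<sigma> \<tau> g' \<delta>'"
  shows "forced \<sigma> \<tau> (\<lambda>t. g t - g' t) (\<lambda>t. \<delta> t - \<delta>' t)"
  unfolding forced_def
proof (intro conjI ballI)
  note d = assms(1)[unfolded forced_def] and d' = assms(2)[unfolded forced_def]
  show "\<delta> t - \<delta>' t \<in> V" if "t \<in> {0..\<tau>}" for t using d d' that by (auto intro: V_closed_ops)
  show "continuous_on {0..\<tau>} (\<lambda>t. \<delta> t - \<delta>' t)" using d d' by (auto intro: continuous_intros)
  fix \<phi> t assume \<phi>: "\<phi> \<in> V" and t: "t \<in> {0..\<tau>}"
  have "((\<lambda>s. (form \<sigma> (\<delta> s) \<phi> + cinner (g s) \<phi>) - (form \<sigma> (\<delta>' s) \<phi> + cinner (g' s) \<phi>)) has_integral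
      ((cinner (\<delta> t) \<phi> - cinner (\<delta> 0) \<phi>) - (cinner (\<delta>' t) \<phi> - cinner (\<delta>' 0) \<phi>))) {0..t}"
    using d d' \<phi> t by (intro has_integral_diff) auto
  then have H: "((\<lambda>s. (form \<sigma> (\<delta> s) \<phi> + cinner (g s) \<phi>) - (form \<sigma> (\<delta>' s) \<phi> + cinner (g' s) \<phi>)) has_integral
      (cinner (\<delta> t - \<delta>' t) \<phi> - cinner (\<delta> 0 - \<delta>' 0) \<phi>)) {0..t}"
    by (simp add: cinner.diff_left algebra_simps)
  have "(form \<sigma> (\<delta> s) \<phi> + cinner (g s) \<phi>) - (form \<sigma> (\<delta>' s) \<phi> + cinner (g' s) \<phi>)
      = form \<sigma> (\<delta> s - \<delta>' s) \<phi> + cinner (g s - g' s) \<phi>" if "s \<in> {0..t}" for s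
    using d d' t that by (subst form_diff) (auto simp: cinner.diff_left)
  from has_integral_eq[OF this H]
  show "((\<lambda>s. form \<sigma> (\<delta> s - \<delta>' s) \<phi> + cinner (g s - g' s) \<phi>) has_integral
      (cinner (\<delta> t - \<delta>' t) \<phi> - cinner (\<delta> 0 - \<delta>' 0) \<phi>)) {0..t}" .
qed

lemma forced_add:
  assumes "forced \<sigma> \<tau> g \<delta>" "forced \<sigma> \<tau> g' \<delta>'"
  shows "forced \<sigma> \<tau> (\<lambda>t. g t + g' t) (\<lambda>t. \<delta> t + \<delta>' t)"
proof -
  have "form \<sigma> 0 \<phi> = 0" for \<phi>
    using form_diff[OF V_closed_ops(1) V_closed_ops(1), of \<sigma> \<phi>] by simp
  then have "forced \<sigma> \<tau> (\<lambda>_. 0) (\<lambda>_. 0)"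
    by (simp add: forced_def V_closed_ops(1) cinner.zero_left)
  from forced_diff[OF assms(1) forced_diff[OF this assms(2)]] show ?thesis by simp
qed

lemma forced_of_derivative:
  assumes V: "\<And>t. t \<in> {0..\<tau>} \<Longrightarrow> \<delta> t \<in> V"
    and deriv: "\<And>t. t \<in> {0..\<tau>} \<Longrightarrow> (\<delta> has_vector_derivative \<delta>' t) (at t within {0..\<tau>})"
    and eq: "\<And>t \<phi>. t \<in> {0..\<tau>} \<Longrightarrow> \<phi> \<in> V \<Longrightarrow> cinner (\<delta>' t) \<phi> = form \<sigma> (\<delta> t) \<phi> + cinner (g t) \<phi>"
  shows "forced \<sigma> \<tau> g \<delta>"
  unfolding forced_def
proof (intro conjI ballI)
  show "continuous_on {0..\<tau>} \<delta>" by (rule continuous_on_vector_derivative[OF deriv])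
  fix \<phi> t assume \<phi>: "\<phi> \<in> V" and t: "t \<in> {0..\<tau>}"
  show "((\<lambda>s. form \<sigma> (\<delta> s) \<phi> + cinner (g s) \<phi>) has_integral (cinner (\<delta> t) \<phi> - cinner (\<delta> 0) \<phi>)) {0..t}"
  proof (rule fundamental_theorem_of_calculus)
    fix s assume s: "s \<in> {0..t}"
    then have s': "s \<in> {0..\<tau>}" using t by auto
    have "((\<lambda>s. cinner (\<delta> s) \<phi>) has_vector_derivative cinner (\<delta>' s) \<phi>) (at s within {0..t})"
      by (rule bounded_linear.has_vector_derivative[OF cinner.bounded_linear_left])
        (rule has_vector_derivative_within_subset[OF deriv[OF s']], use t in auto)
    then show "((\<lambda>s. cinner (\<delta> s) \<phi>) has_vector_derivative form \<sigma> (\<delta> s) \<phi> + cinner (g s) \<phi>) (at s within {0..t})"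
      by (simp add: eq[OF s' \<phi>])
  qed (use t in simp)
qed (rule V)

lemma Re_form_le: "Re (form \<sigma> v v) \<le> 0"
  by (simp add: form_def inner_half_def cinner_self cinner_B)

lemma form_bounded:
  shows "\<exists>K\<ge>0. \<forall>v\<in>V. \<forall>\<phi>\<in>V. cmod (form \<sigma> v \<phi>) \<le> K * norm v * norm \<phi>"
proof -
  let ?a = "onorm AhV"
  have a: "norm (AhV x) \<le> ?a * norm x" for x by (rule onorm[OF bounded_clinearD(1)[OF bounded_clinear_AhV]])
  have a0: "0 \<le> ?a" by (rule onorm_pos_le[OF bounded_clinearD(1)[OF bounded_clinear_AhV]])
  have "cmod (form \<sigma> v \<phi>) \<le> (\<bar>\<sigma>\<bar> * (?a * ?a) + \<beta>) * norm v * norm \<phi>" if "v \<in> V" "\<phi> \<in> V" for v \<phi>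
  proof -
    have "cmod (form \<sigma> v \<phi>) \<le> \<bar>\<sigma>\<bar> * cmod (cinner (AhV v) (AhV \<phi>)) + cmod (cinner (B v) \<phi>)"
      unfolding form_def inner_half_def using that
      by (intro order_trans[OF norm_triangle_ineq4]) (simp add: norm_mult AhV_V)
    also have "\<dots> \<le> \<bar>\<sigma>\<bar> * ((?a * norm v) * (?a * norm \<phi>)) + (\<beta> * norm v) * norm \<phi>"
      using a0 by (intro add_mono mult_left_mono order_trans[OF cmod_cinner_le] mult_mono mult_right_mono a norm_B_le) auto
    finally show ?thesis by (simp add: algebra_simps)
  qed
  moreover have "0 \<le> \<bar>\<sigma>\<bar> * (?a * ?a) + \<beta>" using a0 \<beta>_nonneg by simp
  ultimately show ?thesis by blast
qed

end

text \<open>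
  Over a partition into short steps the increments add up to at most the total length times the rate,
  and the rate is arbitrary.
\<close>

lemma decreasing_of_short_steps:
  fixes F :: "real \<Rightarrow> real"
  assumes \<tau>: "0 \<le> \<tau>"
    and step: "\<And>e. e > 0 \<Longrightarrow> \<exists>d>0. \<forall>s t. 0 \<le> s \<longrightarrow> s \<le> t \<longrightarrow> t \<le> \<tau> \<longrightarrow> t - s < d \<longrightarrow> F t \<le> F s + e * (t - s)"
  shows "F \<tau> \<le> F 0"
proof (rule field_le_epsilon)
  fix e :: real assume e: "e > 0"
  define e' where "e' = e / (\<tau> + 1)"
  have e': "e' > 0" using e \<tau> by (simp add: e'_def)
  obtain d where d: "d > 0"
    "\<And>s t. 0 \<le> s \<Longrightarrow> s \<le> t \<Longrightarrow> t \<le> \<tau> \<Longrightarrow> t - s < d \<Longrightarrow> F t \<le> F s + e' * (t - s)"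
    using step[OF e'] by blast
  obtain n where n: "\<tau> / d < real n" using reals_Archimedean2 by blast
  have n0: "0 < real n" using n \<tau> d(1) by (meson divide_nonneg_pos le_less_trans)
  define w where "w = \<tau> / real n"
  define p where "p k = real k * w" for k
  have w: "0 \<le> w" "w < d" "real n * w = \<tau>" using n n0 \<tau> d(1) by (auto simp: w_def field_simps)
  have "F (p k) \<le> F 0 + e' * p k" if "k \<le> n" for k
    using that
  proof (induction k)
    case (Suc k)
    have "F (p (Suc k)) \<le> F (p k) + e' * (p (Suc k) - p k)"
    proof (rule d(2))
      show "0 \<le> p k" "p k \<le> p (Suc k)" "p (Suc k) - p k < d"
        using w by (auto simp: p_def algebra_simps)
      have "p (Suc k) \<le> real n * w" unfolding p_def using Suc.prems w by (intro mult_right_mono) auto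
      then show "p (Suc k) \<le> \<tau>" using w by simp
    qed
    then show ?case using Suc by (simp add: algebra_simps)
  qed (simp add: p_def)
  from this[of n] have "F \<tau> \<le> F 0 + e' * \<tau>" by (simp add: p_def w)
  also have "e' * \<tau> \<le> e" using e \<tau> by (simp add: e'_def field_simps)
  finally show "F \<tau> \<le> F 0 + e" by simp
qed

context galerkin
begin

text \<open>
  The energy estimate. The solution need not be differentiable, so the equation is tested over a short
  interval with the value at its right end; uniform continuity makes the error of freezing the
  solution there small relative to the length of the interval.
\<close>

lemma energy_estimate:
  assumes \<delta>: "forced \<sigma> \<tau> g \<delta>" and \<tau>: "0 \<le> \<tau>"
    and \<gamma>: "\<gamma> integrable_on {0..\<tau>}" and g: "\<And>t. t \<in> {0..\<tau>} \<Longrightarrow> norm (g t) \<le> \<gamma> t"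
  shows "norm (\<delta> \<tau>) \<le> norm (\<delta> 0) + integral {0..\<tau>} \<gamma>"
proof -
  have \<delta>V: "\<And>t. t \<in> {0..\<tau>} \<Longrightarrow> \<delta> t \<in> V" and cont: "continuous_on {0..\<tau>} \<delta>"
    and eq: "\<And>\<phi> t. \<phi> \<in> V \<Longrightarrow> t \<in> {0..\<tau>} \<Longrightarrow> ((\<lambda>s. form \<sigma> (\<delta> s) \<phi> + cinner (g s) \<phi>) has_integral
        (cinner (\<delta> t) \<phi> - cinner (\<delta> 0) \<phi>)) {0..t}"
    using \<delta> by (auto simp: forced_def)
  obtain K where K: "K \<ge> 0" "\<And>v \<phi>. v \<in> V \<Longrightarrow> \<phi> \<in> V \<Longrightarrow> cmod (form \<sigma> v \<phi>) \<le> K * norm v * norm \<phi>"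
    using form_bounded[of \<sigma>] by blast
  define F where "F t = norm (\<delta> t) - integral {0..t} \<gamma>" for t
  have sub: "f integrable_on {s..t}" if "f integrable_on {0..\<tau>}" "0 \<le> s" "t \<le> \<tau>"
    for f :: "real \<Rightarrow> 'c::banach" and s t
    by (rule integrable_on_subinterval[OF that(1)]) (use that in auto)
  have "F \<tau> \<le> F 0"
  proof (rule decreasing_of_short_steps[OF \<tau>])
    fix e :: real assume e: "e > 0"
    define e' where "e' = e / (K + 1)"
    have e': "e' > 0" using e K(1) by (simp add: e'_def)
    have Ke': "K * e' \<le> e" using e K(1) by (simp add: e'_def field_simps)
    have "uniformly_continuous_on {0..\<tau>} \<delta>" by (rule compact_uniformly_continuous[OF cont]) simp
    then obtain d where d: "d > 0" "\<And>r t. r \<in> {0..\<tau>} \<Longrightarrow> t \<in> {0..\<tau>} \<Longrightarrow> dist r t < d \<Longrightarrow> dist (\<delta> r) (\<delta> t) < e'"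
      unfolding uniformly_continuous_on_def using e' by blast
    have "F t \<le> F s + e * (t - s)" if st: "0 \<le> s" "s \<le> t" "t \<le> \<tau>" "t - s < d" for s t
    proof -
      define \<phi> where "\<phi> = \<delta> t"
      have \<phi>: "\<phi> \<in> V" using \<delta>V st by (simp add: \<phi>_def)
      let ?f = "\<lambda>r. form \<sigma> (\<delta> r) \<phi> + cinner (g r) \<phi>"
      have int0: "?f integrable_on {0..\<tau>}" using eq[OF \<phi>, of \<tau>] \<tau> by auto
      have "(?f has_integral integral {s..t} ?f) {s..t}"
        using sub[OF int0, of s t] st by (simp add: integrable_integral)
      moreover have "integral {s..t} ?f = cinner (\<delta> t) \<phi> - cinner (\<delta> s) \<phi>"
      proof -
        have I: "integral {0..r} ?f = cinner (\<delta> r) \<phi> - cinner (\<delta> 0) \<phi>" if "0 \<le> r" "r \<le> \<tau>" for r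
          by (rule integral_unique[OF eq[OF \<phi>]]) (use that in simp)
        have "integral {0..s} ?f + integral {s..t} ?f = integral {0..t} ?f"
          by (rule Henstock_Kurzweil_Integration.integral_combine[OF st(1,2) sub[OF int0 order_refl st(3)]])
        then have "integral {s..t} ?f = integral {0..t} ?f - integral {0..s} ?f"
          unfolding eq_diff_eq by (subst add.commute)
        moreover have "integral {0..s} ?f = cinner (\<delta> s) \<phi> - cinner (\<delta> 0) \<phi>"
          and "integral {0..t} ?f = cinner (\<delta> t) \<phi> - cinner (\<delta> 0) \<phi>"
          by (rule I; use st in simp)+
        ultimately show ?thesis by simp
      qed
      ultimately have "(?f has_integral (cinner (\<delta> t) \<phi> - cinner (\<delta> s) \<phi>)) {s..t}" by simp
      from has_integral_Re[OF this]
      have lhs: "((\<lambda>r. Re (?f r)) has_integral (Re (cinner (\<delta> t) \<phi>) - Re (cinner (\<delta> s) \<phi>))) {s..t}" by simp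
      have \<gamma>st: "\<gamma> integrable_on {s..t}" by (rule sub[OF \<gamma>]) (use st in auto)
      have rhs: "((\<lambda>r. e * norm \<phi> + \<gamma> r * norm \<phi>) has_integral
          ((t - s) * (e * norm \<phi>) + integral {s..t} \<gamma> * norm \<phi>)) {s..t}"
        using has_integral_add[OF has_integral_const_real[of "e * norm \<phi>" s t]
            has_integral_mult_left[OF integrable_integral[OF \<gamma>st], of "norm \<phi>"]] st by simp
      have "Re (cinner (\<delta> t) \<phi>) - Re (cinner (\<delta> s) \<phi>) \<le> (t - s) * (e * norm \<phi>) + integral {s..t} \<gamma> * norm \<phi>"
      proof (rule has_integral_le[OF lhs rhs])
        fix r assume r: "r \<in> {s..t}"
        then have r': "r \<in> {0..\<tau>}" "t \<in> {0..\<tau>}" using st by auto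
        have "form \<sigma> (\<delta> r) \<phi> = form \<sigma> (\<delta> r - \<delta> t) \<phi> + form \<sigma> \<phi> \<phi>"
          using form_diff[OF \<delta>V[OF r'(1)] \<phi>, of \<sigma> \<phi>] by (simp add: \<phi>_def)
        then have "Re (form \<sigma> (\<delta> r) \<phi>) \<le> cmod (form \<sigma> (\<delta> r - \<delta> t) \<phi>)"
          using Re_form_le[of \<sigma> \<phi>] complex_Re_le_cmod[of "form \<sigma> (\<delta> r - \<delta> t) \<phi>"] by simp
        also have "\<dots> \<le> K * norm (\<delta> r - \<delta> t) * norm \<phi>"
          by (rule K(2)[OF V_closed_ops(3)[OF \<delta>V[OF r'(1)] \<delta>V[OF r'(2)]] \<phi>])
        also have "\<dots> \<le> K * e' * norm \<phi>"
          using d(2)[OF r'] r st K(1) by (intro mult_right_mono mult_left_mono) (auto simp: dist_norm)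
        also have "\<dots> \<le> e * norm \<phi>" by (intro mult_right_mono Ke') auto
        finally have 1: "Re (form \<sigma> (\<delta> r) \<phi>) \<le> e * norm \<phi>" .
        have "Re (cinner (g r) \<phi>) \<le> norm (g r) * norm \<phi>"
          using cmod_cinner_le complex_Re_le_cmod order_trans by blast
        also have "\<dots> \<le> \<gamma> r * norm \<phi>" by (intro mult_right_mono g r') auto
        finally show "Re (?f r) \<le> e * norm \<phi> + \<gamma> r * norm \<phi>" using 1 by simp
      qed
      moreover have "Re (cinner (\<delta> s) \<phi>) \<le> norm (\<delta> s) * norm \<phi>"
        using cmod_cinner_le complex_Re_le_cmod order_trans by blast
      ultimately have "Re (cinner \<phi> \<phi>) \<le> (norm (\<delta> s) + integral {s..t} \<gamma> + e * (t - s)) * norm \<phi>"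
        by (simp add: \<phi>_def algebra_simps)
      moreover have "0 \<le> integral {s..t} \<gamma>"
      proof (rule Henstock_Kurzweil_Integration.integral_nonneg[OF \<gamma>st])
        show "0 \<le> \<gamma> r" if "r \<in> {s..t}" for r
          by (rule order_trans[OF norm_ge_zero g]) (use that st in auto)
      qed
      ultimately have "norm \<phi> \<le> norm (\<delta> s) + integral {s..t} \<gamma> + e * (t - s)"
        using e st by (intro norm_le_of_cinner_le) auto
      moreover have "integral {0..s} \<gamma> + integral {s..t} \<gamma> = integral {0..t} \<gamma>"
        by (rule Henstock_Kurzweil_Integration.integral_combine[OF st(1,2) sub[OF \<gamma> order_refl st(3)]])
      ultimately show ?thesis by (simp add: F_def \<phi>_def)
    qed
    then show "\<exists>d>0. \<forall>s t. 0 \<le> s \<longrightarrow> s \<le> t \<longrightarrow> t \<le> \<tau> \<longrightarrow> t - s < d \<longrightarrow> F t \<le> F s + e * (t - s)"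
      using d(1) by blast
  qed
  then show ?thesis by (simp add: F_def)
qed

lemma forced_restrict: "forced \<sigma> \<tau> g \<delta> \<Longrightarrow> t \<le> \<tau> \<Longrightarrow> forced \<sigma> t g \<delta>"
  by (auto simp: forced_def elim!: continuous_on_subset)

lemma norm_unforced_le:
  assumes "forced \<sigma> \<tau> (\<lambda>_. 0) \<delta>" "t \<in> {0..\<tau>}"
  shows "norm (\<delta> t) \<le> norm (\<delta> 0)"
proof -
  have "forced \<sigma> t (\<lambda>_. 0) \<delta>" by (rule forced_restrict[OF assms(1)]) (use assms in simp)
  from energy_estimate[OF this, of "\<lambda>_. 0"] assms(2) show ?thesis by (simp add: integrable_const_ivl)
qed


section \<open>The discrete semigroups\<close>

text \<open>
  The operator with \<open>\<langle>gen_h \<sigma> v, \<phi>\<rangle> = form \<sigma> v \<phi>\<close> on the Galerkin space, extended to the whole space so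
  as to commute with the orthogonal projection. Hence its exponential leaves the Galerkin space
  invariant.
\<close>

definition gen_h :: "real \<Rightarrow> 'a \<Rightarrow> 'a" where
  "gen_h \<sigma> x = proj ((of_real \<sigma> * \<i>) *\<^sub>C cadjoint AhV (AhV x) - B (proj x))"

definition flow_h :: "real \<Rightarrow> real \<Rightarrow> 'a \<Rightarrow> 'a" where
  "flow_h \<sigma> = exp_flow (gen_h \<sigma>)"

lemma bounded_linear_gen_h: "bounded_linear (gen_h \<sigma>)"
  unfolding gen_h_def[abs_def]
  by (intro bounded_linear_compose[OF bounded_clinearD(1)[OF proj(1)]] bounded_linear_sub
      bounded_linear_compose[OF scaleC.bounded_linear_right]
      bounded_linear_compose[OF bounded_clinearD(1)[OF bounded_clinear_cadjoint[OF bounded_clinear_AhV]]]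
      bounded_clinearD(1)[OF bounded_clinear_AhV]
      bounded_linear_compose[OF bounded_linear_B] bounded_clinearD(1)[OF proj(1)])

lemma proj_gen_h: "proj (gen_h \<sigma> x) = gen_h \<sigma> (proj x)"
  by (simp add: gen_h_def proj_id proj AhV_def)

lemma cinner_gen_h:
  assumes "v \<in> V" "\<phi> \<in> V"
  shows "cinner (gen_h \<sigma> v) \<phi> = form \<sigma> v \<phi>"
proof -
  have adj: "cinner (cadjoint AhV (AhV v)) \<phi> = cinner (AhV v) (AhV \<phi>)"
    using arg_cong[OF cinner_cadjoint[OF bounded_clinear_AhV, of \<phi> "AhV v"], of cnj]
    by (simp only: cinner_commute[symmetric])
  have "cinner (gen_h \<sigma> v) \<phi> = cinner ((of_real \<sigma> * \<i>) *\<^sub>C cadjoint AhV (AhV v) - B (proj v)) \<phi>"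
    unfolding gen_h_def by (rule cinner_proj_left[OF assms(2)])
  also have "\<dots> = of_real \<sigma> * \<i> * cinner (AhV v) (AhV \<phi>) - cinner (B v) \<phi>"
    by (simp only: cinner.diff_left cinner_scaleC_left proj_id[OF assms(1)] adj)
  finally show ?thesis
    by (simp only: form_def inner_half_def AhV_V[OF assms(1)] AhV_V[OF assms(2)])
qed

lemma flow_h_in_V:
  assumes "v \<in> V"
  shows "flow_h \<sigma> t v \<in> V"
proof -
  have "proj (flow_h \<sigma> t v) = flow_h \<sigma> t (proj v)"
    unfolding flow_h_def
    by (rule exp_flow_commute[where P = proj and G = "gen_h \<sigma>"])
      (rule bounded_linear_gen_h bounded_clinearD(1)[OF proj(1)] proj_gen_h)+
  then show ?thesis using proj(2)[of "flow_h \<sigma> t v"] by (simp add: proj_id[OF assms])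
qed

lemma flow_h_zero: "flow_h \<sigma> 0 v = v"
  unfolding flow_h_def by (rule exp_flow_zero[OF bounded_linear_gen_h])

lemma flow_h_add: "flow_h \<sigma> t (u + v) = flow_h \<sigma> t u + flow_h \<sigma> t v"
  unfolding flow_h_def by (rule exp_flow_add[OF bounded_linear_gen_h])

lemma flow_h_diff: "flow_h \<sigma> t (u - v) = flow_h \<sigma> t u - flow_h \<sigma> t v"
  using flow_h_add[of \<sigma> t "u - v" v] by simp

lemma flow_h_deriv: "((\<lambda>t. flow_h \<sigma> t v) has_vector_derivative gen_h \<sigma> (flow_h \<sigma> t v)) (at t within S)"
  unfolding flow_h_def by (rule exp_flow_has_vector_derivative_within[OF bounded_linear_gen_h])

lemma forced_flow_h:
  assumes "v \<in> V"
  shows "forced \<sigma> \<tau> (\<lambda>_. 0) (\<lambda>t. flow_h \<sigma> t v)"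
  by (rule forced_of_derivative[OF _ flow_h_deriv])
    (simp_all add: flow_h_in_V assms cinner_gen_h cinner.zero_left)

lemma norm_flow_h_le: "v \<in> V \<Longrightarrow> 0 \<le> t \<Longrightarrow> norm (flow_h \<sigma> t v) \<le> norm v"
  using norm_unforced_le[OF forced_flow_h[where \<tau> = t and \<sigma> = \<sigma>], of v t] by (simp add: flow_h_zero)

lemma discrete_solution_flow_h:
  assumes "q0 \<in> Dh"
  shows "discrete_solution (of_real \<sigma>) Ah C V \<tau> q0 (\<lambda>t. flow_h \<sigma> t (gproj q0))"
  unfolding discrete_solution_def
proof (intro conjI ballI)
  note p = gproj_in_V[OF assms]
  show "flow_h \<sigma> t (gproj q0) \<in> V" for t by (rule flow_h_in_V[OF p])
  show "flow_h \<sigma> 0 (gproj q0) = gproj q0" by (rule flow_h_zero)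
  show "\<exists>q'. ((\<lambda>t. flow_h \<sigma> t (gproj q0)) has_vector_derivative q') (at t within {0..\<tau>}) \<and>
      (\<forall>\<phi>\<in>V. cinner q' \<phi> = of_real \<sigma> * \<i> * inner_half Ah (flow_h \<sigma> t (gproj q0)) \<phi> - cinner (B (flow_h \<sigma> t (gproj q0))) \<phi>)"
    for t
    by (rule exI[of _ "gen_h \<sigma> (flow_h \<sigma> t (gproj q0))"])
      (simp add: flow_h_deriv cinner_gen_h flow_h_in_V[OF p] form_def)
qed

lemma discrete_semigroup_eq:
  assumes q0: "q0 \<in> Dh" and t: "t \<in> {0..\<tau>}"
  shows "discrete_semigroup (of_real \<sigma>) Ah C V \<tau> t q0 = flow_h \<sigma> t (gproj q0)"
  unfolding discrete_semigroup_def
proof (rule the_equality)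
  show "\<exists>q. discrete_solution (of_real \<sigma>) Ah C V \<tau> q0 q \<and> flow_h \<sigma> t (gproj q0) = q t"
    using discrete_solution_flow_h[OF q0] by blast
  fix v assume "\<exists>q. discrete_solution (of_real \<sigma>) Ah C V \<tau> q0 q \<and> v = q t"
  then obtain q where q: "discrete_solution (of_real \<sigma>) Ah C V \<tau> q0 q" and v: "v = q t" by blast
  have "\<forall>t\<in>{0..\<tau>}. \<exists>q'. (q has_vector_derivative q') (at t within {0..\<tau>}) \<and> (\<forall>\<phi>\<in>V. cinner q' \<phi> = form \<sigma> (q t) \<phi>)"
    using q by (simp add: discrete_solution_def form_def)
  then obtain q' where q': "\<And>t. t \<in> {0..\<tau>} \<Longrightarrow> (q has_vector_derivative q' t) (at t within {0..\<tau>})"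
    "\<And>t \<phi>. t \<in> {0..\<tau>} \<Longrightarrow> \<phi> \<in> V \<Longrightarrow> cinner (q' t) \<phi> = form \<sigma> (q t) \<phi>"
    by metis
  have qV: "\<And>t. t \<in> {0..\<tau>} \<Longrightarrow> q t \<in> V" and q_0: "q 0 = gproj q0" using q by (auto simp: discrete_solution_def)
  have "forced \<sigma> \<tau> (\<lambda>_. 0) q"
    by (rule forced_of_derivative[OF qV q'(1)]) (simp_all add: q'(2) cinner.zero_left)
  from forced_diff[OF this forced_flow_h[OF gproj_in_V[OF q0]]]
  have "forced \<sigma> \<tau> (\<lambda>_. 0) (\<lambda>t. q t - flow_h \<sigma> t (gproj q0))" by simp
  from norm_unforced_le[OF this t] show "v = flow_h \<sigma> t (gproj q0)"
    by (simp add: v q_0 flow_h_zero)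
qed

end

section \<open>Error estimates\<close>

lemma has_integral_reverse:
  fixes f :: "real \<Rightarrow> 'c::banach"
  assumes "(f has_integral I) {\<tau> - t..\<tau>}"
  shows "((\<lambda>s. f (\<tau> - s)) has_integral I) {0..t}"
proof -
  have "((\<lambda>s. f (s + \<tau>)) has_integral I) {- t..0}"
    using has_integral_shift_Icc_real[of f \<tau> I "- t" 0] assms by (simp add: o_def add.commute)
  then have "((\<lambda>s. f (- s + \<tau>)) has_integral I) {- 0..- (- t)}"
    by (rule has_integral_reflect_real[THEN iffD2])
  then show ?thesis by (simp add: algebra_simps)
qed

context galerkin
begin

text \<open>
  The projection is orthogonal for \<open>\<langle>\<cdot>, \<cdot>\<rangle>\<^sub>1\<^sub>/\<^sub>2\<close>, so the principal part of the equation is not affected by it.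
  There remain the projection error of the derivative and the change of argument in \<open>B\<close>.
\<close>

lemma forced_projected_trajectory:
  assumes x: "smooth_trajectory \<sigma> c \<tau> x x' R"
  shows "forced \<sigma> \<tau> (\<lambda>t. (gproj (x' t) - x' t) + (B (gproj (x t)) - c *\<^sub>R B (x t))) (\<lambda>t. gproj (x t))"
proof (rule forced_of_derivative)
  fix t assume t: "t \<in> {0..\<tau>}"
  have xD: "x s \<in> D0" "x' s \<in> D0" if "s \<in> {0..\<tau>}" for s
    by (rule smooth_trajectoryD[OF x that])+
  then have xDh: "x s \<in> Dh" "x' s \<in> Dh" if "s \<in> {0..\<tau>}" for s
    using that by (auto simp: dom_iff)
  show "gproj (x t) \<in> V" by (rule gproj_in_V[OF xDh(1)[OF t]])
  have "((\<lambda>t. A0 (x t)) has_vector_derivative A0 (x' t)) (at t within {0..\<tau>})"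
    by (rule smooth_trajectoryD(5)[OF x t])
  then have "((\<lambda>t. dinv (A0 (x t))) has_vector_derivative dinv (A0 (x' t))) (at t within {0..\<tau>})"
    by (rule bounded_linear.has_vector_derivative[OF bounded_linear_dinv])
  then show "((\<lambda>t. gproj (x t)) has_vector_derivative gproj (x' t)) (at t within {0..\<tau>})"
    unfolding gproj_eq_dinv[OF xD(2)[OF t]]
    by (rule has_vector_derivative_transform[rotated 2, OF _ t]) (simp add: gproj_eq_dinv xD)
  fix \<phi> assume \<phi>: "\<phi> \<in> V"
  have x'_eq: "x' t = generator \<sigma> c (x t)" by (rule smooth_trajectoryD(3)[OF x t])
  have "cinner (A0 (x t)) \<phi> = inner_half Ah (gproj (x t)) \<phi>"
    using inner_half_gproj[OF xDh(1)[OF t] \<phi>] cinner_A0_left[OF xD(1)[OF t] V_Dh[OF \<phi>]]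
    by (simp add: inner_half_def)
  then have "cinner (x' t) \<phi> = of_real \<sigma> * \<i> * inner_half Ah (gproj (x t)) \<phi> - c *\<^sub>R cinner (B (x t)) \<phi>"
    by (simp add: x'_eq generator_def cinner.diff_left cinner_scaleR_left cinner_scaleC_left scaleR_conv_of_real)
  then show "cinner (gproj (x' t)) \<phi> = form \<sigma> (gproj (x t)) \<phi>
      + cinner ((gproj (x' t) - x' t) + (B (gproj (x t)) - c *\<^sub>R B (x t))) \<phi>"
    by (simp add: form_def cinner.diff_left cinner.add_left cinner_scaleR_left)
qed

definition Lh :: "real \<Rightarrow> 'a \<Rightarrow> 'a" where
  "Lh \<tau> v = flow_h (-1) \<tau> (flow_h 1 \<tau> v)"

lemma Lh_in_V: "v \<in> V \<Longrightarrow> Lh \<tau> v \<in> V"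
  by (simp add: Lh_def flow_h_in_V)

lemma Lh_add: "Lh \<tau> (u + v) = Lh \<tau> u + Lh \<tau> v" and Lh_diff: "Lh \<tau> (u - v) = Lh \<tau> u - Lh \<tau> v"
  by (simp_all add: Lh_def flow_h_add flow_h_diff)

lemma norm_Lh_le: "v \<in> V \<Longrightarrow> 0 \<le> \<tau> \<Longrightarrow> norm (Lh \<tau> v) \<le> norm v"
  using norm_flow_h_le[of "flow_h 1 \<tau> v" \<tau> "-1"] norm_flow_h_le[of v \<tau> 1]
  by (simp add: Lh_def flow_h_in_V)

lemma Lh_funpow_in_V: "v \<in> V \<Longrightarrow> (Lh \<tau> ^^ n) v \<in> V"
  by (induction n) (simp_all add: Lh_in_V)

lemma norm_Lh_funpow_le: "v \<in> V \<Longrightarrow> 0 \<le> \<tau> \<Longrightarrow> norm ((Lh \<tau> ^^ n) v) \<le> norm v"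
  by (induction n) (auto intro: order_trans[OF norm_Lh_le] Lh_funpow_in_V)

lemma Lh_funpow_add: "(Lh \<tau> ^^ n) (u + v) = (Lh \<tau> ^^ n) u + (Lh \<tau> ^^ n) v"
  by (induction n) (simp_all add: Lh_add)

lemma Lh_funpow_diff: "(Lh \<tau> ^^ n) (u - v) = (Lh \<tau> ^^ n) u - (Lh \<tau> ^^ n) v"
  by (induction n) (simp_all add: Lh_diff)

lemma discrete_L_eq:
  assumes "q \<in> Dh" "0 \<le> \<tau>"
  shows "discrete_L Ah C V \<tau> q = Lh \<tau> (gproj q)"
proof -
  have t: "\<tau> \<in> {0..\<tau>}" using assms by simp
  have v: "flow_h 1 \<tau> (gproj q) \<in> V" by (intro flow_h_in_V gproj_in_V assms)
  show ?thesis
    using discrete_semigroup_eq[OF assms(1) t, of 1] discrete_semigroup_eq[OF V_Dh[OF v] t, of "-1"]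
    by (simp add: discrete_L_def Lh_def gproj_id[OF v])
qed

lemma discrete_L_funpow_eq:
  assumes "v \<in> V" "0 \<le> \<tau>"
  shows "(discrete_L Ah C V \<tau> ^^ n) v = (Lh \<tau> ^^ n) v"
  by (induction n) (simp_all add: assms discrete_L_eq V_Dh gproj_id Lh_funpow_in_V)

text \<open>The Neumann sum telescopes, as for the exact operator.\<close>

lemma sum_Lh_funpow:
  "(\<Sum>n = 0..N. (Lh \<tau> ^^ n) (p - Lh \<tau> p + r)) = p - (Lh \<tau> ^^ Suc N) p + (\<Sum>n = 0..N. (Lh \<tau> ^^ n) r)"
proof (induction N)
  case (Suc N)
  have "(Lh \<tau> ^^ Suc N) (p - Lh \<tau> p + r) = (Lh \<tau> ^^ Suc N) p - (Lh \<tau> ^^ Suc (Suc N)) p + (Lh \<tau> ^^ Suc N) r"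
    unfolding Lh_funpow_add Lh_funpow_diff funpow_Suc_right[of "Suc N"] comp_apply ..
  then show ?case using Suc by (simp del: funpow.simps)
qed (simp add: Lh_diff)

context
  fixes \<nu> :: real
  assumes \<nu>: "0 \<le> \<nu>" and approx: "\<And>\<phi>. \<phi> \<in> D0 \<Longrightarrow> norm (gproj \<phi> - \<phi>) \<le> \<nu> * norm (A0 \<phi>)"
begin

lemma norm_B_gproj_le:
  assumes "x \<in> D0" "norm (A0 x) \<le> R"
  shows "norm (B (gproj x - x)) \<le> \<beta> * (\<nu> * R)"
  using assms \<beta>_nonneg \<nu>
  by (intro order_trans[OF norm_B_le] mult_left_mono order_trans[OF approx]) auto

text \<open>
  The projected orbit and the discrete orbit start at the same point and solve the same Galerkin equation
  up to the consistency error, so the energy estimate applies to their difference.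
\<close>

lemma semigroup_error:
  assumes x: "smooth_trajectory \<sigma> 1 \<tau> x x' R" and \<tau>: "0 \<le> \<tau>"
  shows "norm (gproj (x \<tau>) - flow_h \<sigma> \<tau> (gproj (x 0))) \<le> (1 + \<beta>) * \<nu> * \<tau> * R"
proof -
  have x0: "x 0 \<in> Dh" using smooth_trajectoryD(1)[OF x, of 0] \<tau> by (simp add: dom_iff)
  define g where "g t = (gproj (x' t) - x' t) + (B (gproj (x t)) - 1 *\<^sub>R B (x t)) - 0" for t
  have "forced \<sigma> \<tau> g (\<lambda>t. gproj (x t) - flow_h \<sigma> t (gproj (x 0)))"
    unfolding g_def by (rule forced_diff[OF forced_projected_trajectory[OF x] forced_flow_h[OF gproj_in_V[OF x0]]])
  then have "norm (gproj (x \<tau>) - flow_h \<sigma> \<tau> (gproj (x 0))) \<le>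
      norm (gproj (x 0) - flow_h \<sigma> 0 (gproj (x 0))) + integral {0..\<tau>} (\<lambda>_. (1 + \<beta>) * (\<nu> * R))"
  proof (rule energy_estimate[OF _ \<tau>])
    show "(\<lambda>_. (1 + \<beta>) * (\<nu> * R)) integrable_on {0..\<tau>}" by (rule integrable_const_ivl)
    fix t assume t: "t \<in> {0..\<tau>}"
    note d = smooth_trajectoryD(1,2,6,7)[OF x t]
    have "g t = (gproj (x' t) - x' t) + B (gproj (x t) - x t)" by (simp add: g_def B_diff)
    then have "norm (g t) \<le> norm (gproj (x' t) - x' t) + norm (B (gproj (x t) - x t))"
      by (simp only: norm_triangle_ineq)
    moreover have "norm (gproj (x' t) - x' t) \<le> \<nu> * R"
      using d \<nu> by (intro order_trans[OF approx] mult_left_mono) auto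
    moreover have "norm (B (gproj (x t) - x t)) \<le> \<beta> * (\<nu> * R)" by (rule norm_B_gproj_le[OF d(1,3)])
    ultimately show "norm (g t) \<le> (1 + \<beta>) * (\<nu> * R)"
      unfolding distrib_right by linarith
  qed
  then show ?thesis using \<tau> by (simp add: flow_h_zero mult_ac)
qed

text \<open>
  \<open>A x\<close> is a combination of \<open>x'\<close> and \<open>B x\<close>, so \<open>A\<^sup>2 x\<close> is controlled by \<open>A x'\<close> and \<open>A B x\<close>.
\<close>

lemma norm_A0_A0_trajectory_le:
  assumes \<sigma>: "\<sigma> * \<sigma> = 1" and x: "smooth_trajectory \<sigma> 1 \<tau> x x' R" and t: "t \<in> {0..\<tau>}"
  shows "norm (A0 (A0 (x t))) \<le> (1 + KB) * R"
proof -
  note d = smooth_trajectoryD(1,2,3,6,7)[OF x t]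
  have "A0 (A0 (x t)) = A0 ((- \<i> * of_real \<sigma>) *\<^sub>C (x' t + B (x t)))"
    using A0_eq_generator[OF \<sigma>, of "x t" 1] d(3) by simp
  also have "\<dots> = (- \<i> * of_real \<sigma>) *\<^sub>C (A0 (x' t) + A0 (B (x t)))"
    by (simp only: selfadjoint_scaleC[OF sa selfadjoint_dom(2)[OF sa d(2) B_in_dom[OF d(1)]]]
        selfadjoint_add[OF sa d(2) B_in_dom[OF d(1)]])
  finally have "norm (A0 (A0 (x t))) = \<bar>\<sigma>\<bar> * norm (A0 (x' t) + A0 (B (x t)))"
    by (simp add: norm_scaleC norm_mult)
  also have "\<bar>\<sigma>\<bar> = 1" using \<sigma> unfolding square_eq_1_iff by auto
  also have "1 * norm (A0 (x' t) + A0 (B (x t))) \<le> R + KB * R"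
    using d KB by (intro order_trans[OF mult_1_left[THEN eq_refl]] order_trans[OF norm_triangle_ineq] add_mono
        order_trans[OF KB(2)] mult_left_mono) auto
  finally show ?thesis by (simp add: algebra_simps)
qed

context
  fixes Tp Tm :: "real \<Rightarrow> 'a \<Rightarrow> 'a" and \<tau> :: real
  assumes Tp: "contraction_evolution D0 (generator 1 1) Tp"
    and Tm: "contraction_evolution D0 (generator (-1) 1) Tm" and \<tau>: "0 \<le> \<tau>"
begin

lemma L_error:
  assumes q: "q \<in> square_dom D0 A0"
  shows "norm (gproj ((Tm \<tau> \<circ> Tp \<tau>) q) - Lh \<tau> (gproj q)) \<le> K4 * \<nu> * \<tau> * norm (A0 (A0 q))"
proof -
  have s: "(1::real) * 1 = 1" "(-1::real) * -1 = 1" "(0::real) \<le> 1" "(1::real) \<le> 1" by auto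
  let ?a = "norm (A0 (A0 q))"
  note xp = smooth_trajectory_evolution[OF s(1,3,4) Tp q, of \<tau>]
  have q': "Tp \<tau> q \<in> square_dom D0 A0" by (rule T_square_dom[OF s(1,3,4) Tp \<tau> q])
  note xm = smooth_trajectory_evolution[OF s(2,3,4) Tm q', of \<tau>]
  have a': "norm (A0 (A0 (Tp \<tau> q))) \<le> K3 * ?a"
    using norm_A0_A0_trajectory_le[OF s(1) xp, of \<tau>] \<tau> by (simp add: K3_def mult.assoc)
  have dom: "q \<in> Dh" "Tp \<tau> q \<in> Dh" using q q' by (auto simp: square_dom_def dom_iff)
  have 1: "norm (gproj (Tp \<tau> q) - flow_h 1 \<tau> (gproj q)) \<le> (1 + \<beta>) * \<nu> * \<tau> * (K2 * ?a)"
    using semigroup_error[OF xp \<tau>] by (simp add: contraction_evolutionD(1)[OF Tp])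
  have "norm (gproj (Tm \<tau> (Tp \<tau> q)) - flow_h (-1) \<tau> (gproj (Tp \<tau> q)))
      \<le> (1 + \<beta>) * \<nu> * \<tau> * (K2 * norm (A0 (A0 (Tp \<tau> q))))"
    using semigroup_error[OF xm \<tau>] by (simp add: contraction_evolutionD(1)[OF Tm])
  also have "\<dots> \<le> (1 + \<beta>) * \<nu> * \<tau> * (K2 * (K3 * ?a))"
    using \<beta>_nonneg \<nu> \<tau> K2_nonneg by (intro mult_left_mono a') auto
  finally have 2: "norm (gproj (Tm \<tau> (Tp \<tau> q)) - flow_h (-1) \<tau> (gproj (Tp \<tau> q))) \<le> (1 + \<beta>) * \<nu> * \<tau> * (K2 * (K3 * ?a))" .
  have "norm (flow_h (-1) \<tau> (gproj (Tp \<tau> q) - flow_h 1 \<tau> (gproj q))) \<le> norm (gproj (Tp \<tau> q) - flow_h 1 \<tau> (gproj q))"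
    by (intro norm_flow_h_le \<tau> V_closed_ops(3) gproj_in_V flow_h_in_V dom)
  then have "norm (gproj ((Tm \<tau> \<circ> Tp \<tau>) q) - Lh \<tau> (gproj q)) \<le>
     (1 + \<beta>) * \<nu> * \<tau> * (K2 * (K3 * ?a)) + (1 + \<beta>) * \<nu> * \<tau> * (K2 * ?a)"
    using 1 2 norm_triangle_ineq[of "gproj (Tm \<tau> (Tp \<tau> q)) - flow_h (-1) \<tau> (gproj (Tp \<tau> q))"
        "flow_h (-1) \<tau> (gproj (Tp \<tau> q) - flow_h 1 \<tau> (gproj q))"]
    by (simp add: Lh_def flow_h_diff)
  then show ?thesis by (simp add: K4_def algebra_simps)
qed

text \<open>
  \<open>\<pi> L\<^sup>n\<^sup>+\<^sup>1 q - L\<^sub>h\<^sup>n\<^sup>+\<^sup>1 \<pi> q = (\<pi> L - L\<^sub>h \<pi>) L\<^sup>n q + L\<^sub>h (\<pi> L\<^sup>n q - L\<^sub>h\<^sup>n \<pi> q)\<close>. The first term is one consistency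
  error, uniformly in \<open>n\<close> by the graph norm bound; in the second, \<open>L\<^sub>h\<close> is a contraction.
\<close>

lemma L_funpow_error:
  assumes KL: "\<And>n. ((Tm \<tau> \<circ> Tp \<tau>) ^^ n) q \<in> square_dom D0 A0"
      "\<And>n. norm (A0 (A0 (((Tm \<tau> \<circ> Tp \<tau>) ^^ n) q))) \<le> a"
  shows "norm (gproj (((Tm \<tau> \<circ> Tp \<tau>) ^^ n) q) - (Lh \<tau> ^^ n) (gproj q)) \<le> real n * (K4 * \<nu> * \<tau> * a)"
proof (induction n)
  case (Suc n)
  define L where "L = Tm \<tau> \<circ> Tp \<tau>"
  define u v where "u = (L ^^ n) q" and "v = (Lh \<tau> ^^ n) (gproj q)"
  have u: "u \<in> square_dom D0 A0" "norm (A0 (A0 u)) \<le> a" and q: "q \<in> Dh"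
    using KL(1)[of n] KL(2)[of n] KL(1)[of 0] by (auto simp: u_def L_def square_dom_def dom_iff)
  then have dom: "gproj u \<in> V" "v \<in> V"
    by (auto intro!: gproj_in_V Lh_funpow_in_V simp: v_def square_dom_def dom_iff)
  have "norm (gproj (L u) - Lh \<tau> (gproj u)) \<le> K4 * \<nu> * \<tau> * norm (A0 (A0 u))"
    unfolding L_def by (rule L_error[OF u(1)])
  also have "\<dots> \<le> K4 * \<nu> * \<tau> * a" using K4_nonneg \<nu> \<tau> by (intro mult_left_mono u) auto
  finally have 1: "norm (gproj (L u) - Lh \<tau> (gproj u)) \<le> K4 * \<nu> * \<tau> * a" .
  have 2: "norm (Lh \<tau> (gproj u - v)) \<le> norm (gproj u - v)"
    by (intro norm_Lh_le \<tau> V_closed_ops(3) dom)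
  have 3: "norm (gproj u - v) \<le> real n * (K4 * \<nu> * \<tau> * a)"
    using Suc by (simp only: u_def v_def L_def)
  have "gproj (L u) - Lh \<tau> v = (gproj (L u) - Lh \<tau> (gproj u)) + Lh \<tau> (gproj u - v)"
    by (simp add: Lh_diff)
  then have "norm (gproj (L u) - Lh \<tau> v) \<le> norm (gproj (L u) - Lh \<tau> (gproj u)) + norm (Lh \<tau> (gproj u - v))"
    by (simp only: norm_triangle_ineq)
  also have "\<dots> \<le> real (Suc n) * (K4 * \<nu> * \<tau> * a)"
    using 1 2 3 by (simp add: algebra_simps)
  also have "L u = ((Tm \<tau> \<circ> Tp \<tau>) ^^ Suc n) q"
    unfolding u_def L_def funpow.simps(2) by (rule comp_apply[symmetric])
  also have "Lh \<tau> v = (Lh \<tau> ^^ Suc n) (gproj q)" by (simp add: v_def)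
  finally show ?case .
qed simp

end

text \<open>
  Up to sign and the data error, the error of the forward observer is the forward flow of the projected
  initial state, and the error of the backward observer, read backwards in time, is the backward flow of
  that. Hence the backward observer ends near \<open>(I - L\<^sub>h) \<pi> z\<^sub>0\<close>.
\<close>

lemma observer_error:
  assumes z: "smooth_trajectory 1 0 \<tau> z z' R" and \<tau>: "0 \<le> \<tau>"
    and zp: "forced 1 \<tau> (\<lambda>t. cadjoint C (yh t)) zp" "zp 0 = 0"
    and zm: "forced (-1) \<tau> (\<lambda>t. cadjoint C (yh (\<tau> - t))) (\<lambda>t. zm (\<tau> - t))" "zm \<tau> = zp \<tau>"
    and I: "((\<lambda>t. norm (cadjoint C (C (z t) - yh t))) has_integral I) {0..\<tau>}"
  shows "norm (zm 0 - gproj (z 0) + Lh \<tau> (gproj (z 0))) \<le> 2 * (I + (1 + \<beta>) * \<nu> * \<tau> * R)"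
proof -
  let ?c = "(1 + \<beta>) * (\<nu> * R)"
  define \<gamma> where "\<gamma> t = norm (cadjoint C (C (z t) - yh t)) + ?c" for t
  have \<gamma>_int: "(\<gamma> has_integral (I + \<tau> * ?c)) {0..\<tau>}"
    unfolding \<gamma>_def[abs_def] using has_integral_add[OF I has_integral_const_real[of ?c 0 \<tau>]] \<tau> by simp
  have \<gamma>_rev: "((\<lambda>t. \<gamma> (\<tau> - t)) has_integral (I + \<tau> * ?c)) {0..\<tau>}"
    by (rule has_integral_reverse) (simp add: \<gamma>_int)
  have bound: "norm (cadjoint C (yh t) - (w + (B (gproj (z t)) - 0 *\<^sub>R B (z t))) + 0) \<le> \<gamma> t"
    if t: "t \<in> {0..\<tau>}" and w: "norm w \<le> \<nu> * R" for t w
  proof -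
    note d = smooth_trajectoryD(1,6)[OF z t]
    have adj: "cadjoint C (C (z t) - yh t) = B (z t) - cadjoint C (yh t)"
      by (simp add: linear_diff[OF bounded_linear.linear[OF bounded_linear_adjC]])
    have "cadjoint C (yh t) - (w + (B (gproj (z t)) - 0 *\<^sub>R B (z t))) + 0
        = - (cadjoint C (C (z t) - yh t) + (w + B (gproj (z t) - z t)))"
      by (simp add: adj B_diff)
    also have "norm \<dots> \<le> norm (cadjoint C (C (z t) - yh t)) + (norm w + norm (B (gproj (z t) - z t)))"
      unfolding norm_minus_cancel by (rule order_trans[OF norm_triangle_ineq add_left_mono[OF norm_triangle_ineq]])
    also have "\<dots> \<le> \<gamma> t"
      using w norm_B_gproj_le[OF d] by (simp add: \<gamma>_def algebra_simps)
    finally show ?thesis .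
  qed
  have z'_le: "norm (gproj (z' t) - z' t) \<le> \<nu> * R" if "t \<in> {0..\<tau>}" for t
    by (rule order_trans[OF approx[OF smooth_trajectoryD(2)[OF z that]]
          mult_left_mono[OF smooth_trajectoryD(7)[OF z that] \<nu>]])
  have z0: "z 0 \<in> Dh" using smooth_trajectoryD(1)[OF z, of 0] \<tau> by (simp add: dom_iff)
  let ?p = "gproj (z 0)"
  have pV: "?p \<in> V" by (rule gproj_in_V[OF z0])
  note d1 = forced_add[OF forced_diff[OF zp(1) forced_projected_trajectory[OF z]] forced_flow_h[OF pV]]
  have 1: "norm (zp \<tau> - gproj (z \<tau>) + flow_h 1 \<tau> ?p)
      \<le> norm (zp 0 - gproj (z 0) + flow_h 1 0 ?p) + integral {0..\<tau>} \<gamma>"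
    by (rule energy_estimate[OF d1 \<tau>]) (use \<gamma>_int bound z'_le in \<open>auto simp: integrable_on_def\<close>)
  note zr = smooth_trajectory_reverse[OF z]
  note d2 = forced_add[OF forced_diff[OF zm(1) forced_projected_trajectory[OF zr]] forced_flow_h[OF flow_h_in_V[OF pV, of 1 \<tau>]]]
  have "norm (zm (\<tau> - \<tau>) - gproj (z (\<tau> - \<tau>)) + flow_h (-1) \<tau> (flow_h 1 \<tau> ?p))
      \<le> norm (zm (\<tau> - 0) - gproj (z (\<tau> - 0)) + flow_h (-1) 0 (flow_h 1 \<tau> ?p)) + integral {0..\<tau>} (\<lambda>t. \<gamma> (\<tau> - t))"
  proof (rule energy_estimate[OF d2 \<tau>])
    show "(\<lambda>t. \<gamma> (\<tau> - t)) integrable_on {0..\<tau>}" using \<gamma>_rev by (auto simp: integrable_on_def)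
    fix t assume t': "t \<in> {0..\<tau>}"
    then have t: "\<tau> - t \<in> {0..\<tau>}" by auto
    have "norm (gproj (- z' (\<tau> - t)) - - z' (\<tau> - t)) \<le> \<nu> * R"
      by (rule order_trans[OF approx[OF smooth_trajectoryD(2)[OF zr t']]
            mult_left_mono[OF smooth_trajectoryD(7)[OF zr t'] \<nu>]])
    from bound[OF t this]
    show "norm (cadjoint C (yh (\<tau> - t)) - (gproj (- z' (\<tau> - t)) - - z' (\<tau> - t)
        + (B (gproj (z (\<tau> - t))) - 0 *\<^sub>R B (z (\<tau> - t)))) + 0) \<le> \<gamma> (\<tau> - t)" .
  qed
  then have "norm (zm 0 - ?p + Lh \<tau> ?p) \<le> norm (zp \<tau> - gproj (z \<tau>) + flow_h 1 \<tau> ?p) + (I + \<tau> * ?c)"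
    using integral_unique[OF \<gamma>_rev] by (simp add: Lh_def flow_h_zero zm(2))
  also have "\<dots> \<le> 2 * (I + \<tau> * ?c)"
  proof -
    have "norm (zp \<tau> - gproj (z \<tau>) + flow_h 1 \<tau> ?p) \<le> I + \<tau> * ?c"
      using 1 unfolding integral_unique[OF \<gamma>_int] zp(2) flow_h_zero by simp
    then show ?thesis unfolding mult_2 by (rule add_right_mono)
  qed
  finally show ?thesis by (simp add: mult_ac)
qed

end

end

section \<open>Observers with integrable data\<close>

text \<open>
  Bochner measurability without a countable base: on the countably many level sets of the simple
  approximations the integrand depends continuously on time, and the exceptional set of the
  convergence is negligible for the completed measure.
\<close>

lemma L1_on_compose_measurable:
  fixes f :: "real \<Rightarrow> 'b::complex_hilbert" and \<Phi> :: "real \<Rightarrow> 'b \<Rightarrow> 'c::euclidean_space"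
  assumes f: "L1_on {a..b} f"
    and cont_t: "\<And>v. continuous_on {a..b} (\<lambda>t. \<Phi> t v)"
    and cont_v: "\<And>t. t \<in> {a..b} \<Longrightarrow> continuous_on UNIV (\<Phi> t)"
  shows "(\<lambda>t. \<Phi> t (f t)) \<in> borel_measurable (lebesgue_on {a..b})"
proof -
  let ?S = "{a..b}"
  let ?M = "lebesgue_on ?S"
  obtain s where s: "\<And>n. simple_function ?M (s n)" and lim: "AE t in ?M. (\<lambda>n. s n t) \<longlonglongrightarrow> f t"
    using f by (auto simp: L1_on_def)
  obtain N where N: "N \<in> null_sets ?M" "{t \<in> space ?M. \<not> (\<lambda>n. s n t) \<longlonglongrightarrow> f t} \<subseteq> N"
    using lim by (auto simp: eventually_ae_filter)
  have N_leb: "N \<in> null_sets lebesgue" "N \<subseteq> ?S"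
    using N(1) by (auto simp: null_sets_restrict_space)
  have meas: "(\<lambda>t. \<Phi> t (s n t)) \<in> borel_measurable ?M" for n
  proof (rule measurable_compose_countable'[where f = "\<lambda>v t. \<Phi> t v" and g = "s n" and I = "s n ` space ?M"])
    show "(\<lambda>t. \<Phi> t v) \<in> borel_measurable ?M" for v
      by (rule continuous_imp_measurable_on_sets_lebesgue[OF cont_t]) simp
    show "countable (s n ` space ?M)"
      using s[of n] by (simp add: simple_function_def countable_finite)
    show "s n \<in> ?M \<rightarrow>\<^sub>M count_space (s n ` space ?M)"
      using s[of n] by (auto simp: simple_function_def measurable_count_space_eq2)
  qed
  define g where "g n t = (if t \<in> ?S - N then \<Phi> t (s n t) else 0)" for n t
  define h where "h t = (if t \<in> ?S - N then \<Phi> t (f t) else 0)" for t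
  have diff: "?S - N \<in> sets lebesgue" using N_leb by auto
  have g_meas: "g n \<in> borel_measurable lebesgue" for n
  proof -
    have "(\<lambda>t. \<Phi> t (s n t)) \<in> borel_measurable (lebesgue_on (?S - N))"
      using measurable_restrict_mono[OF meas[of n], of "?S - N"] by auto
    then show ?thesis unfolding g_def[abs_def] by (rule borel_measurable_if[OF diff, THEN iffD2])
  qed
  have "h \<in> borel_measurable lebesgue"
  proof (rule borel_measurable_LIMSEQ_metric[OF g_meas])
    fix t :: real
    show "(\<lambda>n. g n t) \<longlonglongrightarrow> h t"
    proof (cases "t \<in> ?S - N")
      case True
      then have "(\<lambda>n. s n t) \<longlonglongrightarrow> f t" using N(2) by auto
      moreover have "isCont (\<Phi> t) (f t)"
        using cont_v[of t] True by (simp add: continuous_on_eq_continuous_at)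
      ultimately have "(\<lambda>n. \<Phi> t (s n t)) \<longlonglongrightarrow> \<Phi> t (f t)" by (rule isCont_tendsto_compose[rotated])
      then show ?thesis using True by (simp add: g_def h_def)
    qed (auto simp: g_def h_def)
  qed
  moreover have "AE t in lebesgue. h t = (if t \<in> ?S then \<Phi> t (f t) else 0)"
    using AE_not_in[OF N_leb(1)] by eventually_elim (auto simp: h_def)
  ultimately have "(\<lambda>t. if t \<in> ?S then \<Phi> t (f t) else 0) \<in> borel_measurable lebesgue"
    by (rule borel_measurable_AE)
  then show ?thesis by (rule borel_measurable_if[THEN iffD1, rotated]) simp
qed

lemma L1_on_compose_absolutely_integrable:
  fixes f :: "real \<Rightarrow> 'b::complex_hilbert" and \<Phi> :: "real \<Rightarrow> 'b \<Rightarrow> 'c::euclidean_space"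
  assumes f: "L1_on {a..b} f"
    and cont_t: "\<And>v. continuous_on {a..b} (\<lambda>t. \<Phi> t v)"
    and cont_v: "\<And>t. t \<in> {a..b} \<Longrightarrow> continuous_on UNIV (\<Phi> t)"
    and bound: "\<And>t v. t \<in> {a..b} \<Longrightarrow> norm (\<Phi> t v) \<le> k + K * norm v"
  shows "(\<lambda>t. \<Phi> t (f t)) absolutely_integrable_on {a..b}"
proof -
  let ?M = "lebesgue_on {a..b}"
  have "integrable ?M (\<lambda>t. k)"
    by (rule finite_measure.integrable_const[OF finite_measure_lebesgue_on]) simp
  moreover have "integrable ?M (\<lambda>t. norm (f t))" using f by (simp add: L1_on_def)
  ultimately have "integrable ?M (\<lambda>t. k + K * norm (f t))" by auto
  then have "integrable ?M (\<lambda>t. \<Phi> t (f t))"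
  proof (rule Bochner_Integration.integrable_bound)
    show "(\<lambda>t. \<Phi> t (f t)) \<in> borel_measurable ?M" by (rule L1_on_compose_measurable[OF f cont_t cont_v])
    show "AE t in ?M. norm (\<Phi> t (f t)) \<le> norm (k + K * norm (f t))"
      by (rule AE_I2) (use bound in \<open>auto intro: order_trans[OF _ abs_ge_self]\<close>)
  qed
  then show ?thesis
    unfolding set_integrable_def by (simp add: integrable_restrict_space)
qed

context galerkin
begin

lemma continuous_on_form:
  assumes "continuous_on S z" "\<And>t. t \<in> S \<Longrightarrow> z t \<in> V" "\<phi> \<in> V"
  shows "continuous_on S (\<lambda>t. form \<sigma> (z t) \<phi>)"
proof -
  have "continuous_on S (\<lambda>t. of_real \<sigma> * \<i> * cinner (AhV (z t)) (AhV \<phi>) - cinner (B (z t)) \<phi>)"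
    by (intro continuous_intros bounded_linear.continuous_on[OF cinner.bounded_linear_left]
        bounded_linear.continuous_on[OF bounded_clinearD(1)[OF bounded_clinear_AhV]]
        bounded_linear.continuous_on[OF bounded_linear_B] assms(1))
  then show ?thesis
    by (rule continuous_on_cong[THEN iffD1, rotated 2])
      (simp_all add: form_def inner_half_def AhV_V assms)
qed

lemma absolutely_integrable_forcing:
  assumes z: "continuous_on {0..\<tau>} z" "\<And>t. t \<in> {0..\<tau>} \<Longrightarrow> z t \<in> V" and \<phi>: "\<phi> \<in> V" and yh: "L1_on {0..\<tau>} yh"
  shows "(\<lambda>t. form \<sigma> (z t) \<phi> + cinner (cadjoint C (yh t)) \<phi>) absolutely_integrable_on {0..\<tau>}"
proof (rule set_integral_add(1))
  show "(\<lambda>t. form \<sigma> (z t) \<phi>) absolutely_integrable_on {0..\<tau>}"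
    by (rule absolutely_integrable_continuous_real[OF continuous_on_form[OF z \<phi>]])
  show "(\<lambda>t. cinner (cadjoint C (yh t)) \<phi>) absolutely_integrable_on {0..\<tau>}"
  proof (rule L1_on_compose_absolutely_integrable[OF yh, of "\<lambda>_ v. cinner (cadjoint C v) \<phi>" 0 "onorm (cadjoint C) * norm \<phi>"])
    show "continuous_on UNIV (\<lambda>v. cinner (cadjoint C v) \<phi>)"
      by (intro bounded_linear.continuous_on[OF cinner.bounded_linear_left]
          bounded_linear.continuous_on[OF bounded_linear_adjC] continuous_on_id)
    show "norm (cinner (cadjoint C v) \<phi>) \<le> 0 + onorm (cadjoint C) * norm \<phi> * norm v" for v
      using order_trans[OF cmod_cinner_le mult_right_mono[OF onorm[OF bounded_linear_adjC] norm_ge_zero], of v \<phi>]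
      by (simp add: mult_ac)
  qed auto
qed

lemma forced_forward_observer:
  assumes zp: "caratheodory_solution V \<tau>
       (\<lambda>t v \<phi>. \<i> * inner_half Ah v \<phi> - cinner (B v) \<phi> + cinner (cadjoint C (yh t)) \<phi>) zp"
    and yh: "L1_on {0..\<tau>} yh"
  shows "forced 1 \<tau> (\<lambda>t. cadjoint C (yh t)) zp"
  unfolding forced_def
proof (intro conjI ballI)
  have zV: "\<And>t. t \<in> {0..\<tau>} \<Longrightarrow> zp t \<in> V" and zc: "continuous_on {0..\<tau>} zp"
    using zp by (auto simp: caratheodory_solution_def)
  show "zp t \<in> V" if "t \<in> {0..\<tau>}" for t using zV that .
  show "continuous_on {0..\<tau>} zp" by (rule zc)
  fix \<phi> t assume \<phi>: "\<phi> \<in> V" and t: "t \<in> {0..\<tau>}"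
  have "(\<lambda>s. form 1 (zp s) \<phi> + cinner (cadjoint C (yh s)) \<phi>) absolutely_integrable_on {0..t}"
    by (rule set_integrable_subset[OF absolutely_integrable_forcing[OF zc zV \<phi> yh]]) (use t in auto)
  from has_integral_set_lebesgue[OF this]
  show "((\<lambda>s. form 1 (zp s) \<phi> + cinner (cadjoint C (yh s)) \<phi>) has_integral (cinner (zp t) \<phi> - cinner (zp 0) \<phi>)) {0..t}"
    using zp \<phi> t by (simp add: caratheodory_solution_def form_def)
qed

text \<open>
  Reversing time turns the equation of the backward observer, which is anti-dissipative, into a
  dissipative one, to which the energy estimate applies.
\<close>

lemma forced_backward_observer:
  assumes zm: "caratheodory_solution V \<tau>
       (\<lambda>t v \<phi>. \<i> * inner_half Ah v \<phi> + cinner (B v) \<phi> - cinner (cadjoint C (yh t)) \<phi>) zm"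
    and yh: "L1_on {0..\<tau>} yh" and \<tau>: "0 \<le> \<tau>"
  shows "forced (-1) \<tau> (\<lambda>t. cadjoint C (yh (\<tau> - t))) (\<lambda>t. zm (\<tau> - t))"
  unfolding forced_def
proof (intro conjI ballI)
  have zV: "\<And>t. t \<in> {0..\<tau>} \<Longrightarrow> zm t \<in> V" and zc: "continuous_on {0..\<tau>} zm"
    using zm by (auto simp: caratheodory_solution_def)
  show "zm (\<tau> - t) \<in> V" if "t \<in> {0..\<tau>}" for t using zV that by auto
  show "continuous_on {0..\<tau>} (\<lambda>t. zm (\<tau> - t))"
    by (rule continuous_on_compose2[OF zc]) (auto intro: continuous_intros)
  fix \<phi> t assume \<phi>: "\<phi> \<in> V" and t: "t \<in> {0..\<tau>}"
  let ?f = "\<lambda>s. form (-1) (zm s) \<phi> + cinner (cadjoint C (yh s)) \<phi>"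
  have abs: "?f absolutely_integrable_on {0..r}" if "r \<in> {0..\<tau>}" for r
    by (rule set_integrable_subset[OF absolutely_integrable_forcing[OF zc zV \<phi> yh]]) (use that in auto)
  have int: "integral {0..r} ?f = - (cinner (zm r) \<phi> - cinner (zm 0) \<phi>)" if r: "r \<in> {0..\<tau>}" for r
  proof -
    have "(\<lambda>s. \<i> * inner_half Ah (zm s) \<phi> + cinner (B (zm s)) \<phi> - cinner (cadjoint C (yh s)) \<phi>) = (\<lambda>s. - ?f s)"
      by (simp add: form_def fun_eq_iff)
    moreover have "cinner (zm r) \<phi> - cinner (zm 0) \<phi> = (LINT s:{0..r}|lebesgue.
        \<i> * inner_half Ah (zm s) \<phi> + cinner (B (zm s)) \<phi> - cinner (cadjoint C (yh s)) \<phi>)"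
      using zm \<phi> r unfolding caratheodory_solution_def by blast
    ultimately have "cinner (zm r) \<phi> - cinner (zm 0) \<phi> = (LINT s:{0..r}|lebesgue. - ?f s)" by (simp only:)
    also have "\<dots> = - (LINT s:{0..r}|lebesgue. ?f s)"
      unfolding set_lebesgue_integral_def scaleR_minus_right by (rule Bochner_Integration.integral_minus)
    also have "(LINT s:{0..r}|lebesgue. ?f s) = integral {0..r} ?f"
      by (rule set_lebesgue_integral_eq_integral(2)[OF abs[OF r]])
    finally show ?thesis by simp
  qed
  have integ: "?f integrable_on {0..\<tau>}"
    by (rule set_lebesgue_integral_eq_integral(1)[OF abs]) (use \<tau> in simp)
  have sub: "?f integrable_on {\<tau> - t..\<tau>}"
    by (rule integrable_on_subinterval[OF integ]) (use t in auto)
  have "integral {0..\<tau> - t} ?f + integral {\<tau> - t..\<tau>} ?f = integral {0..\<tau>} ?f"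
    by (rule Henstock_Kurzweil_Integration.integral_combine[OF _ _ integ]) (use t in auto)
  then have "integral {\<tau> - t..\<tau>} ?f = integral {0..\<tau>} ?f - integral {0..\<tau> - t} ?f"
    unfolding eq_diff_eq by (subst add.commute)
  also have "\<dots> = cinner (zm (\<tau> - t)) \<phi> - cinner (zm (\<tau> - 0)) \<phi>"
  proof -
    have "\<tau> \<in> {0..\<tau>}" "\<tau> - t \<in> {0..\<tau>}" using \<tau> t by auto
    from int[OF this(1)] int[OF this(2)] show ?thesis by simp
  qed
  finally have "(?f has_integral (cinner (zm (\<tau> - t)) \<phi> - cinner (zm (\<tau> - 0)) \<phi>)) {\<tau> - t..\<tau>}"
    using integrable_integral[OF sub] by simp
  from has_integral_reverse[OF this]
  show "((\<lambda>s. form (-1) (zm (\<tau> - s)) \<phi> + cinner (cadjoint C (yh (\<tau> - s))) \<phi>) has_integral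
      (cinner (zm (\<tau> - t)) \<phi> - cinner (zm (\<tau> - 0)) \<phi>)) {0..t}" .
qed

text \<open>
  With \<open>p = \<pi> z\<^sub>0\<close> and \<open>r = z\<^sub>h\<^sup>-(0) - p + L\<^sub>h p\<close>, the error is split as
  \<open>(z\<^sub>0 - p) - (\<pi> L\<^sup>N\<^sup>+\<^sup>1 z\<^sub>0 - L\<^sub>h\<^sup>N\<^sup>+\<^sup>1 p) + (\<pi> L\<^sup>N\<^sup>+\<^sup>1 z\<^sub>0 - L\<^sup>N\<^sup>+\<^sup>1 z\<^sub>0) + L\<^sup>N\<^sup>+\<^sup>1 z\<^sub>0 - \<Sum> L\<^sub>h\<^sup>n r\<close>. The
  projection errors do not carry a factor \<open>\<tau>\<close>, which is why the last factor of the bound contains its inverse.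
\<close>

lemma reconstruction_error:
  fixes N :: nat
  assumes \<nu>: "0 \<le> \<nu>" and approx: "\<And>\<phi>. \<phi> \<in> D0 \<Longrightarrow> norm (gproj \<phi> - \<phi>) \<le> \<nu> * norm (A0 \<phi>)"
    and Tp: "contraction_evolution D0 (generator 1 1) Tp"
    and Tm: "contraction_evolution D0 (generator (-1) 1) Tm" and \<tau>: "0 < \<tau>"
    and \<eta>: "0 \<le> \<eta>" "\<And>x. norm ((Tm \<tau> \<circ> Tp \<tau>) x) \<le> \<eta> * norm x"
    and KL: "0 \<le> KL" "\<And>n. ((Tm \<tau> \<circ> Tp \<tau>) ^^ n) z0 \<in> square_dom D0 A0"
      "\<And>n. norm (A0 (A0 (((Tm \<tau> \<circ> Tp \<tau>) ^^ n) z0))) \<le> KL * norm (A0 (A0 z0))"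
    and z: "system_solution D0 A0 z0 z" and y: "\<And>t. t \<in> {0..\<tau>} \<Longrightarrow> y t = C (z t)"
    and yh: "L1_on {0..\<tau>} yh" and obs: "discrete_observers Ah C V \<tau> yh zp zm" and N: "0 < N"
  shows "norm (z0 - (\<Sum>n = 0..N. (discrete_L Ah C V \<tau> ^^ n) (zm 0))) \<le>
    \<eta> ^ (N + 1) * (norm (A0 (A0 z0)) / m0\<^sup>2) +
    4 * real N * (LINT s:{0..\<tau>}|lebesgue. norm (cadjoint C (y s - yh s))) +
    \<nu> * \<tau> * (real N)\<^sup>2 * norm (A0 (A0 z0)) * ((1 + KL) / (m0 * \<tau>) + 2 * (K4 * KL + 2 * (1 + \<beta>) * K2))"
proof -
  let ?L = "Tm \<tau> \<circ> Tp \<tau>"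
  define a where "a = norm (A0 (A0 z0))"
  define I where "I = (LINT s:{0..\<tau>}|lebesgue. norm (cadjoint C (y s - yh s)))"
  define L where "L n = (?L ^^ n) z0" for n
  have \<tau>0: "0 \<le> \<tau>" using \<tau> by simp
  have z0: "z0 \<in> square_dom D0 A0" using KL(2)[of 0] by simp
  then have z0D: "z0 \<in> D0" "A0 z0 \<in> D0" "z0 \<in> Dh" by (auto simp: square_dom_def dom_iff)
  have s: "(1::real) * 1 = 1" "(0::real) \<le> 0" "(0::real) \<le> 1" by auto
  have LD: "L n \<in> D0" "A0 (L n) \<in> D0" "L n \<in> Dh" "norm (A0 (A0 (L n))) \<le> KL * a" for n
    using KL(2)[of n] KL(3)[of n] by (auto simp: L_def a_def square_dom_def dom_iff)
  have g0: "group 0 z0 = z0" by (rule contraction_evolutionD(1)[OF group_evolution])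
  have zg: "z t = group t z0" if "t \<in> {0..\<tau>}" for t
    by (rule system_solution_unique[OF z]) (use that in simp)
  note traj = smooth_trajectory_evolution[OF s group_evolution z0, of \<tau>]
  have g_cont: "continuous_on {0..\<tau>} (\<lambda>t. group t z0)"
    by (rule continuous_on_vector_derivative[OF smooth_trajectoryD(4)[OF traj]])
  define K where "K = onorm (cadjoint C)"
  have K: "norm (cadjoint C v) \<le> K * norm v" "0 \<le> K" for v
    unfolding K_def by (rule onorm[OF bounded_linear_adjC], rule onorm_pos_le[OF bounded_linear_adjC])
  have Cg_cont: "continuous_on {0..\<tau>} (\<lambda>t. C (group t z0))"
    by (rule bounded_linear.continuous_on[OF bounded_linear_C g_cont])
  have data_int: "(\<lambda>t. norm (cadjoint C (C (group t z0) - yh t))) absolutely_integrable_on {0..\<tau>}"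
  proof (rule L1_on_compose_absolutely_integrable[OF yh, of "\<lambda>t v. norm (cadjoint C (C (group t z0) - v))"
        "K * (onorm C * norm z0)" K])
    show "continuous_on {0..\<tau>} (\<lambda>t. norm (cadjoint C (C (group t z0) - v)))" for v
      by (intro continuous_on_norm bounded_linear.continuous_on[OF bounded_linear_adjC] continuous_on_diff Cg_cont continuous_on_const)
    show "continuous_on UNIV (\<lambda>v. norm (cadjoint C (C (group t z0) - v)))" for t
      by (intro continuous_on_norm bounded_linear.continuous_on[OF bounded_linear_adjC] continuous_intros)
    fix t v assume t: "t \<in> {0..\<tau>}"
    have "norm (C (group t z0)) \<le> onorm C * norm z0"
      using t by (intro order_trans[OF onorm[OF bounded_linear_C]] mult_left_mono onorm_pos_le[OF bounded_linear_C] norm_group_le) auto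
    then have "norm (C (group t z0) - v) \<le> onorm C * norm z0 + norm v"
      using norm_triangle_ineq4[of "C (group t z0)" v] by linarith
    then have "norm (cadjoint C (C (group t z0) - v)) \<le> K * (onorm C * norm z0 + norm v)"
      by (intro order_trans[OF K(1)] mult_left_mono K(2))
    then show "norm (norm (cadjoint C (C (group t z0) - v))) \<le> K * (onorm C * norm z0) + K * norm v"
      by (simp add: distrib_left)
  qed
  have I_eq: "I = (LINT t:{0..\<tau>}|lebesgue. norm (cadjoint C (C (group t z0) - yh t)))"
    unfolding I_def by (rule set_lebesgue_integral_cong) (auto simp: y zg)
  have I: "((\<lambda>t. norm (cadjoint C (C (group t z0) - yh t))) has_integral I) {0..\<tau>}"
    unfolding I_eq by (rule has_integral_set_lebesgue[OF data_int])
  have I0: "0 \<le> I" by (rule has_integral_nonneg[OF I]) simp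
  have obs_p: "forced 1 \<tau> (\<lambda>t. cadjoint C (yh t)) zp" "zp 0 = 0"
    and obs_m: "forced (-1) \<tau> (\<lambda>t. cadjoint C (yh (\<tau> - t))) (\<lambda>t. zm (\<tau> - t))" "zm \<tau> = zp \<tau>"
    using obs forced_forward_observer[OF _ yh] forced_backward_observer[OF _ yh \<tau>0] by (auto simp: discrete_observers_def)
  have zmV: "zm 0 \<in> V" using obs \<tau>0 by (auto simp: discrete_observers_def caratheodory_solution_def)
  define p where "p = gproj z0"
  have pV: "p \<in> V" unfolding p_def by (rule gproj_in_V[OF z0D(3)])
  define r where "r = zm 0 - p + Lh \<tau> p"
  have rV: "r \<in> V" unfolding r_def by (intro V_closed_ops zmV pV Lh_in_V)
  have r_le: "norm r \<le> 2 * (I + (1 + \<beta>) * \<nu> * \<tau> * (K2 * a))"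
    using observer_error[OF \<nu> approx traj \<tau>0 obs_p obs_m I] by (simp add: r_def p_def a_def g0)
  have sum_eq: "(\<Sum>n = 0..N. (discrete_L Ah C V \<tau> ^^ n) (zm 0)) = p - (Lh \<tau> ^^ Suc N) p + (\<Sum>n = 0..N. (Lh \<tau> ^^ n) r)"
  proof -
    have "zm 0 = p - Lh \<tau> p + r" by (simp add: r_def)
    then have "(\<Sum>n = 0..N. (discrete_L Ah C V \<tau> ^^ n) (zm 0)) = (\<Sum>n = 0..N. (Lh \<tau> ^^ n) (p - Lh \<tau> p + r))"
      using discrete_L_funpow_eq[OF zmV \<tau>0] by simp
    then show ?thesis by (simp only: sum_Lh_funpow)
  qed
  have sum_r: "norm (\<Sum>n = 0..N. (Lh \<tau> ^^ n) r) \<le> real (N + 1) * norm r"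
    using sum_norm_bound[of "{0..N}" "\<lambda>n. (Lh \<tau> ^^ n) r" "norm r"] norm_Lh_funpow_le[OF rV \<tau>0] by simp
  have e0: "norm (z0 - p) \<le> \<nu> * (a / m0)"
    using order_trans[OF approx[OF z0D(1)] mult_left_mono[OF norm_le_norm_A0[OF z0D(2)] \<nu>]]
    by (simp add: p_def a_def norm_minus_commute)
  have e1: "norm (gproj (L (Suc N)) - (Lh \<tau> ^^ Suc N) p) \<le> real (Suc N) * (K4 * \<nu> * \<tau> * (KL * a))"
    unfolding L_def p_def a_def by (rule L_funpow_error[OF \<nu> approx Tp Tm \<tau>0 KL(2,3)])
  have e2: "norm (gproj (L (Suc N)) - L (Suc N)) \<le> \<nu> * (KL * a / m0)"
  proof (rule order_trans[OF approx[OF LD(1)] mult_left_mono[OF _ \<nu>]])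
    have "norm (A0 (L (Suc N))) \<le> norm (A0 (A0 (L (Suc N)))) / m0" by (rule norm_le_norm_A0[OF LD(2)])
    also have "\<dots> \<le> KL * a / m0" using m0(1) LD(4) by (intro divide_right_mono) auto
    finally show "norm (A0 (L (Suc N))) \<le> KL * a / m0" .
  qed
  have "norm (L n) \<le> \<eta> ^ n * norm z0" for n
  proof (induction n)
    case (Suc n)
    have "L (Suc n) = ?L (L n)" unfolding L_def funpow.simps(2) by (rule comp_apply)
    then have "norm (L (Suc n)) \<le> \<eta> * norm (L n)" using \<eta>(2)[of "L n"] by (simp only:)
    also have "\<dots> \<le> \<eta> * (\<eta> ^ n * norm z0)" by (intro mult_left_mono Suc \<eta>(1))
    finally show ?case by simp
  qed (simp add: L_def)
  then have "norm (L (Suc N)) \<le> \<eta> ^ (N + 1) * norm z0" by (metis Suc_eq_plus1)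
  also have "norm z0 \<le> a / m0\<^sup>2"
    using norm_le_norm_A0[OF z0D(1)] divide_right_mono[OF norm_le_norm_A0[OF z0D(2)], of m0] m0(1)
    by (simp add: a_def power2_eq_square)
  finally have e3: "norm (L (Suc N)) \<le> \<eta> ^ (N + 1) * (a / m0\<^sup>2)"
    using \<eta>(1) by (simp add: mult_left_mono)
  have tri: "norm (u - v + w + x - x') \<le> norm u + norm v + norm w + norm x + norm x'" for u v w x x' :: 'a
    using norm_triangle_ineq4[of "u - v + w + x" x'] norm_triangle_ineq[of "u - v + w" x]
      norm_triangle_ineq[of "u - v" w] norm_triangle_ineq4[of u v] by linarith
  define \<kappa> where "\<kappa> = (1 + KL) / (m0 * \<tau>)"
  have \<kappa>: "\<nu> * (a / m0) + \<nu> * (KL * a / m0) = \<nu> * \<tau> * a * \<kappa>"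
    using m0(1) \<tau> by (simp add: \<kappa>_def field_simps)
  have split: "z0 - (\<Sum>n = 0..N. (discrete_L Ah C V \<tau> ^^ n) (zm 0)) =
      (z0 - p) - (gproj (L (Suc N)) - (Lh \<tau> ^^ Suc N) p) + (gproj (L (Suc N)) - L (Suc N)) + L (Suc N)
        - (\<Sum>n = 0..N. (Lh \<tau> ^^ n) r)"
    unfolding sum_eq by simp
  have "norm (z0 - (\<Sum>n = 0..N. (discrete_L Ah C V \<tau> ^^ n) (zm 0)))
      \<le> norm (z0 - p) + norm (gproj (L (Suc N)) - (Lh \<tau> ^^ Suc N) p) + norm (gproj (L (Suc N)) - L (Suc N))
      + norm (L (Suc N)) + norm (\<Sum>n = 0..N. (Lh \<tau> ^^ n) r)"
    unfolding split by (rule tri)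
  also have "\<dots> \<le> (\<nu> * (a / m0) + \<nu> * (KL * a / m0)) + real (Suc N) * (K4 * \<nu> * \<tau> * (KL * a))
      + \<eta> ^ (N + 1) * (a / m0\<^sup>2) + real (N + 1) * (2 * (I + (1 + \<beta>) * \<nu> * \<tau> * (K2 * a)))"
  proof -
    have "norm (\<Sum>n = 0..N. (Lh \<tau> ^^ n) r) \<le> real (N + 1) * (2 * (I + (1 + \<beta>) * \<nu> * \<tau> * (K2 * a)))"
      by (rule order_trans[OF sum_r mult_left_mono[OF r_le]]) simp
    from add_mono[OF add_mono[OF add_mono[OF add_mono[OF e0 e1] e2] e3] this]
    show ?thesis by (simp only: ac_simps)
  qed
  also have "\<dots> = \<eta> ^ (N + 1) * (a / m0\<^sup>2) + 2 * real (N + 1) * I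
      + \<nu> * \<tau> * a * (1 * \<kappa> + real (N + 1) * (K4 * KL + 2 * (1 + \<beta>) * K2))"
    unfolding \<kappa> by (simp add: algebra_simps)
  also have "\<dots> \<le> \<eta> ^ (N + 1) * (a / m0\<^sup>2) + 4 * real N * I
      + \<nu> * \<tau> * a * ((real N)\<^sup>2 * \<kappa> + (2 * (real N)\<^sup>2) * (K4 * KL + 2 * (1 + \<beta>) * K2))"
  proof -
    have N1: "1 \<le> real N" using N by simp
    have N2: "1 \<le> (real N)\<^sup>2" "real N \<le> (real N)\<^sup>2"
      by (rule one_le_power[OF N1], rule self_le_power[OF N1]) simp
    have "0 \<le> K4 * KL + 2 * (1 + \<beta>) * K2" using K4_nonneg KL(1) \<beta>_nonneg K2_nonneg by simp
    moreover have "0 \<le> \<kappa>" using KL(1) m0(1) \<tau> by (simp add: \<kappa>_def)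
    moreover have "real (N + 1) \<le> 2 * (real N)\<^sup>2"
      unfolding of_nat_add of_nat_1 using N1 N2 by linarith
    moreover have "0 \<le> \<nu> * \<tau> * a" using \<nu> \<tau> by (simp add: a_def)
    moreover have "2 * real (N + 1) \<le> 4 * real N" using N1 by simp
    ultimately show ?thesis
      using N2 I0 by (intro add_mono order_refl mult_right_mono mult_left_mono) (assumption | simp)+
  qed
  also have "\<dots> = \<eta> ^ (N + 1) * (a / m0\<^sup>2) + 4 * real N * I
      + \<nu> * \<tau> * (real N)\<^sup>2 * a * (\<kappa> + 2 * (K4 * KL + 2 * (1 + \<beta>) * K2))"
    by (simp add: algebra_simps)
  finally show ?thesis unfolding a_def I_def \<kappa>_def .
qed

end

theorem theorem2p1:
  fixes D0 :: "'a::complex_hilbert set" and A0 :: "'a \<Rightarrow> 'a"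
    and Dh :: "'a set" and Ah :: "'a \<Rightarrow> 'a"
    and C :: "'a \<Rightarrow> 'b::complex_hilbert"
    and Tp Tm :: "real \<Rightarrow> 'a \<Rightarrow> 'a"
    and X :: "real \<Rightarrow> 'a set" and \<theta> :: real
  assumes "selfadjoint_operator D0 A0" and "strictly_positive_operator D0 A0"
    and "sqrt_operator D0 A0 Dh Ah"
    and "bounded_clinear C"
    and "bounded_on_domain (square_dom D0 A0) (\<lambda>x. norm (A0 (A0 x))) (cadjoint C \<circ> C)"
    and "bounded_on_domain D0 (\<lambda>x. norm (A0 x)) (cadjoint C \<circ> C)"
    and "generates D0 (\<lambda>x. \<i> *\<^sub>C A0 x - cadjoint C (C x)) Tp"
    and "generates D0 (\<lambda>x. - (\<i> *\<^sub>C A0 x) - cadjoint C (C x)) Tm"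
    and "\<forall>h>0. galerkin_space Dh (X h)"
    and "\<theta> > 0" and "approximation_property Dh Ah X \<theta>"
  shows "\<exists>M>0. \<forall>\<tau>>0. exactly_observable D0 A0 C \<tau> \<longrightarrow>
    (let \<eta> = onorm (Tm \<tau> \<circ> Tp \<tau>) in
     \<exists>hs>0. \<forall>z0\<in>square_dom D0 A0. \<forall>z :: real \<Rightarrow> 'a. \<forall>y :: real \<Rightarrow> 'b.
       \<forall>yh :: real \<Rightarrow> real \<Rightarrow> 'b. \<forall>N :: real \<Rightarrow> nat. \<forall>zp zm :: real \<Rightarrow> real \<Rightarrow> 'a. \<forall>z0h :: real \<Rightarrow> 'a.
         system_solution D0 A0 z0 z \<and>
         (\<forall>t\<in>{0..\<tau>}. y t = C (z t)) \<and>
         (\<forall>h>0. L1_on {0..\<tau>} (yh h) \<and> N h > 0 \<and>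
            discrete_observers Ah C (X h) \<tau> (yh h) (zp h) (zm h) \<and>
            z0h h = (\<Sum>n = 0..N h. (discrete_L Ah C (X h) \<tau> ^^ n) (zm h 0))) \<longrightarrow>
         (\<forall>h\<in>{0<..<hs}.
            norm (z0 - z0h h) \<le>
              M * ((\<eta> ^ (N h + 1) / (1 - \<eta>) + h powr \<theta> * \<tau> * (real (N h))\<^sup>2) * norm (A0 (A0 z0))
                   + real (N h) * (LINT s:{0..\<tau>}|lebesgue. norm (cadjoint C (y s - yh h s))))))"
proof -
  interpret observed_system D0 A0 Dh Ah C
    by unfold_locales (fact assms)+
  have gen: "generator 1 1 = (\<lambda>x. \<i> *\<^sub>C A0 x - B x)" "generator (-1) 1 = (\<lambda>x. - (\<i> *\<^sub>C A0 x) - B x)"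
    by (simp_all add: generator_def fun_eq_iff)
  have diss: "inner x (generator \<sigma> 1 x) \<le> 0" if "x \<in> D0" for x \<sigma>
    by (simp add: inner_generator[OF that])
  have Tp: "contraction_evolution D0 (generator 1 1) Tp"
    by (rule contraction_evolution_of_generator[OF _ selfadjoint_dense[OF sa] diss]) (simp add: gen assms(7))
  have Tm: "contraction_evolution D0 (generator (-1) 1) Tm"
    by (rule contraction_evolution_of_generator[OF _ selfadjoint_dense[OF sa] diss]) (simp add: gen assms(8))
  obtain M0 h0 where M0: "M0 > 0" and h0: "h0 > 0"
    and approx: "\<And>\<phi> h. \<phi> \<in> Dh \<Longrightarrow> h \<in> {0<..<h0} \<Longrightarrow>
        norm (galerkin_proj Ah (X h) \<phi> - \<phi>) \<le> M0 * h powr \<theta> * norm (Ah \<phi>)"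
    using assms(11) unfolding approximation_property_def by blast
  let "\<exists>M>0. \<forall>\<tau>>0. _ \<tau> \<longrightarrow> ?P M \<tau>" = ?thesis
  define M where "M = 4 + 1 / m0\<^sup>2"
  have M: "M > 0" "4 \<le> M" "1 \<le> M" "1 / m0\<^sup>2 \<le> M" using m0(1) by (auto simp: M_def add_pos_pos)
  show ?thesis
  proof (intro exI[of _ M] conjI M(1) allI impI)
    fix \<tau> :: real assume \<tau>: "0 < \<tau>" and obs: "exactly_observable D0 A0 C \<tau>"
    have \<tau>0: "0 \<le> \<tau>" using \<tau> by simp
    define \<eta> where "\<eta> = onorm (Tm \<tau> \<circ> Tp \<tau>)"
    have L_lin: "bounded_linear (Tm \<tau> \<circ> Tp \<tau>)"
      unfolding o_def
      by (rule bounded_linear_compose[OF bounded_clinearD(1) bounded_clinearD(1)])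
        (rule contraction_evolutionD(2)[OF Tm \<tau>0] contraction_evolutionD(2)[OF Tp \<tau>0])+
    obtain \<rho> where \<rho>: "0 \<le> \<rho>" "\<rho> < 1" "\<And>x. norm (Tp \<tau> x) \<le> \<rho> * norm x"
      using observability_imp_strict_contraction[OF Tp obs \<tau>] by blast
    have "\<eta> \<le> \<rho>"
      unfolding \<eta>_def
      by (rule onorm_bound[OF \<rho>(1)]) (use order_trans[OF contraction_evolutionD(3)[OF Tm \<tau>0] \<rho>(3)] in simp)
    then have \<eta>: "0 \<le> \<eta>" "\<eta> < 1" "\<And>x. norm ((Tm \<tau> \<circ> Tp \<tau>) x) \<le> \<eta> * norm x"
      using \<rho>(2) onorm_pos_le[OF L_lin] onorm[OF L_lin] by (auto simp: \<eta>_def)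
    obtain KL where KL: "0 \<le> KL" "\<And>q n. q \<in> square_dom D0 A0 \<Longrightarrow> ((Tm \<tau> \<circ> Tp \<tau>) ^^ n) q \<in> square_dom D0 A0"
      "\<And>q n. q \<in> square_dom D0 A0 \<Longrightarrow> norm (A0 (A0 (((Tm \<tau> \<circ> Tp \<tau>) ^^ n) q))) \<le> KL * norm (A0 (A0 q))"
      using power_graph_bound[OF Tp Tm \<tau>0 \<eta>(1,2)] \<eta>(3) unfolding comp_apply by blast
    define K where "K = M0\<^sup>2 * ((1 + KL) / (m0 * \<tau>) + 2 * (K4 * KL + 2 * (1 + \<beta>) * K2))"
    have K: "0 \<le> K"
      using KL(1) m0(1) \<tau> K4_nonneg \<beta>_nonneg K2_nonneg by (simp add: K_def)
    \<comment> \<open>For \<open>h < hs\<close> one of the two factors \<open>h powr \<theta>\<close> absorbs \<open>K\<close>, which depends on \<open>\<tau>\<close>.\<close>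
    define hs where "hs = min h0 ((1 / (K + 1)) powr (1 / \<theta>))"
    have hs: "hs > 0" using h0 K by (simp add: hs_def)
    have small: "K * h powr \<theta> \<le> 1" if "h \<in> {0<..<hs}" for h
    proof -
      have "h powr \<theta> \<le> ((1 / (K + 1)) powr (1 / \<theta>)) powr \<theta>"
        using that assms(10) by (intro powr_mono2) (auto simp: hs_def)
      also have "\<dots> = 1 / (K + 1)" using assms(10) K by (simp add: powr_powr)
      finally have "(K + 1) * h powr \<theta> \<le> 1" using K by (simp add: field_simps)
      moreover have "K * h powr \<theta> \<le> (K + 1) * h powr \<theta>" by (intro mult_right_mono) auto
      ultimately show ?thesis by linarith
    qed
    show "?P M \<tau>"
      unfolding Let_def \<eta>_def[symmetric]
    proof (intro exI[of _ hs] conjI hs ballI allI impI, elim conjE)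
      fix z0 z y yhs Ns zps zms z0hs h
      assume z0: "z0 \<in> square_dom D0 A0" and h: "h \<in> {0<..<hs}" and z: "system_solution D0 A0 z0 z"
        and y: "\<forall>t\<in>{0..\<tau>}. y t = C (z t)"
        and H: "\<forall>h>0. L1_on {0..\<tau>} (yhs h) \<and> Ns h > 0 \<and>
            discrete_observers Ah C (X h) \<tau> (yhs h) (zps h) (zms h) \<and>
            z0hs h = (\<Sum>n = 0..Ns h. (discrete_L Ah C (X h) \<tau> ^^ n) (zms h 0))"
      define yh N zp zm where "yh = yhs h" and "N = Ns h" and "zp = zps h" and "zm = zms h"
      have yh: "L1_on {0..\<tau>} yh" and N: "N > 0" and obs_h: "discrete_observers Ah C (X h) \<tau> yh zp zm"
        and z0h: "z0hs h = (\<Sum>n = 0..N. (discrete_L Ah C (X h) \<tau> ^^ n) (zm 0))"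
        using H h by (simp_all add: yh_def N_def zp_def zm_def)
      interpret galerkin D0 A0 Dh Ah C "X h"
        by unfold_locales (use assms(9) h in simp)
      define a where "a = norm (A0 (A0 z0))"
      define I where "I = (LINT s:{0..\<tau>}|lebesgue. norm (cadjoint C (y s - yh s)))"
      define \<nu> where "\<nu> = (M0 * h powr \<theta>)\<^sup>2"
      have I0: "0 \<le> I"
        unfolding I_def set_lebesgue_integral_def by (rule integral_nonneg_AE) auto
      have approx2: "norm (gproj \<phi> - \<phi>) \<le> \<nu> * norm (A0 \<phi>)" if "\<phi> \<in> D0" for \<phi>
        unfolding \<nu>_def using M0 h that by (intro aubin_nitsche approx) (auto simp: hs_def)
      have "norm (z0 - z0hs h) \<le> \<eta> ^ (N + 1) * (a / m0\<^sup>2) + 4 * real N * I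
          + \<nu> * \<tau> * (real N)\<^sup>2 * a * ((1 + KL) / (m0 * \<tau>) + 2 * (K4 * KL + 2 * (1 + \<beta>) * K2))"
        unfolding z0h a_def I_def
        by (rule reconstruction_error[OF _ approx2 Tp Tm \<tau> \<eta>(1,3) KL(1) KL(2,3)[OF z0] z _ yh obs_h N])
          (use y in \<open>auto simp: \<nu>_def\<close>)
      also have "\<dots> = (1 / m0\<^sup>2) * (\<eta> ^ (N + 1) * a) + 4 * (real N * I) + (K * h powr \<theta>) * (h powr \<theta> * \<tau> * (real N)\<^sup>2 * a)"
        by (simp add: \<nu>_def K_def power2_eq_square algebra_simps)
      also have "\<dots> \<le> M * (\<eta> ^ (N + 1) / (1 - \<eta>) * a) + M * (real N * I) + M * (h powr \<theta> * \<tau> * (real N)\<^sup>2 * a)"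
      proof (intro add_mono)
        have "\<eta> ^ (N + 1) * (1 - \<eta>) \<le> \<eta> ^ (N + 1) * 1" using \<eta> by (intro mult_left_mono) auto
        then have "\<eta> ^ (N + 1) \<le> \<eta> ^ (N + 1) / (1 - \<eta>)" using \<eta>(2) by (simp add: pos_le_divide_eq)
        then show "1 / m0\<^sup>2 * (\<eta> ^ (N + 1) * a) \<le> M * (\<eta> ^ (N + 1) / (1 - \<eta>) * a)"
          using M \<eta> by (intro mult_mono mult_right_mono) (auto simp: a_def)
        show "4 * (real N * I) \<le> M * (real N * I)" using M I0 by (intro mult_right_mono) auto
        show "(K * h powr \<theta>) * (h powr \<theta> * \<tau> * (real N)\<^sup>2 * a) \<le> M * (h powr \<theta> * \<tau> * (real N)\<^sup>2 * a)"
          using small[OF h] M(3) \<tau>0 by (intro mult_right_mono) (auto simp: a_def)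
      qed
      also have "\<dots> = M * ((\<eta> ^ (N + 1) / (1 - \<eta>) + h powr \<theta> * \<tau> * (real N)\<^sup>2) * a + real N * I)"
        by (simp add: algebra_simps)
      finally show "norm (z0 - z0hs h) \<le>
          M * ((\<eta> ^ (Ns h + 1) / (1 - \<eta>) + h powr \<theta> * \<tau> * (real (Ns h))\<^sup>2) * norm (A0 (A0 z0))
            + real (Ns h) * (LINT s:{0..\<tau>}|lebesgue. norm (cadjoint C (y s - yhs h s))))"
        unfolding a_def I_def yh_def N_def .
    qed
  qed
qed

end
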